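(* Let $H$ be a reflexive tournament with strongly connected component decomposition $H = H_1 \Rightarrow \cdots \Rightarrow H_n$. If $|V(H_1)| = |V(H_n)| = 1$, then $\mathrm{QCSP}(H)$ is in $\mathrm{NL}$.
   Context: A digraph is reflexive if every vertex has a self-loop. A reflexive tournament is a reflexive digraph in which for every two distinct vertices $u,v$ exactly one of $(u,v)$, $(v,u)$ is an edge. Every reflexive tournament $H$ splits into its strongly connected components $H_1,\ldots,H_n$ ($n\ge 1$), ordered so that there is an edge from every vertex of $H_i$ to every vertex of $H_j$ if and only if $i<j$; this is written $H = H_1\Rightarrow\cdots\Rightarrow H_n$. For a digraph $H$, $\mathrm{QCSP}(H)$ is the problem: given a sentence $\forall x_1\exists y_1\cdots\forall x_m\exists y_m\,\Phi$, where $\Phi$ is a conjunction of atoms $E(u,v)$ over these variables, decide whether it is true in $H$ (with $E$ interpreted as the edge relation of $H$). *)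

theory Defs
  imports "Graph_Theory.Graph_Theory" "HOL-Library.Landau_Symbols"
begin

section \<open>Reflexive tournaments\<close>

definition reflexive_tournament :: "'v pair_pre_digraph \<Rightarrow> bool" where
  "reflexive_tournament H \<longleftrightarrow>
     pair_fin_digraph H \<and> pverts H \<noteq> {} \<and>
     (\<forall>v\<in>pverts H. (v, v) \<in> parcs H) \<and>
     (\<forall>u\<in>pverts H. \<forall>v\<in>pverts H. u \<noteq> v \<longrightarrow> ((u, v) \<in> parcs H \<longleftrightarrow> (v, u) \<notin> parcs H))"

text \<open>
  The ordering condition is imposed on distinct components only: a one-vertex component of a
  reflexive digraph trivially has all edges to itself.
\<close>

definition scc_decomposition ::
  "'v pair_pre_digraph \<Rightarrow> ('v, 'v \<times> 'v) pre_digraph list \<Rightarrow> bool" where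
  "scc_decomposition H Hs \<longleftrightarrow>
     distinct Hs \<and> set Hs = pre_digraph.sccs (with_proj H) \<and>
     (\<forall>i<length Hs. \<forall>j<length Hs. i \<noteq> j \<longrightarrow>
        ((\<forall>u\<in>verts (Hs ! i). \<forall>v\<in>verts (Hs ! j). (u, v) \<in> parcs H) \<longleftrightarrow> i < j))"

section \<open>Quantified constraint satisfaction\<close>

text \<open>
  An instance \<open>(m, \<Phi>)\<close> stands for the sentence
  \<open>\<forall>x\<^sub>1 \<exists>y\<^sub>1 \<dots> \<forall>x\<^sub>m \<exists>y\<^sub>m. \<Phi>\<close>, where \<open>\<Phi>\<close> lists the pairs \<open>(u, v)\<close> of the atoms
  \<open>E(u, v)\<close> of the conjunction.
\<close>

datatype qvar = X nat | Y nat

fun qindex :: "qvar \<Rightarrow> nat" where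
  "qindex (X i) = i"
| "qindex (Y i) = i"

type_synonym sentence = "nat \<times> (qvar \<times> qvar) list"

fun is_sentence :: "sentence \<Rightarrow> bool" where
  "is_sentence (m, \<Phi>) \<longleftrightarrow> (\<forall>(u, v)\<in>set \<Phi>. qindex u \<in> {1..m} \<and> qindex v \<in> {1..m})"

text \<open>
  \<open>quantify V i k P\<close> prefixes \<open>P\<close> with the \<open>k\<close> quantifier pairs
  \<open>\<forall>x\<^sub>i \<exists>y\<^sub>i \<dots> \<forall>x\<^bsub>i+k-1\<^esub> \<exists>y\<^bsub>i+k-1\<^esub>\<close>, ranging over \<open>V\<close>.
\<close>

primrec quantify ::
  "'v set \<Rightarrow> nat \<Rightarrow> nat \<Rightarrow> ((qvar \<Rightarrow> 'v) \<Rightarrow> bool) \<Rightarrow> (qvar \<Rightarrow> 'v) \<Rightarrow> bool" where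
  "quantify V i 0 P e \<longleftrightarrow> P e"
| "quantify V i (Suc k) P e \<longleftrightarrow>
     (\<forall>a\<in>V. \<exists>b\<in>V. quantify V (Suc i) k P (e(X i := a, Y i := b)))"

fun true_in :: "'v pair_pre_digraph \<Rightarrow> sentence \<Rightarrow> bool" where
  "true_in H (m, \<Phi>) \<longleftrightarrow>
     quantify (pverts H) 1 m (\<lambda>e. \<forall>(u, v)\<in>set \<Phi>. (e u, e v) \<in> parcs H) (\<lambda>_. undefined)"

text \<open>
  A sentence is written over a fixed finite alphabet: first its quantifier prefix, in which the
  \<open>i\<close>-th pair of quantifiers binds \<open>x\<^sub>i\<close> and \<open>y\<^sub>i\<close>, then its atoms. Indices are in binary, most
  significant bit first and without leading zeros.
\<close>

datatype token = QForall | QExists | Edge | VarX | VarY | Bit bool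

instance token :: finite
proof
  have "(UNIV :: token set) \<subseteq> {QForall, QExists, Edge, VarX, VarY} \<union> Bit ` UNIV"
  proof
    fix t :: token
    show "t \<in> {QForall, QExists, Edge, VarX, VarY} \<union> Bit ` UNIV" by (cases t) auto
  qed
  then show "finite (UNIV :: token set)" by (rule finite_subset) simp
qed

fun binary :: "nat \<Rightarrow> bool list" where
  "binary n = (if n = 0 then [] else binary (n div 2) @ [odd n])"

declare binary.simps [simp del]

fun encode_var :: "qvar \<Rightarrow> token list" where
  "encode_var (X i) = VarX # map Bit (binary i)"
| "encode_var (Y i) = VarY # map Bit (binary i)"

fun encode_atom :: "qvar \<times> qvar \<Rightarrow> token list" where
  "encode_atom (u, v) = Edge # encode_var u @ encode_var v"

fun encode :: "sentence \<Rightarrow> token list" where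
  "encode (m, \<Phi>) = concat (replicate m [QForall, QExists]) @ concat (map encode_atom \<Phi>)"

definition QCSP :: "'v pair_pre_digraph \<Rightarrow> token list set" where
  "QCSP H = {encode \<phi> | \<phi>. is_sentence \<phi> \<and> true_in H \<phi>}"

text \<open>The encoding is unambiguous.\<close>

lemma binary_inject: "binary m = binary n \<longleftrightarrow> m = n"
proof
  assume "binary m = binary n"
  then show "m = n"
  proof (induction m arbitrary: n rule: less_induct)
    case (less m)
    show ?case
    proof (cases "m = 0 \<or> n = 0")
      case True
      with less.prems show ?thesis
        by (auto simp: binary.simps[of m] binary.simps[of n] split: if_splits)
    next
      case False
      then have eq: "binary (m div 2) = binary (n div 2)" "odd m = odd n"
        using less.prems by (simp_all add: binary.simps[of m] binary.simps[of n])
      from False have "m div 2 < m" by simp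
      from less.IH[OF this eq(1)] have "m div 2 = n div 2" .
      with eq(2) show ?thesis
        by (metis even_two_times_div_two odd_two_times_div_two_succ)
    qed
  qed
qed simp

lemma map_Bit_append_inject:
  assumes "map Bit bs @ r = map Bit bs' @ r'"
    and "r = [] \<or> hd r \<notin> range Bit" and "r' = [] \<or> hd r' \<notin> range Bit"
  shows "bs = bs' \<and> r = r'"
  using assms
proof (induction bs arbitrary: bs')
  case Nil
  then show ?case by (cases bs') auto
next
  case (Cons b bs)
  then show ?case by (cases bs') auto
qed

lemma encode_var_append_inject:
  assumes "encode_var u @ r = encode_var u' @ r'"
    and "r = [] \<or> hd r \<notin> range Bit" and "r' = [] \<or> hd r' \<notin> range Bit"
  shows "u = u' \<and> r = r'"
proof (cases u)
  case (X i)
  with assms(1) obtain i' where u': "u' = X i'" by (cases u') auto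
  from assms(1) X u' have "map Bit (binary i) @ r = map Bit (binary i') @ r'" by simp
  from map_Bit_append_inject[OF this assms(2,3)] X u' show ?thesis by (simp add: binary_inject)
next
  case (Y i)
  with assms(1) obtain i' where u': "u' = Y i'" by (cases u') auto
  from assms(1) Y u' have "map Bit (binary i) @ r = map Bit (binary i') @ r'" by simp
  from map_Bit_append_inject[OF this assms(2,3)] Y u' show ?thesis by (simp add: binary_inject)
qed

lemma hd_encode_atoms:
  "concat (map encode_atom \<Phi>) = [] \<or> hd (concat (map encode_atom \<Phi>)) = Edge"
  by (cases \<Phi>) auto

lemma encode_atoms_inject:
  "concat (map encode_atom \<Phi>) = concat (map encode_atom \<Psi>) \<Longrightarrow> \<Phi> = \<Psi>"
proof (induction \<Phi> arbitrary: \<Psi>)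
  case Nil
  then show ?case by (cases \<Psi>) auto
next
  case (Cons a \<Phi>)
  obtain u v where a: "a = (u, v)" by (cases a)
  from Cons.prems a obtain u' v' \<Psi>' where \<Psi>: "\<Psi> = (u', v') # \<Psi>'"
    by (cases \<Psi>) auto
  have var_hd: "hd (encode_var w @ xs) \<notin> range Bit" for w xs by (cases w) auto
  have rest: "concat (map encode_atom \<Xi>) = [] \<or> hd (concat (map encode_atom \<Xi>)) \<notin> range Bit"
    for \<Xi> using hd_encode_atoms[of \<Xi>] by auto
  from Cons.prems a \<Psi> have eq: "encode_var u @ (encode_var v @ concat (map encode_atom \<Phi>)) =
      encode_var u' @ (encode_var v' @ concat (map encode_atom \<Psi>'))" by simp
  from encode_var_append_inject[OF eq] var_hd
  have "u = u'" and eq': "encode_var v @ concat (map encode_atom \<Phi>) =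
      encode_var v' @ concat (map encode_atom \<Psi>')" by blast+
  from encode_var_append_inject[OF eq' rest rest]
  have "v = v'" and "concat (map encode_atom \<Phi>) = concat (map encode_atom \<Psi>')" by auto
  with Cons.IH \<open>u = u'\<close> a \<Psi> show ?case by simp
qed

lemma inj_encode: "inj encode"
proof (rule injI)
  fix \<phi> \<psi> assume eq: "encode \<phi> = encode \<psi>"
  obtain m \<Phi> n \<Psi> where \<phi>: "\<phi> = (m, \<Phi>)" and \<psi>: "\<psi> = (n, \<Psi>)" by (cases \<phi>, cases \<psi>)
  have "m = n \<and> concat (map encode_atom \<Phi>) = concat (map encode_atom \<Psi>)"
    using eq unfolding \<phi> \<psi>
  proof (induction m arbitrary: n)
    case 0
    then show ?case using hd_encode_atoms[of \<Phi>] by (cases n) auto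
  next
    case (Suc m)
    have "n \<noteq> 0"
    proof
      assume "n = 0"
      with Suc.prems have "concat (map encode_atom \<Psi>) =
          QForall # QExists # concat (replicate m [QForall, QExists]) @ concat (map encode_atom \<Phi>)"
        by simp
      with hd_encode_atoms[of \<Psi>] show False by (metis list.distinct(1) list.sel(1) token.distinct(3))
    qed
    then obtain k where n: "n = Suc k" by (cases n) auto
    with Suc.prems have "encode (m, \<Phi>) = encode (k, \<Psi>)" by simp
    from Suc.IH[OF this] n show ?case by blast
  qed
  with \<phi> \<psi> encode_atoms_inject show "\<phi> = \<psi>" by blast
qed

section \<open>Nondeterministic logarithmic space\<close>

text \<open>
  A nondeterministic Turing machine has a read-only two-way input tape, on which the input is
  enclosed by two end markers, and a fixed number of work tapes, infinite to the right. States and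
  work symbols are natural numbers, finitely many of which occur in the finite transition
  relation; the blank symbol is \<open>0\<close>.

  A transition \<open>(q, a, bs, q', d, ws)\<close> applies in state \<open>q\<close> if the input head reads \<open>a\<close> and the
  work heads read \<open>bs\<close>; it changes to state \<open>q'\<close>, moves the input head by \<open>d\<close> and, for each work
  tape, writes a symbol and moves the head as given by \<open>ws\<close>.
\<close>

datatype direction = Move_Left | Stay | Move_Right

datatype 'a cell = Left_End | Input 'a | Right_End

type_synonym 'a transition =
  "nat \<times> 'a cell \<times> nat list \<times> nat \<times> direction \<times> (nat \<times> direction) list"

record 'a ntm =
  work_tapes :: nat
  start :: nat
  accepting :: "nat set"
  transitions :: "'a transition set"

definition wf_ntm :: "'a ntm \<Rightarrow> bool" where
  "wf_ntm M \<longleftrightarrow> finite (transitions M) \<and>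
     (\<forall>(q, a, bs, q', d, ws)\<in>transitions M. length bs = work_tapes M \<and> length ws = work_tapes M)"

text \<open>
  A configuration consists of the state, the position of the input head (\<open>0\<close> is the left end
  marker, \<open>length w + 1\<close> the right one), and the contents and head position of each work tape.
  A head that is told to move off the end of a tape stays where it is.
\<close>

type_synonym tape = "(nat \<Rightarrow> nat) \<times> nat"
type_synonym config = "nat \<times> nat \<times> tape list"

definition input_cell :: "'a list \<Rightarrow> nat \<Rightarrow> 'a cell" where
  "input_cell w p =
     (if p = 0 then Left_End else if p \<le> length w then Input (w ! (p - 1)) else Right_End)"

fun shift :: "direction \<Rightarrow> nat \<Rightarrow> nat" where
  "shift Move_Left p = p - 1"
| "shift Stay p = p"
| "shift Move_Right p = p + 1"

fun read_tape :: "tape \<Rightarrow> nat" where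
  "read_tape (f, h) = f h"

fun update_tape :: "tape \<Rightarrow> nat \<times> direction \<Rightarrow> tape" where
  "update_tape (f, h) (b, d) = (f(h := b), shift d h)"

inductive step :: "'a ntm \<Rightarrow> 'a list \<Rightarrow> config \<Rightarrow> config \<Rightarrow> bool" for M w where
  "(q, input_cell w p, map read_tape ts, q', d, ws) \<in> transitions M \<Longrightarrow>
   step M w (q, p, ts) (q', min (shift d p) (length w + 1), map2 update_tape ts ws)"

definition initial :: "'a ntm \<Rightarrow> config" where
  "initial M = (start M, 0, replicate (work_tapes M) (\<lambda>_. 0, 0))"

definition accepts :: "'a ntm \<Rightarrow> 'a list \<Rightarrow> bool" where
  "accepts M w \<longleftrightarrow> (\<exists>q p ts. (step M w)\<^sup>*\<^sup>* (initial M) (q, p, ts) \<and> q \<in> accepting M)"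

text \<open>
  On every computation path for an input of length \<open>n\<close>, only the first \<open>s n\<close> cells of each work
  tape are visited. As the number of work tapes is fixed, this agrees up to a constant factor with
  bounding the total number of visited work cells.
\<close>

definition space_bounded :: "'a ntm \<Rightarrow> (nat \<Rightarrow> nat) \<Rightarrow> bool" where
  "space_bounded M s \<longleftrightarrow>
     (\<forall>w q p ts. (step M w)\<^sup>*\<^sup>* (initial M) (q, p, ts) \<longrightarrow>
        (\<forall>(f, h)\<in>set ts. h < s (length w)))"

definition NL :: "'a::finite list set set" where
  "NL = {L. \<exists>M s. wf_ntm M \<and> space_bounded M s \<and>
            (\<lambda>n. real (s n)) \<in> O(\<lambda>n. ln (real n)) \<and> L = {w. accepts M w}}"

end

theory Submission
  imports Defs "HOL-Real_Asymp.Real_Asymp"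
begin

text \<open>
  The first and the last component provide a source \<open>s\<close> and a sink \<open>t\<close> of the tournament. If
  \<open>s = t\<close>, every sentence is true. Otherwise a universal player who only uses \<open>s\<close> and \<open>t\<close> wins as
  soon as the atoms contain a path between two distinct universal variables, or a cycle through a
  universal variable and an existential variable quantified before it; if there is neither, the
  existential player wins by copying a universal variable on a common cycle and playing \<open>s\<close> or \<open>t\<close>
  elsewhere. So truth is the absence of certain paths in the graph of the atoms, and the
  inductive counting of Immerman and Szelepcsenyi certifies it.

  To keep Turing machines at a distance, regular programs over a few counters are compiled
  to machines. The predicates that such programs can test are closed under conjunction, disjunction,
  both quantifiers and transitive closure, and inductive counting is a formula built from these.
\<close>

section \<open>Regular programs\<close>

text \<open>Acceptance is existential, so the testable predicates have no negation. Wherever both a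
  relation and its complement are needed (edge and non-edge, near and far), each gets a positive
  formula of its own; non-reachability is the one complement that needs an idea. Two requirements
  shape the machine part. Space has to be bounded on every computation path, not only on accepting
  ones, so programs get a semantics of unfinished runs beside the input-output semantics. And a
  counter occupies a fixed number of cells, prepared by counting the input: its range is the least
  power of two above \<open>length w + 1\<close>, overflow makes a run fail, and this range is the
  bound \<open>N\<close> in all formulas. The input is an arbitrary word, so well-formedness is
  tested too; the path conditions are claimed to be correct for well-formed words only. There the
  quantifier prefix is written out in full, and the position of a quantifier can serve as the name
  of its variable.\<close>

datatype 'a prog = Atom 'a | Seq "'a prog" "'a prog" | Choice "'a prog" "'a prog" | Star "'a prog"

primrec sem :: "('a \<Rightarrow> 's rel) \<Rightarrow> 'a prog \<Rightarrow> 's rel" where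
  "sem I (Atom a) = I a"
| "sem I (Seq c d) = sem I c O sem I d"
| "sem I (Choice c d) = sem I c \<union> sem I d"
| "sem I (Star c) = (sem I c)\<^sup>*"

text \<open>\<open>mid I c\<close> relates a state to all states visited by the runs of \<open>c\<close>, finished or not.\<close>

primrec mid :: "('a \<Rightarrow> 's rel) \<Rightarrow> 'a prog \<Rightarrow> 's rel" where
  "mid I (Atom a) = Id \<union> I a"
| "mid I (Seq c d) = mid I c \<union> sem I c O mid I d"
| "mid I (Choice c d) = mid I c \<union> mid I d"
| "mid I (Star c) = (sem I c)\<^sup>* \<union> (sem I c)\<^sup>* O mid I c"

text \<open>Homomorphic substitution of a program for each atom. It is used on two levels: tape
  operations become actions of a machine with \<open>K\<close> tapes, and register instructions
  become programs on tapes.\<close>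

primrec bind :: "('a \<Rightarrow> 'b prog) \<Rightarrow> 'a prog \<Rightarrow> 'b prog" where
  "bind g (Atom a) = g a"
| "bind g (Seq c d) = Seq (bind g c) (bind g d)"
| "bind g (Choice c d) = Choice (bind g c) (bind g d)"
| "bind g (Star c) = Star (bind g c)"

lemma set_prog_bind: "set_prog (bind g c) = (\<Union>a\<in>set_prog c. set_prog (g a))"
  by (induction c) auto

lemma refl_mid: "(s, s) \<in> mid I c"
  by (induction c arbitrary: s) auto

lemma sem_subset_mid: "sem I c \<subseteq> mid I c"
proof (induction c)
  case (Seq c d)
  then show ?case by (auto simp: relcomp.simps)
qed auto

lemma sem_invariant:
  assumes "\<And>a. a \<in> set_prog c \<Longrightarrow> I a `` S \<subseteq> S"
  shows "sem I c `` S \<subseteq> S"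
  using assms
proof (induction c)
  case (Seq c d)
  then have "sem I d `` (sem I c `` S) \<subseteq> S" by fastforce
  then show ?case by (simp add: relcomp_Image)
next
  case (Star c)
  then have "sem I c `` S \<subseteq> S" by simp
  then show ?case by (simp add: Image_closed_trancl)
qed auto

lemma mid_invariant:
  assumes "\<And>a. a \<in> set_prog c \<Longrightarrow> I a `` S \<subseteq> S"
  shows "mid I c `` S \<subseteq> S"
  using assms
proof (induction c)
  case (Seq c d)
  then have "mid I c `` S \<subseteq> S" "mid I d `` S \<subseteq> S" "sem I c `` S \<subseteq> S"
    using sem_invariant[of c I S] by auto
  then show ?case by (simp add: relcomp_Image Un_Image) blast
next
  case (Star c)
  then have "mid I c `` S \<subseteq> S" "sem I (Star c) `` S \<subseteq> S"
    using sem_invariant[of "Star c" I S] by auto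
  then show ?case by (simp add: relcomp_Image Un_Image) blast
qed auto

section \<open>Simulation of programs and evaluation of loops\<close>

text \<open>States are matched in both directions because a test that fails on one level has to fail
  on the other as well. Closure under composition, union and iteration reduces a translation to its
  atoms.\<close>

definition bisim :: "('s \<times> 't) set \<Rightarrow> 's rel \<Rightarrow> 't rel \<Rightarrow> bool" where
  "bisim \<rho> R S \<longleftrightarrow> (\<forall>s t. (s, t) \<in> \<rho> \<longrightarrow>
     (\<forall>s'. (s, s') \<in> R \<longrightarrow> (\<exists>t'. (t, t') \<in> S \<and> (s', t') \<in> \<rho>)) \<and>
     (\<forall>t'. (t, t') \<in> S \<longrightarrow> (\<exists>s'. (s, s') \<in> R \<and> (s', t') \<in> \<rho>)))"

lemma bisim_relcomp: "bisim \<rho> R S \<Longrightarrow> bisim \<rho> R' S' \<Longrightarrow> bisim \<rho> (R O R') (S O S')"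
  unfolding bisim_def by (intro allI impI conjI; elim relcompE; blast)

lemma bisim_rtrancl:
  assumes "bisim \<rho> R S"
  shows "bisim \<rho> (R\<^sup>*) (S\<^sup>*)"
proof -
  have "\<exists>t'. (t, t') \<in> S\<^sup>* \<and> (s', t') \<in> \<rho>" if "(s, s') \<in> R\<^sup>*" "(s, t) \<in> \<rho>" for s s' t
    using that
  proof (induction rule: rtrancl_induct)
    case (step y z)
    then obtain t' where "(t, t') \<in> S\<^sup>*" "(y, t') \<in> \<rho>" by blast
    with assms step.hyps show ?case unfolding bisim_def by (meson rtrancl.rtrancl_into_rtrancl)
  qed auto
  moreover have "\<exists>s'. (s, s') \<in> R\<^sup>* \<and> (s', t') \<in> \<rho>" if "(t, t') \<in> S\<^sup>*" "(s, t) \<in> \<rho>" for s t t'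
    using that
  proof (induction rule: rtrancl_induct)
    case (step y z)
    then obtain s' where "(s, s') \<in> R\<^sup>*" "(s', y) \<in> \<rho>" by blast
    with assms step.hyps show ?case unfolding bisim_def by (meson rtrancl.rtrancl_into_rtrancl)
  qed auto
  ultimately show ?thesis unfolding bisim_def by blast
qed

lemma bisim_Un: "bisim \<rho> R S \<Longrightarrow> bisim \<rho> R' S' \<Longrightarrow> bisim \<rho> (R \<union> R') (S \<union> S')"
  unfolding bisim_def by (intro allI impI conjI; elim UnE; blast)

lemma bisim_bind:
  assumes "\<And>a. a \<in> set_prog c \<Longrightarrow> bisim \<rho> (I a) (sem J (g a))"
  shows "bisim \<rho> (sem I c) (sem J (bind g c))"
  using assms
  by (induction c) (auto simp: bisim_relcomp bisim_rtrancl bisim_Un)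

text \<open>\<open>P\<close> singles out the states on which \<open>g\<close> is a faithful
  encoding; \<open>R\<close> has to mirror \<open>Q\<close> only there, and \<open>Q\<close> does
  not leave them.\<close>

lemma rtrancl_embed_iff:
  assumes "\<And>u t. P u \<Longrightarrow> (g u, t) \<in> R \<longleftrightarrow> (\<exists>u'. (u, u') \<in> Q \<and> t = g u')"
    and "\<And>u u'. P u \<Longrightarrow> (u, u') \<in> Q \<Longrightarrow> P u'" and "P u"
  shows "(g u, t) \<in> R\<^sup>* \<longleftrightarrow> (\<exists>u'. (u, u') \<in> Q\<^sup>* \<and> t = g u')"
proof
  assume "(g u, t) \<in> R\<^sup>*"
  then have "\<exists>u'. (u, u') \<in> Q\<^sup>* \<and> t = g u' \<and> P u'"
  proof (induction rule: rtrancl_induct)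
    case base
    then show ?case using assms(3) by blast
  next
    case (step y z)
    then obtain u' where u': "(u, u') \<in> Q\<^sup>*" "y = g u'" "P u'" by blast
    with step(2) assms(1)[of u' z] obtain v where "(u', v) \<in> Q" "z = g v" by blast
    with u' assms(2)[of u' v] show ?case by (blast intro: rtrancl.rtrancl_into_rtrancl)
  qed
  then show "\<exists>u'. (u, u') \<in> Q\<^sup>* \<and> t = g u'" by blast
next
  assume "\<exists>u'. (u, u') \<in> Q\<^sup>* \<and> t = g u'"
  then obtain u' where "(u, u') \<in> Q\<^sup>*" "t = g u'" by blast
  from this(1) have "(g u, g u') \<in> R\<^sup>* \<and> P u'"
  proof (induction rule: rtrancl_induct)
    case base
    then show ?case using assms(3) by blast
  next
    case (step y z)
    then have "(g y, g z) \<in> R" using assms(1) by blast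
    with step assms(2) show ?case by (blast intro: rtrancl.rtrancl_into_rtrancl)
  qed
  with \<open>t = g u'\<close> show "(g u, t) \<in> R\<^sup>*" by simp
qed

text \<open>Evaluates a deterministic loop: \<open>g i\<close> is the state after \<open>i\<close>
  rounds and \<open>C i\<close> the condition for another round. A \<open>Star\<close> may be left
  after any round, so the exit test that follows a loop has to pin down \<open>i\<close>.\<close>

lemma rtrancl_chain_iff:
  assumes "\<And>i t. (g i, t) \<in> R \<longleftrightarrow> C i \<and> t = g (Suc i)"
  shows "(g 0, t) \<in> R\<^sup>* \<longleftrightarrow> (\<exists>i. t = g i \<and> (\<forall>j<i. C j))"
proof -
  have *: "(i, k) \<in> {(i, k). C i \<and> k = Suc i}\<^sup>* \<longleftrightarrow> i \<le> k \<and> (\<forall>j. i \<le> j \<and> j < k \<longrightarrow> C j)" for i k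
  proof
    assume "(i, k) \<in> {(i, k). C i \<and> k = Suc i}\<^sup>*"
    then show "i \<le> k \<and> (\<forall>j. i \<le> j \<and> j < k \<longrightarrow> C j)"
      by (induction rule: rtrancl_induct) (auto simp: less_Suc_eq)
  next
    assume "i \<le> k \<and> (\<forall>j. i \<le> j \<and> j < k \<longrightarrow> C j)"
    then show "(i, k) \<in> {(i, k). C i \<and> k = Suc i}\<^sup>*"
    proof (induction k)
      case (Suc k)
      show ?case
      proof (cases "i = Suc k")
        case False
        with Suc have "(i, k) \<in> {(i, k). C i \<and> k = Suc i}\<^sup>*"
          and "(k, Suc k) \<in> {(i, k). C i \<and> k = Suc i}" by auto
        then show ?thesis by (rule rtrancl.rtrancl_into_rtrancl)
      qed simp
    qed auto
  qed
  have "(g 0, t) \<in> R\<^sup>* \<longleftrightarrow> (\<exists>k. (0, k) \<in> {(i, k). C i \<and> k = Suc i}\<^sup>* \<and> t = g k)"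
    by (rule rtrancl_embed_iff[where P = "\<lambda>_. True"]) (use assms in auto)
  then show ?thesis by (auto simp: *)
qed

section \<open>Compiling regular programs to Turing machines\<close>

type_synonym 'a act = "'a cell \<times> nat list \<times> direction \<times> (nat \<times> direction) list"
type_synonym tconf = "nat \<times> tape list"

definition act_sem :: "'a list \<Rightarrow> 'a act set \<Rightarrow> tconf rel" where
  "act_sem w A = {((p, ts), (min (shift d p) (length w + 1), map2 update_tape ts ws)) | p ts d ws.
     (input_cell w p, map read_tape ts, d, ws) \<in> A}"

text \<open>
  The control states of the machine are the lists of programs that remain to be run;
  \<open>unfold\<close> rewrites such a list without performing an action.
\<close>

inductive unfold :: "'a prog list \<Rightarrow> 'a prog list \<Rightarrow> bool" where
  "unfold (Seq c d # ks) (c # d # ks)"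
| "unfold (Choice c d # ks) (c # ks)"
| "unfold (Choice c d # ks) (d # ks)"
| "unfold (Star c # ks) ks"
| "unfold (Star c # ks) (c # Star c # ks)"

inductive_simps unfold_simps:
  "unfold [] x" "unfold (Atom a # ks) x" "unfold (Seq c d # ks) x" "unfold (Choice c d # ks) x"
  "unfold (Star c # ks) x"

text \<open>One list for each occurrence of a subprogram of \<open>c\<close>, much like the partial
  derivatives of a regular expression. A star returns only as the continuation of its own body, so
  finitely many control states suffice.\<close>

primrec conts :: "'a prog \<Rightarrow> 'a prog list \<Rightarrow> 'a prog list set" where
  "conts (Atom a) ks = {Atom a # ks}"
| "conts (Seq c d) ks = insert (Seq c d # ks) (conts c (d # ks) \<union> conts d ks)"
| "conts (Choice c d) ks = insert (Choice c d # ks) (conts c ks \<union> conts d ks)"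
| "conts (Star c) ks = insert (Star c # ks) (conts c (Star c # ks))"

lemma finite_conts: "finite (conts c ks)"
  by (induction c arbitrary: ks) auto

lemma Cons_in_conts: "c # ks \<in> conts c ks"
  by (cases c) auto

lemma unfold_conts: "unfold x y \<Longrightarrow> x \<in> conts c ks \<Longrightarrow> y \<in> insert ks (conts c ks)"
proof (induction c arbitrary: ks)
  case (Atom a)
  then show ?case by (simp add: unfold_simps)
next
  case (Seq c d)
  from Seq.IH(1)[OF Seq.prems(1), of "d # ks"] Seq.IH(2)[OF Seq.prems(1), of ks] Seq.prems
  show ?case by (auto simp: unfold_simps Cons_in_conts)
next
  case (Choice c d)
  from Choice.IH(1)[OF Choice.prems(1), of ks] Choice.IH(2)[OF Choice.prems(1), of ks] Choice.prems
  show ?case by (auto simp: unfold_simps Cons_in_conts)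
next
  case (Star c)
  from Star.IH[OF Star.prems(1), of "Star c # ks"] Star.prems
  show ?case by (auto simp: unfold_simps Cons_in_conts)
qed

lemma Atom_conts: "Atom a # y \<in> conts c ks \<Longrightarrow> y \<in> insert ks (conts c ks)"
proof (induction c arbitrary: ks)
  case (Seq c d)
  from Seq.prems Seq.IH(1)[of "d # ks"] Seq.IH(2)[of ks] Cons_in_conts[of d ks] show ?case by auto
next
  case (Star c)
  from Star.prems Star.IH[of "Star c # ks"] show ?case by auto
qed auto

primrec sem_list :: "('a \<Rightarrow> 's rel) \<Rightarrow> 'a prog list \<Rightarrow> 's rel" where
  "sem_list I [] = Id"
| "sem_list I (c # ks) = sem I c O sem_list I ks"

primrec mid_list :: "('a \<Rightarrow> 's rel) \<Rightarrow> 'a prog list \<Rightarrow> 's rel" where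
  "mid_list I [] = Id"
| "mid_list I (c # ks) = mid I c \<union> sem I c O mid_list I ks"

lemma refl_mid_list: "(s, s) \<in> mid_list I ks"
  by (cases ks) (auto simp: refl_mid)

lemma sem_list_unfold: "unfold x y \<Longrightarrow> sem_list I y \<subseteq> sem_list I x"
proof (induction rule: unfold.induct)
  case (5 c ks)
  then show ?case by auto (meson converse_rtrancl_into_rtrancl relcomp.relcompI)
qed auto

lemma mid_list_unfold: "unfold x y \<Longrightarrow> mid_list I y \<subseteq> mid_list I x"
proof (induction rule: unfold.induct)
  case (5 c ks)
  have "sem I c O (sem I c)\<^sup>* O X \<subseteq> (sem I c)\<^sup>* O X" for X
    by (auto intro: converse_rtrancl_into_rtrancl)
  from this[of Id] this[of "mid I c"] this[of "mid_list I ks"] show ?case by auto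
qed auto

lemma sem_list_unfolds: "unfold\<^sup>*\<^sup>* x y \<Longrightarrow> sem_list I y \<subseteq> sem_list I x"
  by (induction rule: rtranclp_induct) (use sem_list_unfold in blast)+

lemma mid_list_unfolds: "unfold\<^sup>*\<^sup>* x y \<Longrightarrow> mid_list I y \<subseteq> mid_list I x"
  by (induction rule: rtranclp_induct) (use mid_list_unfold in blast)+

text \<open>A machine transition always performs an action, so the silent unfoldings are absorbed in
  front of the next atom. Those after the last atom remain; they reappear in
  \<open>terminates\<close> and in the choice of the accepting states.\<close>

inductive run :: "('a \<Rightarrow> 's rel) \<Rightarrow> 'a prog list \<times> 's \<Rightarrow> 'a prog list \<times> 's \<Rightarrow> bool" for I where
  "unfold\<^sup>*\<^sup>* x (Atom a # y) \<Longrightarrow> (s, t) \<in> I a \<Longrightarrow> run I (x, s) (y, t)"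

lemma runs_sound:
  assumes "(run I)\<^sup>*\<^sup>* (x, s) (y, t)"
  shows "(t, u) \<in> sem_list I y \<Longrightarrow> (s, u) \<in> sem_list I x"
    and "(t, u) \<in> mid_list I y \<Longrightarrow> (s, u) \<in> mid_list I x"
proof -
  have "((t, u) \<in> sem_list I y \<longrightarrow> (s, u) \<in> sem_list I x) \<and>
        ((t, u) \<in> mid_list I y \<longrightarrow> (s, u) \<in> mid_list I x)"
    using assms
  proof (induction rule: converse_rtranclp_induct2)
    case (step x s x' s')
    from step(1) obtain a where a: "unfold\<^sup>*\<^sup>* x (Atom a # x')" "(s, s') \<in> I a"
      by (auto elim: run.cases)
    from step(3) a sem_list_unfolds[OF a(1), of I] mid_list_unfolds[OF a(1), of I]
    show ?case by auto
  qed auto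
  then show "(t, u) \<in> sem_list I y \<Longrightarrow> (s, u) \<in> sem_list I x"
    and "(t, u) \<in> mid_list I y \<Longrightarrow> (s, u) \<in> mid_list I x" by auto
qed

definition terminates :: "('a \<Rightarrow> 's rel) \<Rightarrow> 'a prog list \<Rightarrow> 's \<Rightarrow> 's \<Rightarrow> bool" where
  "terminates I x s t \<longleftrightarrow> (\<exists>y. (run I)\<^sup>*\<^sup>* (x, s) (y, t) \<and> unfold\<^sup>*\<^sup>* y [])"

text \<open>The additional unfolding is absorbed by the first action or, if there is none, by the
  final unfolding to the empty list.\<close>

lemma terminates_unfold:
  assumes "unfold x y" "terminates I y s t"
  shows "terminates I x s t"
proof -
  from assms(2) obtain z where z: "(run I)\<^sup>*\<^sup>* (y, s) (z, t)" "unfold\<^sup>*\<^sup>* z []"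
    unfolding terminates_def by blast
  from z(1) show ?thesis
  proof (cases rule: converse_rtranclpE)
    case base
    with z(2) assms(1) have "unfold\<^sup>*\<^sup>* x []" "s = t" by auto
    then show ?thesis unfolding terminates_def by blast
  next
    case (step v)
    obtain v1 v2 where v: "v = (v1, v2)" by (cases v)
    from step(1)[unfolded v] obtain a where a: "unfold\<^sup>*\<^sup>* y (Atom a # v1)" "(s, v2) \<in> I a"
      by (auto elim: run.cases)
    from converse_rtranclp_into_rtranclp[of unfold, OF assms(1) a(1)] a(2) have "run I (x, s) v"
      unfolding v by (rule run.intros)
    with step(2) z(2) show ?thesis
      unfolding terminates_def by (meson converse_rtranclp_into_rtranclp)
  qed
qed

text \<open>The continuation \<open>ks\<close> is arbitrary because the induction hypotheses for
  \<open>Seq\<close> and \<open>Star\<close> are applied in front of the rest of the program. The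
  star itself takes an inner induction along its iterations.\<close>

lemma terminates_Cons: "(s, u) \<in> sem I c \<Longrightarrow> terminates I ks u t \<Longrightarrow> terminates I (c # ks) s t"
proof (induction c arbitrary: s u ks)
  case (Atom a)
  then have "run I (Atom a # ks, s) (ks, u)" by (auto intro: run.intros)
  with Atom show ?case unfolding terminates_def by (meson converse_rtranclp_into_rtranclp)
next
  case (Seq c d)
  then obtain v where "(s, v) \<in> sem I c" "(v, u) \<in> sem I d" by auto
  with Seq have "terminates I (c # d # ks) s t" by blast
  then show ?case by (rule terminates_unfold[OF unfold.intros(1)])
next
  case (Choice c d)
  then have "terminates I (c # ks) s t \<or> terminates I (d # ks) s t" by auto
  then show ?case by (auto intro: terminates_unfold[OF unfold.intros(2)] terminates_unfold[OF unfold.intros(3)])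
next
  case (Star c)
  from Star.prems(1) have "(s, u) \<in> (sem I c)\<^sup>*" by simp
  then show ?case
  proof (induction rule: converse_rtrancl_induct)
    case base
    from Star.prems(2) show ?case by (rule terminates_unfold[OF unfold.intros(4)])
  next
    case (step y z)
    from Star.IH[OF step(1,3)] show ?case by (rule terminates_unfold[OF unfold.intros(5)])
  qed
qed

lemma terminates_iff: "terminates I [c] s t \<longleftrightarrow> (s, t) \<in> sem I c"
proof
  assume "terminates I [c] s t"
  then obtain y where y: "(run I)\<^sup>*\<^sup>* ([c], s) (y, t)" "unfold\<^sup>*\<^sup>* y []"
    unfolding terminates_def by blast
  from sem_list_unfolds[OF y(2), of I] have "(t, t) \<in> sem_list I y" by auto
  from runs_sound(1)[OF y(1) this] show "(s, t) \<in> sem I c" by simp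
next
  assume "(s, t) \<in> sem I c"
  moreover have "terminates I [] t t" unfolding terminates_def by blast
  ultimately show "terminates I [c] s t" by (rule terminates_Cons)
qed

definition tape0 :: tape where "tape0 = (\<lambda>_. 0, 0)"

definition wf_act :: "nat \<Rightarrow> 'a act set \<Rightarrow> bool" where
  "wf_act K A \<longleftrightarrow> finite A \<and> (\<forall>(a, bs, d, ws)\<in>A. length bs = K \<and> length ws = K)"

text \<open>The finite set of continuation lists provides the control states. Besides acceptance,
  the conclusion places every reachable configuration in \<open>mid\<close>; the space bound on all
  paths is read off from this.\<close>

theorem compile:
  assumes "\<And>A. A \<in> set_prog P \<Longrightarrow> wf_act K A"
  shows "\<exists>M. wf_ntm M \<and>
    (\<forall>w. accepts M w \<longleftrightarrow> (\<exists>t. ((0, replicate K tape0), t) \<in> sem (act_sem w) P)) \<and>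
    (\<forall>w q p ts. (step M w)\<^sup>*\<^sup>* (initial M) (q, p, ts) \<longrightarrow>
       ((0, replicate K tape0), (p, ts)) \<in> mid (act_sem w) P)"
proof -
  have wf: "finite A" if "A \<in> set_prog P" for A
    using assms[OF that] by (simp add: wf_act_def)
  have len: "length bs = K \<and> length ws = K" if "A \<in> set_prog P" "(a, bs, d, ws) \<in> A" for A a bs d ws
    using assms[OF that(1)] that(2) by (auto simp: wf_act_def)
  define C where "C = insert [] (conts P [])"
  have C: "finite C" "[P] \<in> C" by (simp_all add: C_def finite_conts Cons_in_conts)
  have C_unf: "y \<in> C" if "unfold x y" "x \<in> C" for x y
    using that unfold_conts[OF that(1), of P "[]"] by (auto simp: C_def unfold_simps)
  have C_unfs: "y \<in> C" if "unfold\<^sup>*\<^sup>* x y" "x \<in> C" for x y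
    using that by (induction rule: rtranclp_induct) (auto intro: C_unf)
  have C_Atom: "y \<in> C" if "Atom a # y \<in> C" for a y
    using that Atom_conts[of a y P "[]"] by (auto simp: C_def)
  have atoms: "set x \<subseteq> {d. set_prog d \<subseteq> set_prog P}" if "x \<in> C" for x
  proof -
    have "set x \<subseteq> set ks \<union> {d. set_prog d \<subseteq> set_prog c}" if "x \<in> conts c ks" for x c ks
      using that by (induction c arbitrary: ks) fastforce+
    from this[of x P "[]"] that show ?thesis by (auto simp: C_def)
  qed
  obtain f :: "_ \<Rightarrow> nat" where f: "inj_on f C"
    using finite_imp_inj_to_nat_seg[OF C(1)] by blast
  \<comment> \<open>The state of \<open>x\<close> is left by an action of any atom that
    \<open>x\<close> can unfold to, and the remaining list is the next state. \<open>f\<close> is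
    injective on \<open>C\<close> only, whence the condition on \<open>x\<close>.\<close>
  define \<Delta> where "\<Delta> = {(f x, a, bs, f y, d, ws) | x a bs y d ws. x \<in> C \<and>
     (\<exists>A. unfold\<^sup>*\<^sup>* x (Atom A # y) \<and> (a, bs, d, ws) \<in> A)}"
  define M where "M = \<lparr>work_tapes = K, start = f [P], accepting = f ` {x \<in> C. unfold\<^sup>*\<^sup>* x []},
    transitions = \<Delta>\<rparr>"
  have A_P: "A \<in> set_prog P \<and> y \<in> C" if "unfold\<^sup>*\<^sup>* x (Atom A # y)" "x \<in> C" for x y A
    using C_unfs[OF that] atoms C_Atom by fastforce
  have "\<Delta> \<subseteq> (\<lambda>(x, (a, bs, d, ws), y). (f x, a, bs, f y, d, ws)) ` (C \<times> \<Union> (set_prog P) \<times> C)"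
  proof
    fix r assume "r \<in> \<Delta>"
    then obtain x a bs y d ws A where r: "r = (f x, a, bs, f y, d, ws)" and x: "x \<in> C"
      and A: "unfold\<^sup>*\<^sup>* x (Atom A # y)" "(a, bs, d, ws) \<in> A" unfolding \<Delta>_def by blast
    from A_P[OF A(1) x] A(2) x have "(x, (a, bs, d, ws), y) \<in> C \<times> \<Union> (set_prog P) \<times> C" by blast
    from imageI[OF this, of "\<lambda>(x, (a, bs, d, ws), y). (f x, a, bs, f y, d, ws)"]
    show "r \<in> (\<lambda>(x, (a, bs, d, ws), y). (f x, a, bs, f y, d, ws)) ` (C \<times> \<Union> (set_prog P) \<times> C)"
      by (simp add: r)
  qed
  moreover have "finite (set_prog P)" by (induction P) auto
  ultimately have "finite \<Delta>" using C(1) wf by (auto elim!: finite_subset)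
  moreover have "length bs = K \<and> length ws = K" if "(q, a, bs, q', d, ws) \<in> \<Delta>" for q a bs q' d ws
    using that A_P len unfolding \<Delta>_def by blast
  ultimately have "wf_ntm M" unfolding wf_ntm_def M_def by fastforce
  have step_run: "\<exists>y. q' = f y \<and> y \<in> C \<and> run (act_sem w) (x, s) (y, s')"
    if "step M w (f x, s) (q', s')" "x \<in> C" for w x s q' s'
    using that(1)
  proof cases
    case (1 p ts d ws)
    then obtain x' y A where *: "f x = f x'" "q' = f y" "x' \<in> C" "unfold\<^sup>*\<^sup>* x' (Atom A # y)"
      "(input_cell w p, map read_tape ts, d, ws) \<in> A"
      unfolding M_def \<Delta>_def by auto
    with f that(2) have "x' = x" by (auto dest: inj_onD)
    from *(5) 1 have "(s, s') \<in> act_sem w A" unfolding act_sem_def by blast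
    with *(4) \<open>x' = x\<close> have "run (act_sem w) (x, s) (y, s')" by (auto intro: run.intros)
    with * A_P show ?thesis by blast
  qed
  have run_step: "step M w (f x, s) (f y, s') \<and> y \<in> C" if "run (act_sem w) (x, s) (y, s')" "x \<in> C" for w x s y s'
    using that(1)
  proof cases
    case (1 A)
    then obtain p ts d ws where *: "s = (p, ts)" "s' = (min (shift d p) (length w + 1), map2 update_tape ts ws)"
      "(input_cell w p, map read_tape ts, d, ws) \<in> A" unfolding act_sem_def by auto
    have "(f x, input_cell w p, map read_tape ts, f y, d, ws) \<in> transitions M"
      using 1(1) *(3) that(2) unfolding M_def \<Delta>_def by auto
    from step.intros[OF this] * 1(1) A_P that(2) show ?thesis by blast
  qed
  have init: "initial M = (f [P], 0, replicate K tape0)"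
    by (simp add: initial_def M_def tape0_def)
  have steps_runs: "\<exists>y. q = f y \<and> y \<in> C \<and> (run (act_sem w))\<^sup>*\<^sup>* ([P], 0, replicate K tape0) (y, s)"
    if "(step M w)\<^sup>*\<^sup>* (initial M) (q, s)" for w q s
    using that unfolding init
  proof (induction rule: rtranclp_induct2)
    case refl
    then show ?case using C by blast
  next
    case (step q s q' s')
    then obtain y where y: "q = f y" "y \<in> C" "(run (act_sem w))\<^sup>*\<^sup>* ([P], 0, replicate K tape0) (y, s)"
      by blast
    from step_run[OF step(2)[unfolded y(1)] y(2)] obtain y' where
      "q' = f y'" "y' \<in> C" "run (act_sem w) (y, s) (y', s')" by blast
    with y(3) show ?case by (blast intro: rtranclp.rtrancl_into_rtrancl)
  qed
  have runs_steps: "(step M w)\<^sup>*\<^sup>* (initial M) (f y, s) \<and> y \<in> C"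
    if "(run (act_sem w))\<^sup>*\<^sup>* ([P], 0, replicate K tape0) (y, s)" for w y s
    using that
  proof (induction rule: rtranclp_induct2)
    case refl
    then show ?case using C by (simp add: init)
  next
    case (step y s y' s')
    from run_step[OF step(2)] step(3) show ?case by (blast intro: rtranclp.rtrancl_into_rtrancl)
  qed
  have "accepts M w \<longleftrightarrow> (\<exists>t. terminates (act_sem w) [P] (0, replicate K tape0) t)" for w
  proof
    assume "accepts M w"
    then obtain q s where q: "(step M w)\<^sup>*\<^sup>* (initial M) (q, s)" "q \<in> accepting M"
      unfolding accepts_def by auto
    from steps_runs[OF q(1)] obtain y where y: "q = f y" "y \<in> C"
      "(run (act_sem w))\<^sup>*\<^sup>* ([P], 0, replicate K tape0) (y, s)" by blast
    from q(2) y(1,2) f have "unfold\<^sup>*\<^sup>* y []" by (auto simp: M_def dest: inj_onD)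
    with y(3) show "\<exists>t. terminates (act_sem w) [P] (0, replicate K tape0) t"
      unfolding terminates_def by blast
  next
    assume "\<exists>t. terminates (act_sem w) [P] (0, replicate K tape0) t"
    then obtain y s where y: "(run (act_sem w))\<^sup>*\<^sup>* ([P], 0, replicate K tape0) (y, s)" "unfold\<^sup>*\<^sup>* y []"
      unfolding terminates_def by blast
    obtain p ts where s: "s = (p, ts)" by (cases s)
    from runs_steps[OF y(1)] y(2) have "(step M w)\<^sup>*\<^sup>* (initial M) (f y, p, ts)" "f y \<in> accepting M"
      by (auto simp: M_def s)
    then show "accepts M w" unfolding accepts_def by blast
  qed
  then have "accepts M w \<longleftrightarrow> (\<exists>t. ((0, replicate K tape0), t) \<in> sem (act_sem w) P)" for w
    by (simp add: terminates_iff)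
  moreover have "((0, replicate K tape0), (p, ts)) \<in> mid (act_sem w) P"
    if "(step M w)\<^sup>*\<^sup>* (initial M) (q, p, ts)" for w q p ts
  proof -
    from steps_runs[OF that] obtain y where
      y: "(run (act_sem w))\<^sup>*\<^sup>* ([P], 0, replicate K tape0) (y, p, ts)" by blast
    from runs_sound(2)[OF y refl_mid_list] sem_subset_mid[of "act_sem w" P] show ?thesis by auto
  qed
  ultimately show ?thesis using \<open>wf_ntm M\<close> by blast
qed

section \<open>Binary counters on tapes\<close>

text \<open>
  A counter is stored with its least significant bit first: \<open>3\<close> marks the left end of the tape,
  \<open>1\<close> and \<open>2\<close> are the bits, and the first blank ends the counter.
\<close>

definition digit :: "bool \<Rightarrow> nat" where "digit b = (if b then 2 else 1)"

definition cells :: "bool list \<Rightarrow> nat \<Rightarrow> nat" where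
  "cells bs i = (if i = 0 then 3 else if i \<le> length bs then digit (bs ! (i - 1)) else 0)"

section \<open>Bit lists and their values\<close>

primrec val :: "bool list \<Rightarrow> nat" where
  "val [] = 0"
| "val (b # bs) = of_bool b + 2 * val bs"

fun incr :: "bool list \<Rightarrow> bool list" where
  "incr [] = [True]"
| "incr (False # bs) = True # bs"
| "incr (True # bs) = False # incr bs"

lemma val_less: "val bs < 2 ^ length bs"
  by (induction bs) auto

lemma val_inject: "length bs = length cs \<Longrightarrow> val bs = val cs \<longleftrightarrow> bs = cs"
proof (induction bs cs rule: list_induct2)
  case (Cons b bs c cs)
  have "val (b # bs) = val (c # cs) \<longleftrightarrow> b = c \<and> val bs = val cs"
    by (cases b; cases c) (simp_all, presburger+)
  with Cons show ?case by simp
qed simp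

lemma val_append: "val (bs @ cs) = val bs + 2 ^ length bs * val cs"
  by (induction bs) (auto simp: algebra_simps)

lemma val_replicate: "val (replicate k b) = (if b then 2 ^ k - 1 else 0)"
proof (induction k)
  case (Suc k)
  have "(1::nat) \<le> 2 ^ k" by simp
  then have "1 + 2 * (2 ^ k - 1) = 2 * 2 ^ k - (1::nat)" by (simp only: diff_mult_distrib2)
  with Suc show ?case by auto
qed simp

lemma val_incr: "val (incr bs) = Suc (val bs)"
  by (induction bs rule: incr.induct) auto

lemma length_incr: "length (incr bs) = (if \<forall>b\<in>set bs. b then Suc (length bs) else length bs)"
  by (induction bs rule: incr.induct) auto

lemma last_incr: "(bs \<noteq> [] \<longrightarrow> last bs) \<Longrightarrow> incr bs \<noteq> [] \<and> last (incr bs)"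
  by (induction bs rule: incr.induct) (auto split: if_splits)

lemma val_ge: "bs \<noteq> [] \<Longrightarrow> last bs \<Longrightarrow> 2 ^ length bs \<le> 2 * val bs"
  by (induction bs) (auto split: if_splits)

lemma all_True_iff: "(\<forall>b\<in>set bs. b) \<longleftrightarrow> Suc (val bs) = 2 ^ length bs"
proof (induction bs)
  case (Cons b bs)
  define x where "x = (2::nat) ^ length bs"
  have "b \<Longrightarrow> Suc (val (b # bs)) = 2 * x \<longleftrightarrow> Suc (val bs) = x"
    and "\<not> b \<Longrightarrow> Suc (val (b # bs)) \<noteq> 2 * x" by simp_all presburger+
  with Cons show ?case by (cases b) (simp_all add: x_def)
qed simp

lemma all_False_iff: "(\<forall>b\<in>set bs. \<not> b) \<longleftrightarrow> val bs = 0"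
  by (induction bs) auto

section \<open>The number of digits for a given input length\<close>

text \<open>Defined by counting, since this is how a tape gets filled. By \<open>last_incr\<close>
  the top bit is always set.\<close>

definition bits :: "nat \<Rightarrow> bool list" where "bits v = (incr ^^ v) []"

lemma bits_simps: "bits 0 = []" "bits (Suc v) = incr (bits v)"
  by (simp_all add: bits_def)

lemma val_bits: "val (bits v) = v"
  by (induction v) (auto simp: bits_simps val_incr)

lemma last_bits: "v > 0 \<Longrightarrow> bits v \<noteq> [] \<and> last (bits v)"
proof (induction v)
  case (Suc v)
  then show ?case using last_incr[of "bits v"] by (cases "v = 0") (auto simp: bits_simps)
qed simp

lemma length_bits_mono: "u \<le> v \<Longrightarrow> length (bits u) \<le> length (bits v)"
  by (rule lift_Suc_mono_le[of "\<lambda>v. length (bits v)"]) (auto simp: bits_simps length_incr)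

text \<open>\<open>n + 1\<close> is the number of cells before the right end marker, hence the
  result of counting the input, and also the largest position of the input head. So every position
  fits into a counter with \<open>width n\<close> digits, whose values are those below
  \<open>cap n\<close>.\<close>

definition width :: "nat \<Rightarrow> nat" where "width n = length (bits (n + 1))"

definition cap :: "nat \<Rightarrow> nat" where "cap n = 2 ^ width n"

lemma cap_gt: "n + 1 < cap n"
  using val_less[of "bits (n + 1)"] by (simp add: cap_def width_def val_bits)

text \<open>The top bit of \<open>bits (n + 1)\<close> is set, so \<open>2 ^ width n\<close> is at
  most twice \<open>n + 1\<close>.\<close>

lemma width_le: "real (width n) \<le> 1 + log 2 (real n + 1)"
proof -
  have "2 ^ width n \<le> 2 * (n + 1)"
    using val_ge[of "bits (n + 1)"] last_bits[of "n + 1"] by (simp add: width_def val_bits)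
  then have "real (2 ^ width n) \<le> real (2 * (n + 1))" by (simp only: of_nat_le_iff)
  then have "2 powr real (width n) \<le> 2 * (real n + 1)" by (simp add: powr_realpow)
  then have "real (width n) \<le> log 2 (2 * (real n + 1))" by (subst le_log_iff) auto
  then show ?thesis by (subst (asm) log_mult) auto
qed

subsection \<open>Programs for a single tape\<close>

type_synonym tape_op = "nat \<times> nat \<times> direction"

fun write_sem :: "tape_op \<Rightarrow> tape rel" where
  "write_sem (b, b', d) = {(t, update_tape t (b', d)) | t. read_tape t = b}"

lemma write_sem_iff: "((f, h), t) \<in> write_sem (b, b', d) \<longleftrightarrow> f h = b \<and> t = (f(h := b'), shift d h)"
  by auto

declare write_sem.simps [simp del]

definition rewind :: "tape_op prog" where
  "rewind = Seq (Star (Choice (Atom (1, 1, Move_Left)) (Atom (2, 2, Move_Left)))) (Atom (3, 3, Stay))"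

text \<open>The loop may stop anywhere in the initial block of bits \<open>b\<close>. What follows
  reads the opposite digit, or a blank in \<open>flip_ext\<close>, and thereby forces it to run to
  the end of that block.\<close>

definition carry :: "bool \<Rightarrow> tape_op prog" where
  "carry b = Seq (Atom (3, 3, Move_Right)) (Star (Atom (digit b, digit (\<not> b), Move_Right)))"

text \<open>Increment for \<open>b = True\<close>, decrement for \<open>b = False\<close>. On
  overflow the head ends on a blank, which the next operation does not accept, so the program
  fails.\<close>

definition flip :: "bool \<Rightarrow> tape_op prog" where
  "flip b = Seq (carry b) (Seq (Atom (digit (\<not> b), digit b, Move_Left)) rewind)"

text \<open>The increment that may lengthen a counter: a carry out of the top bit is written over
  the first blank.\<close>

definition flip_ext :: "tape_op prog" where
  "flip_ext = Seq (carry True)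
     (Seq (Choice (Atom (1, 2, Move_Left)) (Atom (0, 2, Move_Left))) rewind)"

definition all_bits :: "bool \<Rightarrow> tape_op prog" where
  "all_bits b = Seq (Seq (Atom (3, 3, Move_Right)) (Star (Atom (digit b, digit b, Move_Right))))
     (Seq (Atom (0, 0, Move_Left)) rewind)"

lemma digit_simps: "digit True = 2" "digit False = 1" "digit b \<noteq> 0" "digit b \<noteq> 3"
  "digit b = digit c \<longleftrightarrow> b = c" "0 \<noteq> digit b" "3 \<noteq> digit b" "digit b < 4"
  by (auto simp: digit_def)

lemma cells_less: "cells bs i < 4"
  by (auto simp: cells_def digit_def)

lemma cells_update: "i < length bs \<Longrightarrow> (cells bs)(Suc i := digit b) = cells (bs[i := b])"
  by (auto simp: cells_def fun_eq_iff nth_list_update)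

lemma cells_end: "(cells bs)(Suc (length bs) := digit b) = cells (bs @ [b])"
  by (auto simp: cells_def fun_eq_iff nth_append)

lemma cells_0: "cells bs 0 = 3" "cells bs i = 3 \<longleftrightarrow> i = 0" "(cells bs)(0 := 3) = cells bs"
  by (auto simp: cells_def digit_simps)

lemma cells_eq_digit: "cells bs (Suc i) = digit b \<longleftrightarrow> i < length bs \<and> bs ! i = b"
  by (auto simp: cells_def digit_simps)

lemma cells_eq_0: "cells bs i = 0 \<longleftrightarrow> length bs < i"
  by (auto simp: cells_def digit_simps)

lemma write_marker: "((cells bs, 0), t) \<in> write_sem (3, 3, d) \<longleftrightarrow> t = (cells bs, shift d 0)"
  by (simp add: write_sem_iff cells_0)

lemma write_digit: "((cells bs, Suc i), t) \<in> write_sem (digit b, digit c, d) \<longleftrightarrow>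
    i < length bs \<and> bs ! i = b \<and> t = (cells (bs[i := c]), shift d (Suc i))"
  by (auto simp: write_sem_iff cells_eq_digit cells_update)

lemma sem_Seq_iff: "(s, t) \<in> sem I (Seq c d) \<longleftrightarrow> (\<exists>u. (s, u) \<in> sem I c \<and> (u, t) \<in> sem I d)"
  by auto

lemma all_less_iff: "(\<forall>j<k. j < i) \<longleftrightarrow> k \<le> (i::nat)"
  using not_le by auto

lemma rewind_iff:
  assumes "i \<le> length bs"
  shows "((cells bs, i), t) \<in> sem write_sem rewind \<longleftrightarrow> t = (cells bs, 0)"
proof -
  let ?g = "\<lambda>k. (cells bs, i - k)"
  have "(?g k, t) \<in> write_sem (1, 1, Move_Left) \<union> write_sem (2, 2, Move_Left) \<longleftrightarrow>
      k < i \<and> t = ?g (Suc k)" for k t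
  proof (cases "i - k")
    case 0
    then show ?thesis by (auto simp: write_sem_iff cells_0)
  next
    case (Suc m)
    then have *: "k < i" "m < length bs" "i - Suc k = m" using assms by auto
    have "(?g k, t) \<in> write_sem (digit False, digit False, Move_Left) \<union> write_sem (digit True, digit True, Move_Left) \<longleftrightarrow>
        t = (cells bs, m)"
      unfolding Suc Un_iff write_digit using * by (cases "bs ! m") (auto simp: list_update_same_conv[THEN iffD2])
    with * show ?thesis by (simp only: digit_simps) simp
  qed
  from rtrancl_chain_iff[of ?g, OF this]
  have "((cells bs, i), t) \<in> sem write_sem rewind \<longleftrightarrow> (\<exists>k\<le>i. (?g k, t) \<in> write_sem (3, 3, Stay))"
    by (auto simp: rewind_def all_less_iff)
  also have "\<dots> \<longleftrightarrow> t = (cells bs, 0)"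
    by (auto simp: write_sem_iff cells_0 intro: exI[of _ i])
  finally show ?thesis .
qed

lemma carry_iff: "((cells bs, 0), t) \<in> sem write_sem (carry b) \<longleftrightarrow>
    (\<exists>i\<le>length bs. (\<forall>j<i. bs ! j = b) \<and> t = (cells (replicate i (\<not> b) @ drop i bs), Suc i))"
proof -
  let ?g = "\<lambda>i. (cells (replicate i (\<not> b) @ drop i bs), Suc i)"
  have upd: "(replicate i (\<not> b) @ drop i bs)[i := \<not> b] = replicate (Suc i) (\<not> b) @ drop (Suc i) bs"
    if "i < length bs" for i
    using that by (simp add: list_update_append Cons_nth_drop_Suc[symmetric] replicate_append_same)
  have "(?g i, t) \<in> write_sem (digit b, digit (\<not> b), Move_Right) \<longleftrightarrow>
      (i < length bs \<and> bs ! i = b) \<and> t = ?g (Suc i)" for i t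
    unfolding write_digit using upd[of i] by (auto simp: nth_append)
  from rtrancl_chain_iff[of ?g, OF this]
  have "(?g 0, t) \<in> (write_sem (digit b, digit (\<not> b), Move_Right))\<^sup>* \<longleftrightarrow>
      (\<exists>i. t = ?g i \<and> (\<forall>j<i. j < length bs \<and> bs ! j = b))" for t .
  moreover have "(\<forall>j<i. j < length bs \<and> bs ! j = b) \<longleftrightarrow> i \<le> length bs \<and> (\<forall>j<i. bs ! j = b)" for i
    using all_less_iff by blast
  moreover have "((cells bs, 0), t) \<in> sem write_sem (carry b) \<longleftrightarrow>
      (?g 0, t) \<in> (write_sem (digit b, digit (\<not> b), Move_Right))\<^sup>*"
    by (simp add: carry_def sem_Seq_iff write_marker del: sem.simps(2))
  ultimately show ?thesis by simp blast
qed

lemma finish_iff: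
  assumes "i \<le> length bs"
  shows "((cells (replicate i (\<not> b) @ drop i bs), Suc i), t) \<in>
      sem write_sem (Seq (Atom (digit (\<not> b), digit b, Move_Left)) rewind) \<longleftrightarrow>
    i < length bs \<and> bs ! i = (\<not> b) \<and> t = (cells (replicate i (\<not> b) @ b # drop (Suc i) bs), 0)"
proof (cases "i < length bs")
  case True
  then have "(replicate i (\<not> b) @ drop i bs)[i := b] = replicate i (\<not> b) @ b # drop (Suc i) bs"
    by (simp add: list_update_append Cons_nth_drop_Suc[symmetric])
  moreover have "(replicate i (\<not> b) @ drop i bs) ! i = bs ! i" using True by (simp add: nth_append)
  ultimately show ?thesis
    using True by (auto simp: sem_Seq_iff write_digit rewind_iff simp del: sem.simps(2))
next
  case False
  with assms show ?thesis by (auto simp: write_digit)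
qed

lemma first_bit:
  assumes "\<forall>j<i. bs ! j = b" "i < length bs" "bs ! i = (\<not> b)"
  shows "bs = replicate i b @ (\<not> b) # drop (Suc i) bs"
proof -
  have "take i bs = replicate i b" using assms(1,2) by (intro nth_equalityI) auto
  with id_take_nth_drop[OF assms(2)] assms(3) show ?thesis by simp
qed

lemma ex_first_bit:
  assumes "\<exists>c\<in>set bs. c \<noteq> b"
  shows "\<exists>i<length bs. (\<forall>j<i. bs ! j = b) \<and> bs ! i = (\<not> b)"
proof -
  from assms obtain k where "k < length bs \<and> bs ! k = (\<not> b)" by (auto simp: in_set_conv_nth)
  from LeastI[of "\<lambda>k. k < length bs \<and> bs ! k = (\<not> b)", OF this]
    not_less_Least[of _ "\<lambda>k. k < length bs \<and> bs ! k = (\<not> b)"]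
  show ?thesis by (meson order.strict_trans)
qed

lemma val_flip:
  "val (replicate i False @ True # r) = Suc (val (replicate i True @ False # r))"
  by (simp add: val_append val_replicate)

text \<open>Lists of equal length are determined by their values, so the result can be described by
  value alone. On overflow no list of the given length qualifies, in accordance with the failure of
  the program.\<close>

lemma flip_iff: "((cells bs, 0), t) \<in> sem write_sem (flip b) \<longleftrightarrow>
    (\<exists>cs. length cs = length bs \<and> t = (cells cs, 0) \<and>
      (if b then val cs = Suc (val bs) else val bs = Suc (val cs)))"
proof -
  have "((cells bs, 0), t) \<in> sem write_sem (flip b) \<longleftrightarrow>
    (\<exists>i<length bs. (\<forall>j<i. bs ! j = b) \<and> bs ! i = (\<not> b) \<and>
       t = (cells (replicate i (\<not> b) @ b # drop (Suc i) bs), 0))"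
    unfolding flip_def sem_Seq_iff[of _ _ _ "carry b"] carry_iff using finish_iff by (metis less_imp_le)
  also have "\<dots> \<longleftrightarrow> (\<exists>cs. length cs = length bs \<and> t = (cells cs, 0) \<and>
      (if b then val cs = Suc (val bs) else val bs = Suc (val cs)))" (is "?l \<longleftrightarrow> ?r")
  proof
    assume ?l
    then obtain i where i: "i < length bs" "\<forall>j<i. bs ! j = b" "bs ! i = (\<not> b)"
      "t = (cells (replicate i (\<not> b) @ b # drop (Suc i) bs), 0)" by blast
    with first_bit[OF i(2,1,3)] val_flip[of i "drop (Suc i) bs"] show ?r
      by (intro exI[of _ "replicate i (\<not> b) @ b # drop (Suc i) bs"]) (cases b; simp)
  next
    assume ?r
    then obtain cs where cs: "length cs = length bs" "t = (cells cs, 0)"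
      "if b then val cs = Suc (val bs) else val bs = Suc (val cs)" by blast
    \<comment> \<open>Otherwise all digits are \<open>b\<close>, and no list of the same length has
      the next or the previous value.\<close>
    have "\<exists>c\<in>set bs. c \<noteq> b"
      using cs(1,3) val_less[of cs] all_True_iff[of bs] all_False_iff[of bs] by (cases b) auto
    from ex_first_bit[OF this] obtain i where i: "i < length bs" "\<forall>j<i. bs ! j = b" "bs ! i = (\<not> b)"
      by blast
    let ?cs = "replicate i (\<not> b) @ b # drop (Suc i) bs"
    have "val ?cs = val cs"
      using first_bit[OF i(2,1,3)] val_flip[of i "drop (Suc i) bs"] cs(3) by (cases b) simp_all
    moreover have "length ?cs = length cs" using i(1) cs(1) by simp
    ultimately have "?cs = cs" using val_inject by blast
    with i cs(2) show ?l by blast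
  qed
  finally show ?thesis .
qed

lemma incr_first:
  "(\<forall>j<i. bs ! j) \<Longrightarrow> i \<le> length bs \<Longrightarrow> (i < length bs \<Longrightarrow> \<not> bs ! i) \<Longrightarrow>
    incr bs = replicate i False @ True # drop (Suc i) bs"
proof (induction bs arbitrary: i rule: incr.induct)
  case (2 bs)
  then show ?case by (cases i) auto
next
  case (3 bs)
  show ?case
  proof (cases i)
    case (Suc k)
    have "\<forall>j<k. bs ! j" using 3(2) Suc by (metis Suc_less_eq nth_Cons_Suc)
    with 3 Suc show ?thesis by simp
  qed (use 3 in auto)
qed auto

lemma flip_ext_iff: "((cells bs, 0), t) \<in> sem write_sem flip_ext \<longleftrightarrow> t = (cells (incr bs), 0)"
proof -
  have *: "((cells (replicate i False @ drop i bs), Suc i), t) \<in>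
      sem write_sem (Seq (Choice (Atom (1, 2, Move_Left)) (Atom (0, 2, Move_Left))) rewind) \<longleftrightarrow>
    (i < length bs \<longrightarrow> \<not> bs ! i) \<and> t = (cells (replicate i False @ True # drop (Suc i) bs), 0)"
    if "i \<le> length bs" for i
  proof (cases "i < length bs")
    case True
    then have "cells (replicate i False @ drop i bs) (Suc i) \<noteq> 0" by (simp add: cells_eq_0)
    with finish_iff[OF that, of True] True show ?thesis
      by (auto simp: digit_simps write_sem_iff[of _ _ _ 0])
  next
    case False
    with that have i: "i = length bs" by simp
    have "((cells (replicate i False), Suc i), u) \<in> write_sem (1, 2, Move_Left) \<union> write_sem (0, 2, Move_Left)
        \<longleftrightarrow> u = (cells (replicate i False @ [True]), i)" for u
      using cells_end[of "replicate i False" True] cells_eq_0[of "replicate i False" "Suc i"]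
      by (auto simp: write_sem_iff digit_simps)
    with rewind_iff[of i "replicate i False @ [True]"] i show ?thesis
      by (simp add: sem_Seq_iff del: sem.simps(2))
  qed
  have "((cells bs, 0), t) \<in> sem write_sem flip_ext \<longleftrightarrow>
    (\<exists>i\<le>length bs. (\<forall>j<i. bs ! j) \<and> (i < length bs \<longrightarrow> \<not> bs ! i) \<and>
       t = (cells (replicate i False @ True # drop (Suc i) bs), 0))"
    unfolding flip_ext_def sem_Seq_iff[of _ _ _ "carry True"] carry_iff using * by (auto simp del: sem.simps)
  also have "\<dots> \<longleftrightarrow> (\<exists>i\<le>length bs. (\<forall>j<i. bs ! j) \<and> (i < length bs \<longrightarrow> \<not> bs ! i) \<and> t = (cells (incr bs), 0))"
    using incr_first by metis
  also have "\<dots> \<longleftrightarrow> t = (cells (incr bs), 0)"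
  proof -
    have "\<exists>i\<le>length bs. (\<forall>j<i. bs ! j) \<and> (i < length bs \<longrightarrow> \<not> bs ! i)"
    proof (cases "\<forall>c\<in>set bs. c")
      case True
      then show ?thesis by (intro exI[of _ "length bs"]) auto
    next
      case False
      with ex_first_bit[of bs True] show ?thesis by (auto dest: less_imp_le)
    qed
    then show ?thesis by blast
  qed
  finally show ?thesis .
qed

lemma all_bits_iff: "((cells bs, 0), t) \<in> sem write_sem (all_bits b) \<longleftrightarrow>
    (\<forall>c\<in>set bs. c = b) \<and> t = (cells bs, 0)"
proof -
  let ?g = "\<lambda>i. (cells bs, Suc i)"
  have "(?g i, t) \<in> write_sem (digit b, digit b, Move_Right) \<longleftrightarrow>
      (i < length bs \<and> bs ! i = b) \<and> t = ?g (Suc i)" for i t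
    unfolding write_digit by (auto simp: list_update_same_conv[THEN iffD2])
  from rtrancl_chain_iff[of ?g, OF this]
  have "(?g 0, t) \<in> (write_sem (digit b, digit b, Move_Right))\<^sup>* \<longleftrightarrow>
      (\<exists>i. t = ?g i \<and> (\<forall>j<i. j < length bs \<and> bs ! j = b))" for t .
  then have "((cells bs, 0), t) \<in> sem write_sem (all_bits b) \<longleftrightarrow>
      (\<exists>i. (\<forall>j<i. j < length bs \<and> bs ! j = b) \<and> (?g i, t) \<in> sem write_sem (Seq (Atom (0, 0, Move_Left)) rewind))"
    by (simp add: all_bits_def sem_Seq_iff write_marker del: sem.simps(2)) auto
  also have "\<dots> \<longleftrightarrow> (\<exists>i. (\<forall>j<i. j < length bs \<and> bs ! j = b) \<and> length bs \<le> i \<and> t = (cells bs, 0))"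
  proof -
    have "(?g i, t) \<in> sem write_sem (Seq (Atom (0, 0, Move_Left)) rewind) \<longleftrightarrow>
        length bs \<le> i \<and> t = (cells bs, 0)" if "i \<le> length bs" for i
    proof (cases "length bs \<le> i")
      case True
      then have "(cells bs)(Suc i := 0) = cells bs" by (simp add: fun_upd_idem_iff cells_eq_0)
      with True rewind_iff[OF that, of t] show ?thesis
        by (auto simp: sem_Seq_iff write_sem_iff cells_eq_0 simp del: sem.simps(2))
    qed (auto simp: write_sem_iff cells_eq_0)
    moreover have "(\<forall>j<i. j < length bs \<and> bs ! j = b) \<Longrightarrow> i \<le> length bs" for i
      using all_less_iff by blast
    ultimately show ?thesis by blast
  qed
  also have "\<dots> \<longleftrightarrow> (\<forall>c\<in>set bs. c = b) \<and> t = (cells bs, 0)"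
    by (auto simp: all_set_conv_all_nth) 
  finally show ?thesis .
qed

text \<open>Counting down to zero keeps the number of digits, and with it the capacity of the
  tape.\<close>

definition clear_tape :: "tape_op prog" where
  "clear_tape = Seq (Star (flip False)) (all_bits False)"

lemma clear_tape_iff: "((cells bs, 0), t) \<in> sem write_sem clear_tape \<longleftrightarrow>
    t = (cells (replicate (length bs) False), 0)"
proof
  assume "((cells bs, 0), t) \<in> sem write_sem clear_tape"
  then obtain u where u: "((cells bs, 0), u) \<in> (sem write_sem (flip False))\<^sup>*"
    "(u, t) \<in> sem write_sem (all_bits False)" by (auto simp: clear_tape_def)
  from u(1) have "\<exists>cs. u = (cells cs, 0) \<and> length cs = length bs"
    by (induction rule: rtrancl_induct) (auto simp: flip_iff)
  with u(2) show "t = (cells (replicate (length bs) False), 0)"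
    by (auto simp: all_bits_iff) (metis replicate_eqI)
next
  assume t: "t = (cells (replicate (length bs) False), 0)"
  have "((cells bs, 0), t) \<in> (sem write_sem (flip False))\<^sup>*"
    unfolding t
  proof (induction "val bs" arbitrary: bs)
    case 0
    then have "bs = replicate (length bs) False" using all_False_iff[of bs] by (auto intro: replicate_eqI)
    then show ?case by simp
  next
    case (Suc v)
    then have "\<exists>c\<in>set bs. c \<noteq> False" using all_False_iff[of bs] by auto
    from ex_first_bit[OF this] obtain i where "i < length bs" "\<forall>j<i. bs ! j = False" "bs ! i = (\<not> False)"
      by blast
    with first_bit[of i bs False] have bs: "bs = replicate i False @ True # drop (Suc i) bs" by simp
    define cs where "cs = replicate i True @ False # drop (Suc i) bs"
    have "val bs = Suc (val cs)" using bs val_flip[of i "drop (Suc i) bs"] by (simp add: cs_def)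
    moreover have "length cs = length bs" using \<open>i < length bs\<close> by (simp add: cs_def)
    ultimately have cs: "length cs = length bs" "val bs = Suc (val cs)" by simp_all
    then have "((cells bs, 0), (cells cs, 0)) \<in> sem write_sem (flip False)"
      by (auto simp: flip_iff)
    moreover from Suc(1)[of cs] Suc(2) cs
    have "((cells cs, 0), cells (replicate (length bs) False), 0) \<in> (sem write_sem (flip False))\<^sup>*"
      by simp
    ultimately show ?case by (rule converse_rtrancl_into_rtrancl)
  qed
  moreover have "(t, t) \<in> sem write_sem (all_bits False)"
    unfolding t by (simp add: all_bits_iff)
  ultimately show "((cells bs, 0), t) \<in> sem write_sem clear_tape" by (auto simp: clear_tape_def)
qed

section \<open>Space used on a single tape\<close>

text \<open>The head may stand on the first blank, where a carry or a scan ends, but not beyond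
  it.\<close>

definition shape :: "nat \<Rightarrow> tape set" where
  "shape m = {(cells bs, h) | bs h. length bs \<le> m \<and> h \<le> length bs + 1}"

text \<open>The operations that never lengthen a counter: on a blank they can only step
  back.\<close>

definition plain_ops :: "tape_op set" where
  "plain_ops = {(3, 3, d) | d. True} \<union> {(digit b, digit c, d) | b c d. True} \<union> {(0, 0, Move_Left)}"

lemma plain_shape:
  assumes "op \<in> plain_ops"
  shows "write_sem op `` shape m \<subseteq> shape m"
proof
  fix t assume "t \<in> write_sem op `` shape m"
  then obtain bs h where m: "length bs \<le> m" "h \<le> length bs + 1" and t: "((cells bs, h), t) \<in> write_sem op"
    by (auto simp: shape_def)
  have sh: "shift d h \<le> length bs + 1" if "d = Move_Left \<or> h \<le> length bs" for d
    using that m(2) by (cases d) auto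
  from assms consider d where "op = (3, 3, d)" | b c d where "op = (digit b, digit c, d)" | "op = (0, 0, Move_Left)"
    by (auto simp: plain_ops_def)
  then show "t \<in> shape m"
  proof cases
    case 1
    with t have "h = 0" "t = (cells bs, shift d h)" by (auto simp: write_sem_iff cells_0)
    with m sh show ?thesis by (auto simp: shape_def)
  next
    case 2
    show ?thesis
    proof (cases h)
      case 0
      with t 2 show ?thesis by (simp add: write_sem_iff cells_0 digit_simps)
    next
      case (Suc i)
      with t 2 have "i < length bs" "t = (cells (bs[i := c]), shift d h)" by (auto simp: write_digit)
      with m sh[of d] Suc show ?thesis unfolding shape_def
        by (intro CollectI exI[of _ "bs[i := c]"] exI[of _ "shift d h"]) simp
    qed
  next
    case 3
    with t have "t = (cells bs, h - 1)" by (auto simp: write_sem_iff fun_upd_idem_iff)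
    with m show ?thesis by (auto simp: shape_def)
  qed
qed

lemma plain_opsI:
  "(3, 3, d) \<in> plain_ops" "(digit b, digit c, d) \<in> plain_ops" "(0, 0, Move_Left) \<in> plain_ops"
  by (auto simp: plain_ops_def)

lemma plain_opsI2: "(1, 1, d) \<in> plain_ops" "(1, 2, d) \<in> plain_ops" "(2, 1, d) \<in> plain_ops" "(2, 2, d) \<in> plain_ops"
  using plain_opsI(2)[of False False d] plain_opsI(2)[of False True d]
    plain_opsI(2)[of True False d] plain_opsI(2)[of True True d]
  by (simp_all add: digit_simps(1,2))

lemma plain_programs:
  "set_prog rewind \<subseteq> plain_ops" "set_prog (carry b) \<subseteq> plain_ops" "set_prog (flip b) \<subseteq> plain_ops"
  "set_prog (all_bits b) \<subseteq> plain_ops" "set_prog clear_tape \<subseteq> plain_ops"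
  by (simp_all add: rewind_def carry_def flip_def all_bits_def clear_tape_def digit_def plain_opsI(1,3)
      plain_opsI2[simplified])

lemma shape_mono: "m \<le> n \<Longrightarrow> shape m \<subseteq> shape n"
proof
  fix t assume "m \<le> n" "t \<in> shape m"
  then obtain bs h where "t = (cells bs, h)" "length bs \<le> n" "h \<le> length bs + 1"
    unfolding shape_def by fastforce
  then show "t \<in> shape n" unfolding shape_def by blast
qed

lemma plain_invariant:
  assumes "set_prog c \<subseteq> plain_ops"
  shows "sem write_sem c `` shape m \<subseteq> shape m" and "mid write_sem c `` shape m \<subseteq> shape m"
proof -
  have *: "write_sem a `` shape m \<subseteq> shape m" if "a \<in> set_prog c" for a
    using assms that plain_shape by blast
  show "sem write_sem c `` shape m \<subseteq> shape m" by (rule sem_invariant) (rule *)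
  show "mid write_sem c `` shape m \<subseteq> shape m" by (rule mid_invariant) (rule *)
qed

text \<open>\<open>(0, 2, Move_Left)\<close> is the one operation outside \<open>plain_ops\<close>.
  It is executed at most once and only \<open>rewind\<close> follows it, so one more digit suffices
  throughout.\<close>

lemma mid_flip_ext: "mid write_sem flip_ext `` shape m \<subseteq> shape (Suc m)"
proof -
  let ?X = "Choice (Atom (1, 2, Move_Left)) (Atom (0, 2, Move_Left))"
  note carry = plain_invariant[OF plain_programs(2)[of True], of m]
  note rewind = plain_invariant(2)[OF plain_programs(1), of "Suc m"]
  have "write_sem (digit False, digit True, Move_Left) `` shape m \<subseteq> shape m"
    by (rule plain_shape) (auto simp: plain_ops_def)
  then have X1: "write_sem (1, 2, Move_Left) `` shape m \<subseteq> shape (Suc m)"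
    using shape_mono[of m "Suc m"] by (simp only: digit_simps) auto
  have X2: "write_sem (0, 2, Move_Left) `` shape m \<subseteq> shape (Suc m)"
  proof
    fix t assume "t \<in> write_sem (0, 2, Move_Left) `` shape m"
    then obtain bs h where m: "length bs \<le> m" "h \<le> length bs + 1"
      and t: "((cells bs, h), t) \<in> write_sem (0, 2, Move_Left)" by (auto simp: shape_def)
    then have "h = Suc (length bs)" by (auto simp: write_sem_iff cells_eq_0)
    with t have "t = (cells (bs @ [True]), length bs)"
      using cells_end[of bs True] by (simp add: write_sem_iff digit_simps)
    with m show "t \<in> shape (Suc m)" unfolding shape_def
      by (intro CollectI exI[of _ "bs @ [True]"] exI[of _ "length bs"]) simp
  qed
  have X: "sem write_sem ?X `` shape m \<subseteq> shape (Suc m)" "mid write_sem ?X `` shape m \<subseteq> shape (Suc m)"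
    using X1 X2 shape_mono[of m "Suc m"] by (simp_all add: Un_Image)
  have "mid write_sem (Seq ?X rewind) `` shape m \<subseteq> shape (Suc m)"
    unfolding mid.simps(2) Un_Image relcomp_Image using X rewind by blast
  then show ?thesis
    unfolding flip_ext_def mid.simps(2)[of _ "carry True"] Un_Image relcomp_Image
    using carry(2) shape_mono[of m "Suc m"] Image_mono[OF order_refl carry(1)] by (meson Un_least le_SucI order_refl order_trans)
qed

section \<open>Simulation along an encoding function\<close>

lemma bisim_image:
  assumes "\<And>s t. P s \<Longrightarrow> (g s, t) \<in> S \<longleftrightarrow> (\<exists>s'. (s, s') \<in> R \<and> t = g s')"
    and "\<And>s s'. P s \<Longrightarrow> (s, s') \<in> R \<Longrightarrow> P s'"
  shows "bisim {(s, g s) | s. P s} R S"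
  unfolding bisim_def
proof (intro allI impI conjI)
  fix s t s' assume "(s, t) \<in> {(s, g s) | s. P s}" "(s, s') \<in> R"
  then have "P s" "t = g s" "(s, s') \<in> R" by auto
  with assms(1)[of s "g s'"] assms(2)[of s s'] show "\<exists>t'. (t, t') \<in> S \<and> (s', t') \<in> {(s, g s) | s. P s}"
    by (intro exI[of _ "g s'"]) auto
next
  fix s t t' assume "(s, t) \<in> {(s, g s) | s. P s}" "(t, t') \<in> S"
  then have "P s" "t = g s" "(g s, t') \<in> S" by auto
  with assms(1)[of s t'] obtain s' where "(s, s') \<in> R" "t' = g s'" by auto
  with \<open>P s\<close> assms(2)[of s s'] show "\<exists>s'. (s, s') \<in> R \<and> (s', t') \<in> {(s, g s) | s. P s}"
    by (intro exI[of _ s']) auto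
qed

lemma bisim_imageD:
  assumes "bisim {(s, g s) | s. P s} R S" "P s"
  shows "(g s, t) \<in> S \<longleftrightarrow> (\<exists>s'. (s, s') \<in> R \<and> t = g s')"
proof
  have \<rho>: "(s, g s) \<in> {(s, g s) | s. P s}" using assms(2) by auto
  show "\<exists>s'. (s, s') \<in> R \<and> t = g s'" if "(g s, t) \<in> S"
    using assms(1)[unfolded bisim_def, rule_format, OF \<rho>, THEN conjunct2, rule_format, OF that] by auto
  show "(g s, t) \<in> S" if "\<exists>s'. (s, s') \<in> R \<and> t = g s'"
  proof -
    from that obtain s' where s': "(s, s') \<in> R" "t = g s'" by blast
    from assms(1)[unfolded bisim_def, rule_format, OF \<rho>, THEN conjunct1, rule_format, OF s'(1)] s'(2)
    show ?thesis by auto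
  qed
qed

text \<open>The programs substituted for atoms have no intermediate states of their own; otherwise
  an unfinished run could visit a state without counterpart.\<close>

lemma bisim_mid_bind:
  assumes "\<And>a. a \<in> set_prog c \<Longrightarrow> bisim \<rho> (I a) (sem J (g a))"
    and "\<And>a. a \<in> set_prog c \<Longrightarrow> mid J (g a) = Id \<union> sem J (g a)"
  shows "bisim \<rho> (mid I c) (mid J (bind g c))"
proof -
  have Id: "bisim \<rho> Id Id" unfolding bisim_def by blast
  from assms show ?thesis
  proof (induction c)
    case (Atom a)
    then show ?case by (simp add: bisim_Un Id)
  next
    case (Seq c d)
    then show ?case by (simp add: bisim_Un bisim_relcomp bisim_bind)
  next
    case (Choice c d)
    then show ?case by (simp add: bisim_Un)
  next
    case (Star c)
    then show ?case by (simp add: bisim_Un bisim_relcomp bisim_rtrancl bisim_bind)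
  qed
qed

subsection \<open>Programs for several tapes\<close>

text \<open>A transition names the symbols on all \<open>K\<close> tapes, so an operation on one
  tape becomes a set of transitions, one for each reading of the other tapes. Restricting the
  readings to the four symbols in use keeps this set finite.\<close>

definition symbols :: "nat \<Rightarrow> nat list set" where
  "symbols K = {bs. set bs \<subseteq> {..<4} \<and> length bs = K}"

definition idle :: "nat list \<Rightarrow> (nat \<times> direction) list" where "idle = map (\<lambda>b. (b, Stay))"

fun on_tape :: "nat \<Rightarrow> nat \<Rightarrow> tape_op \<Rightarrow> 'a act set prog" where
  "on_tape K j (b, b', d) =
     Atom {(a, bs, Stay, (idle bs)[j := (b', d)]) | a bs. bs \<in> symbols K \<and> bs ! j = b}"

definition head_op :: "nat \<Rightarrow> direction \<Rightarrow> 'a act set prog" where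
  "head_op K d = Atom {(a, bs, d, idle bs) | a bs. bs \<in> symbols K}"

definition cell_op :: "nat \<Rightarrow> 'a cell set \<Rightarrow> 'a act set prog" where
  "cell_op K A = Atom {(a, bs, Stay, idle bs) | a bs. bs \<in> symbols K \<and> a \<in> A}"

definition proper :: "nat \<Rightarrow> tape list \<Rightarrow> bool" where
  "proper K ts \<longleftrightarrow> length ts = K \<and> (\<forall>t\<in>set ts. \<forall>i. fst t i < 4)"

lemma finite_symbols: "finite (symbols K)"
  unfolding symbols_def by (rule finite_lists_length_eq) simp

lemma proper_symbols: "proper K ts \<Longrightarrow> map read_tape ts \<in> symbols K"
  by (fastforce simp: proper_def symbols_def)

lemma update_idle: "map2 update_tape ts (idle (map read_tape ts)) = ts"
  by (induction ts) (auto simp: idle_def)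

lemma head_op_iff:
  assumes "proper K ts" "p \<le> length w + 1"
  shows "((p, ts), s) \<in> sem (act_sem w) (head_op K d) \<longleftrightarrow> s = (min (shift d p) (length w + 1), ts)"
  using proper_symbols[OF assms(1)] by (auto simp: head_op_def act_sem_def update_idle)

lemma cell_op_iff:
  assumes "proper K ts" "p \<le> length w + 1"
  shows "((p, ts), s) \<in> sem (act_sem w) (cell_op K A) \<longleftrightarrow> input_cell w p \<in> A \<and> s = (p, ts)"
  using proper_symbols[OF assms(1)] assms(2) by (auto simp: cell_op_def act_sem_def update_idle)

lemma mid_ops:
  "mid (act_sem w) (on_tape K j op) = Id \<union> sem (act_sem w) (on_tape K j op)"
  "mid (act_sem w) (head_op K d) = Id \<union> sem (act_sem w) (head_op K d)"
  "mid (act_sem w) (cell_op K A) = Id \<union> sem (act_sem w) (cell_op K A)"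
  by (cases op) (simp_all add: head_op_def cell_op_def)

lemma on_tape_op_iff:
  assumes "proper K ts" "p \<le> length w + 1" "j < K"
  shows "((p, ts), s) \<in> sem (act_sem w) (on_tape K j op) \<longleftrightarrow>
    (\<exists>t. (ts ! j, t) \<in> write_sem op \<and> s = (p, ts[j := t]))"
proof -
  obtain b b' d where op: "op = (b, b', d)" by (cases op)
  obtain f h where fh: "ts ! j = (f, h)" by (cases "ts ! j")
  have "map2 update_tape ts ((idle (map read_tape ts))[j := (b', d)]) = ts[j := update_tape (ts ! j) (b', d)]"
    using update_idle[of ts] zip_update[of ts j "ts ! j" "idle (map read_tape ts)" "(b', d)"]
    by (simp add: map_update)
  then show ?thesis
    using proper_symbols[OF assms(1)] assms fh
    by (auto simp: op act_sem_def write_sem_iff proper_def)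
qed

text \<open>On configurations that differ from \<open>(p, ts)\<close> in tape \<open>j\<close> only,
  the lifted program simulates \<open>c\<close>. The bound on the written symbols keeps all tapes
  readable by \<open>symbols K\<close>.\<close>

lemma on_tape_iff:
  assumes "proper K ts" "p \<le> length w + 1" "j < K" and "\<And>b b' d. (b, b', d) \<in> set_prog c \<Longrightarrow> b' < 4"
  shows "((p, ts), s) \<in> sem (act_sem w) (bind (on_tape K j) c) \<longleftrightarrow>
      (\<exists>t. (ts ! j, t) \<in> sem write_sem c \<and> s = (p, ts[j := t]))"
    and "((p, ts), s) \<in> mid (act_sem w) (bind (on_tape K j) c) \<longleftrightarrow>
      (\<exists>t. (ts ! j, t) \<in> mid write_sem c \<and> s = (p, ts[j := t]))"
proof -
  let ?\<rho> = "{(t, (p, ts[j := t])) | t. \<forall>i. fst t i < 4}"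
  have "bisim ?\<rho> (write_sem op) (sem (act_sem w) (on_tape K j op))" if "op \<in> set_prog c" for op
  proof (rule bisim_image)
    fix t :: tape and s assume t: "\<forall>i. fst t i < 4"
    then have "proper K (ts[j := t])" "ts[j := t] ! j = t"
      using assms(1,3) set_update_subset_insert[of ts j t] by (auto simp: proper_def)
    with on_tape_op_iff[OF this(1) assms(2,3), of s op]
    show "((p, ts[j := t]), s) \<in> sem (act_sem w) (on_tape K j op) \<longleftrightarrow>
        (\<exists>s'. (t, s') \<in> write_sem op \<and> s = (p, ts[j := s']))" by simp
  next
    fix t t' :: tape assume t: "\<forall>i. fst t i < 4" "(t, t') \<in> write_sem op"
    obtain b b' d where op: "op = (b, b', d)" by (cases op)
    with assms(4) that have "b' < 4" by blast
    with t op show "\<forall>i. fst t' i < 4" by (cases t) (simp add: write_sem_iff)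
  qed
  note \<rho> = bisim_bind[of c ?\<rho> write_sem "act_sem w" "on_tape K j", OF this]
    bisim_mid_bind[of c ?\<rho> write_sem "act_sem w" "on_tape K j", OF this mid_ops(1)]
  have "\<forall>i. fst (ts ! j) i < 4" using assms(1,3) by (auto simp: proper_def)
  from bisim_imageD[OF \<rho>(1) this, of s] bisim_imageD[OF \<rho>(2) this, of s]
  show "((p, ts), s) \<in> sem (act_sem w) (bind (on_tape K j) c) \<longleftrightarrow>
      (\<exists>t. (ts ! j, t) \<in> sem write_sem c \<and> s = (p, ts[j := t]))"
    and "((p, ts), s) \<in> mid (act_sem w) (bind (on_tape K j) c) \<longleftrightarrow>
      (\<exists>t. (ts ! j, t) \<in> mid write_sem c \<and> s = (p, ts[j := t]))"
    by (simp_all only: list_update_id)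
qed

lemma written_digits:
  assumes "set_prog c \<subseteq> plain_ops \<union> {(0, 2, Move_Left)}" "(b, b', d) \<in> set_prog c"
  shows "b' < 4"
  using assms by (fastforce simp: plain_ops_def digit_simps)

lemma set_flip_ext: "set_prog flip_ext \<subseteq> plain_ops \<union> {(0, 2, Move_Left)}"
  using plain_programs(1) plain_programs(2)[of True] plain_opsI2(2)
  by (auto simp: flip_ext_def)

text \<open>
  A tape is given the right length by counting the cells of the input on it; afterwards it never
  grows again.
\<close>

definition count_input :: "nat \<Rightarrow> nat \<Rightarrow> 'a act set prog" where
  "count_input K j = Seq (cell_op K (- {Right_End}))
     (Seq (bind (on_tape K j) flip_ext) (head_op K Move_Right))"

definition home :: "nat \<Rightarrow> 'a act set prog" where
  "home K = Seq (Star (Seq (cell_op K (- {Left_End})) (head_op K Move_Left))) (cell_op K {Left_End})"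

definition init_tape :: "nat \<Rightarrow> nat \<Rightarrow> 'a act set prog" where
  "init_tape K j = Seq (on_tape K j (0, 3, Stay)) (Seq (Star (count_input K j))
     (Seq (cell_op K {Right_End}) (Seq (home K) (bind (on_tape K j) clear_tape))))"

definition zero_tape :: "nat \<Rightarrow> tape" where
  "zero_tape n = (cells (replicate (width n) False), 0)"

lemma input_cell_iff:
  "input_cell w p = Right_End \<longleftrightarrow> length w < p" "input_cell w p = Left_End \<longleftrightarrow> p = 0"
  by (auto simp: input_cell_def)

lemma proper_update: "proper K ts \<Longrightarrow> \<forall>i. fst t i < 4 \<Longrightarrow> proper K (ts[j := t])"
  using set_update_subset_insert[of ts j t] by (auto simp: proper_def)

lemma proper_update_cells: "proper K ts \<Longrightarrow> proper K (ts[j := (cells bs, h)])"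
  by (rule proper_update) (simp_all add: cells_less)

lemma home_iff:
  assumes "proper K ts" "p \<le> length w + 1"
  shows "((p, ts), s) \<in> sem (act_sem w) (home K) \<longleftrightarrow> s = (0, ts)"
proof -
  let ?g = "\<lambda>i. (p - i, ts)"
  have "(?g i, t) \<in> sem (act_sem w) (Seq (cell_op K (- {Left_End})) (head_op K Move_Left)) \<longleftrightarrow>
      i < p \<and> t = ?g (Suc i)" for i t
    using assms by (auto simp: sem_Seq_iff cell_op_iff head_op_iff input_cell_iff simp del: sem.simps(2))
  from rtrancl_chain_iff[of ?g, OF this] have
    "((p, ts), s) \<in> sem (act_sem w) (home K) \<longleftrightarrow> (\<exists>i\<le>p. (?g i, s) \<in> sem (act_sem w) (cell_op K {Left_End}))"
    unfolding home_def sem_Seq_iff sem.simps(4) by (auto simp: all_less_iff)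
  also have "\<dots> \<longleftrightarrow> s = (0, ts)"
    using assms by (auto simp: cell_op_iff input_cell_iff)
  finally show ?thesis .
qed

lemma count_input_iff:
  assumes "proper K ts" "j < K"
  shows "((p, ts[j := (cells bs, 0)]), s) \<in> sem (act_sem w) (count_input K j) \<longleftrightarrow>
    p \<le> length w \<and> s = (p + 1, ts[j := (cells (incr bs), 0)])"
proof (cases "p \<le> length w")
  case True
  have j: "j < length ts" using assms by (simp add: proper_def)
  have *: "((p, ts[j := (cells bs, 0)]), u) \<in> sem (act_sem w) (bind (on_tape K j) flip_ext) \<longleftrightarrow>
      u = (p, ts[j := (cells (incr bs), 0)])" for u
    using True j assms(2)
    by (subst on_tape_iff(1)[OF proper_update_cells[OF assms(1)] _ _ written_digits[OF set_flip_ext]])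
      (auto simp: flip_ext_iff)
  show ?thesis
    using True *
    by (auto simp: count_input_def sem_Seq_iff cell_op_iff head_op_iff proper_update_cells[OF assms(1)]
        input_cell_iff simp del: sem.simps(2))
next
  case False
  then have "input_cell w p = Right_End" by (simp add: input_cell_iff)
  then show ?thesis using False by (auto simp: count_input_def cell_op_def act_sem_def)
qed

lemma counts_iff:
  assumes "proper K ts" "j < K"
  shows "((0, ts[j := (cells [], 0)]), s) \<in> (sem (act_sem w) (count_input K j))\<^sup>* \<longleftrightarrow>
    (\<exists>i\<le>length w + 1. s = (i, ts[j := (cells (bits i), 0)]))"
proof -
  let ?g = "\<lambda>i. (i, ts[j := (cells (bits i), 0)])"
  have "(?g i, t) \<in> sem (act_sem w) (count_input K j) \<longleftrightarrow> i < length w + 1 \<and> t = ?g (Suc i)" for i t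
    using count_input_iff[OF assms, where w = w] by (auto simp: bits_simps)
  from rtrancl_chain_iff[of ?g, OF this] show ?thesis by (auto simp: bits_simps all_less_iff)
qed

lemma start_iff:
  assumes "proper K ts" "j < K" "ts ! j = tape0"
  shows "((0, ts), s) \<in> sem (act_sem w) (on_tape K j (0, 3, Stay)) \<longleftrightarrow> s = (0, ts[j := (cells [], 0)])"
proof -
  have "(\<lambda>_. 0)(0 := 3) = cells []" by (auto simp: cells_def)
  with on_tape_op_iff[OF assms(1) _ assms(2), of 0 w s "(0, 3, Stay)"] assms(3) show ?thesis
    by (simp add: tape0_def write_sem_iff)
qed

text \<open>The loop runs once for each cell before the right end marker, and the test for that
  marker forbids leaving it earlier. The counter then holds \<open>length w + 1\<close>, which has
  exactly \<open>width (length w)\<close> digits.\<close>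

lemma init_tape_iff:
  assumes "proper K ts" "j < K" "ts ! j = tape0"
  shows "((0, ts), s) \<in> sem (act_sem w) (init_tape K j) \<longleftrightarrow> s = (0, ts[j := zero_tape (length w)])"
proof -
  have j: "j < length ts" using assms by (simp add: proper_def)
  note [simp] = proper_update_cells[OF assms(1)]
  have "((0, ts[j := (cells bs, 0)]), s) \<in> sem (act_sem w) (bind (on_tape K j) clear_tape) \<longleftrightarrow>
      s = (0, ts[j := (cells (replicate (length bs) False), 0)])" for bs
    using plain_programs(5) j assms(2)
    by (subst on_tape_iff(1)[OF proper_update_cells[OF assms(1)] _ _ written_digits])
      (auto simp: clear_tape_iff)
  moreover have "((i, ts[j := (cells bs, 0)]), s) \<in> sem (act_sem w) (cell_op K {Right_End}) \<longleftrightarrow>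
      i = length w + 1 \<and> s = (i, ts[j := (cells bs, 0)])" if "i \<le> length w + 1" for i bs s
    using that by (auto simp: cell_op_iff input_cell_iff)
  ultimately show ?thesis
    unfolding init_tape_def sem_Seq_iff start_iff[OF assms] sem.simps(4)
    by (auto simp: counts_iff[OF assms(1,2)] home_iff zero_tape_def width_def)
qed

section \<open>Space used while the tapes are prepared\<close>

definition head_bound :: "nat \<Rightarrow> tconf set" where
  "head_bound b = {(p, ts). \<forall>t\<in>set ts. snd t \<le> b}"

lemma head_bound_update: "(p, ts) \<in> head_bound b \<Longrightarrow> snd t \<le> b \<Longrightarrow> (q, ts[j := t]) \<in> head_bound b"
  using set_update_subset_insert[of ts j t] by (auto simp: head_bound_def)

lemma shape_bound: "t \<in> shape m \<Longrightarrow> snd t \<le> m + 1"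
  by (auto simp: shape_def)

lemma mid_SeqI:
  "mid I c `` S \<subseteq> B \<Longrightarrow> sem I c `` S \<subseteq> S' \<Longrightarrow> mid I d `` S' \<subseteq> B \<Longrightarrow> mid I (Seq c d) `` S \<subseteq> B"
  by auto blast

lemma mid_StarI:
  assumes "sem I c `` S \<subseteq> S" "mid I c `` S \<subseteq> B"
  shows "mid I (Star c) `` S \<subseteq> B"
proof -
  have "sem I (Star c) `` S \<subseteq> S" using assms(1) by (simp add: Image_closed_trancl)
  moreover have "S \<subseteq> mid I c `` S" using refl_mid by fast
  ultimately show ?thesis using assms(2) by auto
qed

lemma head_bound_ops:
  "act_sem w {(a, bs, d, idle bs) | a bs. bs \<in> symbols K \<and> Q a} `` head_bound b \<subseteq> head_bound b"
  by (auto simp: act_sem_def update_idle head_bound_def)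

lemma mid_head_op: "mid (act_sem w) (head_op K d) `` head_bound b \<subseteq> head_bound b"
  using head_bound_ops[of w d K "\<lambda>_. True" b] by (auto simp: head_op_def)

lemma mid_cell_op: "mid (act_sem w) (cell_op K A) `` head_bound b \<subseteq> head_bound b"
  using head_bound_ops[of w Stay K "\<lambda>a. a \<in> A" b] by (auto simp: cell_op_def)

lemma mid_home: "mid (act_sem w) (home K) `` head_bound b \<subseteq> head_bound b"
proof (rule mid_invariant)
  fix A :: "'a act set" assume "A \<in> set_prog (home K)"
  then show "act_sem w A `` head_bound b \<subseteq> head_bound b"
    using head_bound_ops[of w Stay K "\<lambda>a. a \<in> - {Left_End}" b] head_bound_ops[of w Move_Left K "\<lambda>_. True" b]
      head_bound_ops[of w Stay K "\<lambda>a. a = Left_End" b]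
    by (auto simp: home_def head_op_def cell_op_def)
qed

text \<open>As far as \<open>mid_flip_ext\<close> tells, a counter with \<open>width\<close> digits
  may gain one more during an increment, and the head may stand on the blank behind it; this is the
  \<open>2\<close> in the bound.\<close>

lemma init_tape_mid:
  assumes "proper K ts" "j < K" "ts ! j = tape0" "(0, ts) \<in> head_bound (width (length w) + 2)"
  shows "mid (act_sem w) (init_tape K j) `` {(0, ts)} \<subseteq> head_bound (width (length w) + 2)"
proof -
  let ?m = "width (length w)"
  let ?B = "head_bound (?m + 2)"
  let ?n = "length w + 1"
  have j: "j < length ts" using assms by (simp add: proper_def)
  have B: "(p, ts[j := t]) \<in> ?B" if "t \<in> shape (?m + 1)" for p t
    using head_bound_update[OF assms(4), of t] shape_bound[OF that] by simp
  have bits: "(cells (bits i), 0) \<in> shape ?m" if "i \<le> ?n" for i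
    using length_bits_mono[OF that] by (auto simp: shape_def width_def)
  have on_tape: "mid (act_sem w) (bind (on_tape K j) c) `` {(p, ts[j := (cells bs, 0)])} \<subseteq> ?B"
    if "p \<le> ?n" "set_prog c \<subseteq> plain_ops \<union> {(0, 2, Move_Left)}"
      and "mid write_sem c `` {(cells bs, 0)} \<subseteq> shape (?m + 1)" for p bs c
  proof
    fix s assume "s \<in> mid (act_sem w) (bind (on_tape K j) c) `` {(p, ts[j := (cells bs, 0)])}"
    with on_tape_iff(2)[OF proper_update_cells[OF assms(1)] that(1) assms(2), where c = c]
      written_digits[OF that(2)]
    obtain t where "(ts[j := (cells bs, 0)] ! j, t) \<in> mid write_sem c" "s = (p, ts[j := (cells bs, 0), j := t])"
      by blast
    with that(3) j B[of t p] show "s \<in> ?B" by auto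
  qed
  \<comment> \<open>The configurations of the counting loop: \<open>S\<close> before a round,
    \<open>S'\<close> after the test for the right end has been passed, \<open>S''\<close> after the
    increment but before the input head moves.\<close>
  define S where "S = {(i, ts[j := (cells (bits i), 0)]) | i. i \<le> ?n}"
  define S' where "S' = {(i, ts[j := (cells (bits i), 0)]) | i. i \<le> length w}"
  define S'' where "S'' = {(i, ts[j := (cells (bits (Suc i)), 0)]) | i. i \<le> length w}"
  have SB: "S \<subseteq> ?B" "S'' \<subseteq> ?B"
    using B bits shape_mono[of ?m "?m + 1"] by (fastforce simp: S_def S''_def)+
  have flip: "mid (act_sem w) (bind (on_tape K j) flip_ext) `` {(i, ts[j := (cells (bits i), 0)])} \<subseteq> ?B"
    if "i \<le> length w" for i
    using that bits[of i] mid_flip_ext[of ?m] by (intro on_tape set_flip_ext) auto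
  have flip_sem: "sem (act_sem w) (bind (on_tape K j) flip_ext) `` S' \<subseteq> S''"
  proof
    fix s assume "s \<in> sem (act_sem w) (bind (on_tape K j) flip_ext) `` S'"
    then obtain i where i: "i \<le> length w"
      "((i, ts[j := (cells (bits i), 0)]), s) \<in> sem (act_sem w) (bind (on_tape K j) flip_ext)"
      by (auto simp: S'_def)
    with on_tape_iff(1)[OF proper_update_cells[OF assms(1)] _ assms(2), where c = flip_ext and w = w]
      written_digits[OF set_flip_ext] j
    show "s \<in> S''" by (auto simp: S''_def flip_ext_iff bits_simps)
  qed
  have flip_mid: "mid (act_sem w) (bind (on_tape K j) flip_ext) `` S' \<subseteq> ?B"
    using flip by (auto simp: S'_def)
  have ops: "mid (act_sem w) (head_op K d) `` R \<subseteq> ?B" "mid (act_sem w) (cell_op K A) `` R \<subseteq> ?B"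
    "mid (act_sem w) (home K) `` R \<subseteq> ?B" if "R \<subseteq> ?B" for R d A
    using that mid_head_op[of w K d "?m + 2"] mid_cell_op[of w K A "?m + 2"] mid_home[of w K "?m + 2"] by blast+
  have cell: "sem (act_sem w) (cell_op K (- {Right_End})) `` S \<subseteq> S'"
    by (auto simp: S_def S'_def cell_op_iff proper_update_cells[OF assms(1)] input_cell_iff)
  have "mid (act_sem w) (count_input K j) `` S \<subseteq> ?B"
    unfolding count_input_def
    by (rule mid_SeqI[OF ops(2)[OF SB(1)] cell mid_SeqI[OF flip_mid flip_sem ops(1)[OF SB(2)]]])
  moreover have count: "sem (act_sem w) (count_input K j) `` S \<subseteq> S"
    using count_input_iff[OF assms(1,2), where w = w] by (fastforce simp: S_def bits_simps)
  ultimately have star: "mid (act_sem w) (Star (count_input K j)) `` S \<subseteq> ?B" by (intro mid_StarI)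
  have star_sem: "sem (act_sem w) (Star (count_input K j)) `` S \<subseteq> S" using count by (simp add: Image_closed_trancl)
  let ?E = "{(?n, ts[j := (cells (bits ?n), 0)])}" and ?F = "{(0, ts[j := (cells (bits ?n), 0)])}"
  have E: "?E \<subseteq> ?B" "?F \<subseteq> ?B" using SB B[of "(cells (bits ?n), 0)"] bits[of ?n] shape_mono[of ?m "?m + 1"] by auto
  have start: "mid (act_sem w) (on_tape K j (0, 3, Stay)) `` {(0, ts)} \<subseteq> ?B"
    "sem (act_sem w) (on_tape K j (0, 3, Stay)) `` {(0, ts)} \<subseteq> S"
  proof -
    have *: "sem (act_sem w) (on_tape K j (0, 3, Stay)) `` {(0, ts)} = {(0, ts[j := (cells [], 0)])}"
      using start_iff[OF assms(1-3)] by auto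
    then show "sem (act_sem w) (on_tape K j (0, 3, Stay)) `` {(0, ts)} \<subseteq> S"
      unfolding S_def bits_simps(1)[symmetric] by blast
    with SB(1) assms(4) show "mid (act_sem w) (on_tape K j (0, 3, Stay)) `` {(0, ts)} \<subseteq> ?B"
      unfolding mid_ops(1) by auto
  qed
  have stop: "sem (act_sem w) (cell_op K {Right_End}) `` S \<subseteq> ?E"
  proof
    fix s assume "s \<in> sem (act_sem w) (cell_op K {Right_End}) `` S"
    then obtain i where i: "i \<le> ?n" "length w < i" "s = (i, ts[j := (cells (bits i), 0)])"
      by (auto simp: S_def cell_op_iff proper_update_cells[OF assms(1)] input_cell_iff)
    then have "i = ?n" by simp
    with i(3) show "s \<in> ?E" by simp
  qed
  have home: "sem (act_sem w) (home K) `` ?E \<subseteq> ?F"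
    by (auto simp: home_iff proper_update_cells[OF assms(1)])
  have "mid (act_sem w) (bind (on_tape K j) clear_tape) `` ?F \<subseteq> ?B"
  proof (rule on_tape)
    show "mid write_sem clear_tape `` {(cells (bits ?n), 0)} \<subseteq> shape (?m + 1)"
      using plain_invariant(2)[OF plain_programs(5), of ?m] bits[of ?n] shape_mono[of ?m "?m + 1"] by auto
  qed (use plain_programs(5) in auto)
  from mid_SeqI[OF ops(2)[OF SB(1)] stop mid_SeqI[OF ops(3)[OF E(1)] home this]]
  show ?thesis
    unfolding init_tape_def by (rule mid_SeqI[OF start mid_SeqI[OF star star_sem]])
qed

subsection \<open>Register programs\<close>

datatype 'a instr = Inc nat | Dec nat | Is_Zero nat | Is_Max nat | Head direction | Reads "'a cell"

type_synonym state = "nat \<times> (nat \<Rightarrow> nat)"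

fun instr_sem :: "'a list \<Rightarrow> 'a instr \<Rightarrow> state rel" where
  "instr_sem w (Inc j) = {((p, \<sigma>), (p, \<sigma>(j := Suc (\<sigma> j)))) | p \<sigma>. Suc (\<sigma> j) < cap (length w)}"
| "instr_sem w (Dec j) = {((p, \<sigma>), (p, \<sigma>(j := \<sigma> j - 1))) | p \<sigma>. \<sigma> j > 0}"
| "instr_sem w (Is_Zero j) = {((p, \<sigma>), (p, \<sigma>)) | p \<sigma>. \<sigma> j = 0}"
| "instr_sem w (Is_Max j) = {((p, \<sigma>), (p, \<sigma>)) | p \<sigma>. Suc (\<sigma> j) = cap (length w)}"
| "instr_sem w (Head d) = {((p, \<sigma>), (min (shift d p) (length w + 1), \<sigma>)) | p \<sigma>. True}"
| "instr_sem w (Reads a) = {((p, \<sigma>), (p, \<sigma>)) | p \<sigma>. input_cell w p = a}"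

fun instr_prog :: "nat \<Rightarrow> 'a instr \<Rightarrow> 'a act set prog" where
  "instr_prog K (Inc j) = bind (on_tape K j) (flip True)"
| "instr_prog K (Dec j) = bind (on_tape K j) (flip False)"
| "instr_prog K (Is_Zero j) = bind (on_tape K j) (all_bits False)"
| "instr_prog K (Is_Max j) = bind (on_tape K j) (all_bits True)"
| "instr_prog K (Head d) = head_op K d"
| "instr_prog K (Reads a) = cell_op K {a}"

fun reg_bound :: "'a instr \<Rightarrow> nat" where
  "reg_bound (Inc j) = Suc j"
| "reg_bound (Dec j) = Suc j"
| "reg_bound (Is_Zero j) = Suc j"
| "reg_bound (Is_Max j) = Suc j"
| "reg_bound _ = 0"

text \<open>Register \<open>j\<close> lives on tape \<open>j\<close>. All tapes have the same number
  of digits, so all registers have the range \<open>cap n\<close>, and the values \<open>0\<close>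
  and \<open>cap n - 1\<close> are recognised by uniform digits.\<close>

definition stored :: "nat \<Rightarrow> nat \<Rightarrow> (state \<times> tconf) set" where
  "stored K n = {((p, \<sigma>), (p, ts)) | p \<sigma> ts. p \<le> n + 1 \<and> length ts = K \<and>
     (\<forall>j<K. \<exists>bs. ts ! j = (cells bs, 0) \<and> length bs = width n \<and> val bs = \<sigma> j)}"

lemma storedD:
  assumes "((p, \<sigma>), (q, ts)) \<in> stored K n"
  shows "q = p" "p \<le> n + 1" "proper K ts"
    and "j < K \<Longrightarrow> \<exists>bs. ts ! j = (cells bs, 0) \<and> length bs = width n \<and> val bs = \<sigma> j"
  using assms by (auto simp: stored_def proper_def in_set_conv_nth cells_less) (metis cells_less fst_conv)

lemma stored_update:
  assumes "((p, \<sigma>), (p, ts)) \<in> stored K n" "length bs = width n" "val bs = v"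
  shows "((p, \<sigma>(j := v)), (p, ts[j := (cells bs, 0)])) \<in> stored K n"
  using assms by (auto simp: stored_def nth_list_update)

lemma bisim_instr:
  assumes "reg_bound i \<le> K"
  shows "bisim (stored K (length w)) (instr_sem w i) (sem (act_sem w) (instr_prog K i))"
proof -
  let ?S = "stored K (length w)"
  \<comment> \<open>\<open>Q u v\<close> says that the program may change the value of register
    \<open>j\<close> from \<open>u\<close> to \<open>v\<close>; tests are the case
    \<open>u = v\<close>. The last premise ensures that \<open>v\<close> fits on the tape.\<close>
  have tape: "bisim ?S R (sem (act_sem w) (bind (on_tape K j) c))"
    if "j < K" "set_prog c \<subseteq> plain_ops"
      and R: "\<And>p \<sigma> s. \<sigma> j < cap (length w) \<Longrightarrow>
        ((p, \<sigma>), s) \<in> R \<longleftrightarrow> (\<exists>v. s = (p, \<sigma>(j := v)) \<and> Q (\<sigma> j) v)"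
      and c: "\<And>bs t. length bs = width (length w) \<Longrightarrow> ((cells bs, 0), t) \<in> sem write_sem c \<longleftrightarrow>
        (\<exists>cs. length cs = length bs \<and> t = (cells cs, 0) \<and> Q (val bs) (val cs))"
      and Q: "\<And>u v. u < cap (length w) \<Longrightarrow> Q u v \<Longrightarrow> \<exists>cs. length cs = width (length w) \<and> val cs = v"
    for R j c Q
    unfolding bisim_def
  proof (intro allI impI conjI)
    fix s t s' assume "(s, t) \<in> ?S" "(s, s') \<in> R"
    obtain p \<sigma> q ts where st: "s = (p, \<sigma>)" "t = (q, ts)" by (cases s, cases t)
    note S = \<open>(s, t) \<in> ?S\<close>[unfolded st]
    note D = storedD[OF S]
    from D(4)[OF \<open>j < K\<close>] obtain bs where bs: "ts ! j = (cells bs, 0)" "length bs = width (length w)" "val bs = \<sigma> j"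
      by blast
    then have cap: "\<sigma> j < cap (length w)" using val_less[of bs] by (simp add: cap_def)
    with R[of \<sigma> p s'] \<open>(s, s') \<in> R\<close> st obtain v where v: "s' = (p, \<sigma>(j := v))" "Q (\<sigma> j) v" by auto
    with Q[OF cap] obtain cs where cs: "length cs = width (length w)" "val cs = v" by blast
    with c[OF bs(2)] bs v have "(ts ! j, (cells cs, 0)) \<in> sem write_sem c" by auto
    with on_tape_iff(1)[OF D(3,2) \<open>j < K\<close>, of c] written_digits[of c] \<open>set_prog c \<subseteq> plain_ops\<close> D(1) st
    have "(t, (p, ts[j := (cells cs, 0)])) \<in> sem (act_sem w) (bind (on_tape K j) c)" by blast
    moreover have "(s', (p, ts[j := (cells cs, 0)])) \<in> ?S"
      using stored_update[of p \<sigma> ts K "length w" cs v j] S D(1) cs v by simp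
    ultimately show "\<exists>t'. (t, t') \<in> sem (act_sem w) (bind (on_tape K j) c) \<and> (s', t') \<in> ?S" by blast
  next
    fix s t t' assume "(s, t) \<in> ?S" "(t, t') \<in> sem (act_sem w) (bind (on_tape K j) c)"
    obtain p \<sigma> q ts where st: "s = (p, \<sigma>)" "t = (q, ts)" by (cases s, cases t)
    note S = \<open>(s, t) \<in> ?S\<close>[unfolded st]
    note D = storedD[OF S]
    from D(4)[OF \<open>j < K\<close>] obtain bs where bs: "ts ! j = (cells bs, 0)" "length bs = width (length w)" "val bs = \<sigma> j"
      by blast
    then have cap: "\<sigma> j < cap (length w)" using val_less[of bs] by (simp add: cap_def)
    from on_tape_iff(1)[OF D(3,2) \<open>j < K\<close>, of c] written_digits[of c] \<open>set_prog c \<subseteq> plain_ops\<close> D(1) st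
      \<open>(t, t') \<in> _\<close>
    obtain u where u: "(ts ! j, u) \<in> sem write_sem c" "t' = (p, ts[j := u])" by blast
    with c[OF bs(2)] bs obtain cs where cs: "length cs = length bs" "u = (cells cs, 0)" "Q (\<sigma> j) (val cs)" by auto
    then have "(s, (p, \<sigma>(j := val cs))) \<in> R" using R[of \<sigma> p, OF cap] st by auto
    moreover have "((p, \<sigma>(j := val cs)), t') \<in> ?S"
      using stored_update[of p \<sigma> ts K "length w" cs "val cs" j] S D(1) cs u bs(2) by simp
    ultimately show "\<exists>s'. (s, s') \<in> R \<and> (s', t') \<in> ?S" by blast
  qed
  have ex: "\<exists>cs. length cs = width (length w) \<and> val cs = v" if "v < cap (length w)" for v
  proof -
    have "\<exists>cs. length cs = m \<and> val cs = v" if "v < 2 ^ m" for m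
      using that
    proof (induction m arbitrary: v)
      case (Suc m)
      then have "v div 2 < 2 ^ m" by simp
      from Suc.IH[OF this] obtain cs where "length cs = m" "val cs = v div 2" by blast
      then show ?case by (intro exI[of _ "odd v # cs"]) auto
    qed auto
    with that show ?thesis by (simp add: cap_def)
  qed
  have same: "((cells bs, 0), t) \<in> sem write_sem (all_bits b) \<longleftrightarrow>
      (\<exists>cs. length cs = length bs \<and> t = (cells cs, 0) \<and> (\<forall>c\<in>set bs. c = b) \<and> val bs = val cs)" for bs t b
    unfolding all_bits_iff using val_inject[of _ bs] by metis
  have plain: "bisim ?S R (sem (act_sem w) c)"
    if R: "\<And>p \<sigma> s. p \<le> length w + 1 \<Longrightarrow> ((p, \<sigma>), s) \<in> R \<longleftrightarrow> Q p \<and> s = (f p, \<sigma>)"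
      and c: "\<And>p ts s. p \<le> length w + 1 \<Longrightarrow> proper K ts \<Longrightarrow>
        ((p, ts), s) \<in> sem (act_sem w) c \<longleftrightarrow> Q p \<and> s = (f p, ts)"
      and f: "\<And>p. p \<le> length w + 1 \<Longrightarrow> f p \<le> length w + 1" for R c Q f
    unfolding bisim_def
  proof (intro allI impI)
    fix s t assume "(s, t) \<in> ?S"
    obtain p \<sigma> q ts where st: "s = (p, \<sigma>)" "t = (q, ts)" by (cases s, cases t)
    note S = \<open>(s, t) \<in> ?S\<close>[unfolded st]
    note D = storedD[OF S]
    have "((f p, \<sigma>), (f p, ts)) \<in> ?S" using S f D(2) by (auto simp: stored_def)
    then show "(\<forall>s'. (s, s') \<in> R \<longrightarrow> (\<exists>t'. (t, t') \<in> sem (act_sem w) c \<and> (s', t') \<in> ?S)) \<and>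
        (\<forall>t'. (t, t') \<in> sem (act_sem w) c \<longrightarrow> (\<exists>s'. (s, s') \<in> R \<and> (s', t') \<in> ?S))"
      unfolding st D(1) R[OF D(2)] c[OF D(2,3)] by blast
  qed
  show ?thesis
  proof (cases i)
    case (Inc j)
    show ?thesis unfolding Inc instr_prog.simps
      using assms Inc by (intro tape[where Q = "\<lambda>u v. v = Suc u \<and> v < cap (length w)"])
        (auto simp: plain_programs flip_iff cap_def ex[unfolded cap_def] dest: sym intro: val_less, (metis val_less)+)
  next
    case (Dec j)
    show ?thesis unfolding Dec instr_prog.simps
      using assms Dec by (intro tape[where Q = "\<lambda>u v. u = Suc v"]) (auto simp: plain_programs flip_iff ex)
  next
    case (Is_Zero j)
    show ?thesis unfolding Is_Zero instr_prog.simps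
      using assms Is_Zero by (intro tape[where Q = "\<lambda>u v. u = 0 \<and> u = v"])
        (auto simp: plain_programs same all_False_iff[symmetric] ex)
  next
    case (Is_Max j)
    show ?thesis unfolding Is_Max instr_prog.simps
      using assms Is_Max by (intro tape[where Q = "\<lambda>u v. Suc u = cap (length w) \<and> u = v"])
        (auto simp: plain_programs same all_True_iff cap_def ex)
  next
    case (Head d)
    show ?thesis unfolding Head instr_prog.simps
      by (rule plain[where Q = "\<lambda>_. True" and f = "\<lambda>p. min (shift d p) (length w + 1)"]) (auto simp: head_op_iff)
  next
    case (Reads a)
    show ?thesis unfolding Reads instr_prog.simps
      by (rule plain[where Q = "\<lambda>p. input_cell w p = a" and f = "\<lambda>p. p"]) (auto simp: cell_op_iff)
  qed
qed

lemma UNIV_cell: "UNIV = {Left_End, Right_End} \<union> range Input"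
proof -
  have "a \<in> {Left_End, Right_End} \<union> range Input" for a :: "'a cell" by (cases a) auto
  then show ?thesis by auto
qed

lemma finite_cells: "finite (A :: 'a::finite cell set)"
proof (rule finite_subset[OF subset_UNIV])
  show "finite (UNIV :: 'a cell set)" unfolding UNIV_cell by simp
qed

lemma wf_actI:
  fixes A :: "'a::finite act set"
  assumes "A \<subseteq> {(a, bs, d, f bs) | a bs. bs \<in> symbols K}" "\<And>bs. length (f bs) = length bs"
  shows "wf_act K A"
proof -
  have "A \<subseteq> (\<lambda>(a, bs). (a, bs, d, f bs)) ` (UNIV \<times> symbols K)"
  proof
    fix x assume "x \<in> A"
    with assms(1) obtain a bs where "x = (a, bs, d, f bs)" "bs \<in> symbols K" by blast
    then show "x \<in> (\<lambda>(a, bs). (a, bs, d, f bs)) ` (UNIV \<times> symbols K)"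
      by (intro image_eqI[of _ _ "(a, bs)"]) auto
  qed
  moreover have "finite ((\<lambda>(a, bs). (a, bs, d, f bs)) ` (UNIV \<times> symbols K) :: 'a act set)"
    using finite_cells finite_symbols by blast
  ultimately have "finite A" by (rule finite_subset)
  with assms show ?thesis by (auto simp: wf_act_def symbols_def)
qed

lemma on_tape_act: "A \<in> set_prog (on_tape K j op) \<Longrightarrow> act_sem w A = sem (act_sem w) (on_tape K j op)"
  by (cases op) auto

lemma wf_on_tape: "A \<in> set_prog (on_tape K j op :: 'a::finite act set prog) \<Longrightarrow> wf_act K A"
proof (cases op)
  case (fields b b' d)
  assume "A \<in> set_prog (on_tape K j op)"
  with fields show ?thesis
    by (intro wf_actI[where f = "\<lambda>bs. (idle bs)[j := (b', d)]" and d = Stay]) (auto simp: idle_def)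
qed

declare on_tape.simps [simp del]

lemma wf_head_op: "A \<in> set_prog (head_op K d :: 'a::finite act set prog) \<Longrightarrow> wf_act K A"
  by (auto intro!: wf_actI[where f = idle and d = d] simp: idle_def head_op_def)

lemma wf_cell_op: "A \<in> set_prog (cell_op K C :: 'a::finite act set prog) \<Longrightarrow> wf_act K A"
  by (auto intro!: wf_actI[where f = idle and d = Stay] simp: idle_def cell_op_def)

lemma wf_init_tape: "A \<in> set_prog (init_tape K j :: 'a::finite act set prog) \<Longrightarrow> wf_act K A"
  using wf_on_tape wf_head_op wf_cell_op
  by (auto simp: init_tape_def count_input_def home_def set_prog_bind)

lemma wf_instr_prog: "A \<in> set_prog (instr_prog K i :: 'a::finite act set prog) \<Longrightarrow> wf_act K A"
  using wf_on_tape wf_head_op wf_cell_op by (cases i) (auto simp: set_prog_bind)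

text \<open>All tape operations of register programs lie in \<open>plain_ops\<close>, so no tape
  grows any more. The statement concerns single actions because \<open>mid_invariant\<close> asks
  for them.\<close>

lemma instr_prog_invariant:
  fixes w :: "'a list" and m :: nat
  assumes "reg_bound i \<le> K" "A \<in> set_prog (instr_prog K i)"
  defines "S \<equiv> {(p, ts). p \<le> length w + 1 \<and> length ts = K \<and> set ts \<subseteq> shape m}"
  shows "act_sem w A `` S \<subseteq> S"
proof -
  have proper: "proper K ts" if "(p, ts) \<in> S" for p ts
    using that by (fastforce simp: S_def proper_def shape_def cells_less)
  have tape: "act_sem w A `` S \<subseteq> S"
    if j: "j < K" and c: "set_prog c \<subseteq> plain_ops" and A: "A \<in> set_prog (bind (on_tape K j) c)" for j c
  proof -
    from A obtain op where op: "op \<in> plain_ops" "A \<in> set_prog (on_tape K j op)" using c by (auto simp: set_prog_bind)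
    note A = on_tape_act[OF op(2)]
    show ?thesis
    proof
      fix s' assume "s' \<in> act_sem w A `` S"
      then obtain p ts where s: "(p, ts) \<in> S" "((p, ts), s') \<in> sem (act_sem w) (on_tape K j op)"
        unfolding A by auto
      then obtain t where t: "(ts ! j, t) \<in> write_sem op" "s' = (p, ts[j := t])"
        using on_tape_op_iff[OF proper[OF s(1)] _ j, of p w s' op] by (auto simp: S_def)
      moreover have "ts ! j \<in> shape m" using s(1) j by (auto simp: S_def)
      ultimately have "t \<in> shape m" using plain_shape[OF op(1), of m] by blast
      with s(1) t(2) show "s' \<in> S" using set_update_subset_insert[of ts j t] by (auto simp: S_def)
    qed
  qed
  have head: "act_sem w A `` S \<subseteq> S" if "A \<in> set_prog (head_op K d)" for d
  proof -
    from that have A: "act_sem w A = sem (act_sem w) (head_op K d)" by (auto simp: head_op_def)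
    show ?thesis unfolding A using proper by (auto simp: S_def head_op_iff)
  qed
  have cell: "act_sem w A `` S \<subseteq> S" if "A \<in> set_prog (cell_op K C)" for C
  proof -
    from that have A: "act_sem w A = sem (act_sem w) (cell_op K C)" by (auto simp: cell_op_def)
    show ?thesis unfolding A using proper by (auto simp: S_def cell_op_iff)
  qed
  show ?thesis
    using assms(1,2) tape[OF _ plain_programs(3)] tape[OF _ plain_programs(4)] head cell
    by (cases i) (simp_all add: Suc_le_eq)
qed

text \<open>The tapes are prepared one by one and then the register program runs on them. Acceptance
  is transferred by \<open>bisim\<close>, the space bound by \<open>mid\<close>.\<close>

theorem language_in_NL:
  fixes c :: "'a::finite instr prog"
  shows "{w. \<exists>s. ((0, \<lambda>_. 0), s) \<in> sem (instr_sem w) c} \<in> NL"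
proof -
  have "finite (set_prog c)" by (induction c) auto
  then obtain K where K: "\<And>i. i \<in> set_prog c \<Longrightarrow> reg_bound i \<le> K"
    using finite_imageI[of "set_prog c" reg_bound] by (metis finite_nat_set_iff_bounded_le imageI)
  define Q where "Q = bind (instr_prog K) c"
  \<comment> \<open>\<open>P k\<close> expects the first \<open>k\<close> tapes to be prepared, as
    described by \<open>ts n k\<close>; the inductions below therefore descend from
    \<open>K\<close>.\<close>
  define P where "P k = foldr (\<lambda>j. Seq (init_tape K j)) [k..<K] Q" for k
  define ts where "ts n k = map (\<lambda>i. if i < k then zero_tape n else tape0) [0..<K]" for n k
  have P_simps: "P K = Q" "k < K \<Longrightarrow> P k = Seq (init_tape K k) (P (Suc k))" for k
    by (simp_all add: P_def upt_conv_Cons)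
  have proper: "proper K (ts n k)" for n k
    by (auto simp: ts_def proper_def zero_tape_def tape0_def cells_less)
  have ts_Suc: "(ts n k)[k := zero_tape n] = ts n (Suc k)" if "k < K" for n k
    using that by (auto simp: ts_def list_eq_iff_nth_eq nth_list_update)
  have ts_nth: "ts n k ! k = tape0" if "k < K" for n k
    using that by (simp add: ts_def)
  have ts_bound: "(0, ts n k) \<in> head_bound b" for n k b
    by (auto simp: ts_def head_bound_def zero_tape_def tape0_def)
  have sem_P: "((0, ts (length w) k), s) \<in> sem (act_sem w) (P k) \<longleftrightarrow>
      ((0, ts (length w) K), s) \<in> sem (act_sem w) Q" if "k \<le> K" for w k s
    using that
  proof (induction rule: inc_induct)
    case (step k)
    then show ?case
      by (simp add: P_simps sem_Seq_iff init_tape_iff[OF proper _ ts_nth] ts_Suc del: sem.simps(2))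
  qed (simp add: P_simps)
  have mid_Q: "mid (act_sem w) Q `` {(0, ts (length w) K)} \<subseteq> head_bound (width (length w) + 2)" for w
  proof -
    define S :: "tconf set" where
      "S = {(p, ts). p \<le> length w + 1 \<and> length ts = K \<and> set ts \<subseteq> shape (width (length w))}"
    have "act_sem w A `` S \<subseteq> S" if A: "A \<in> set_prog Q" for A
    proof -
      from A obtain i where "i \<in> set_prog c" "A \<in> set_prog (instr_prog K i)"
        by (auto simp: Q_def set_prog_bind)
      with K instr_prog_invariant[of i K A w "width (length w)"] show ?thesis by (simp add: S_def)
    qed
    from mid_invariant[OF this] have 1: "mid (act_sem w) Q `` S \<subseteq> S" .
    have "{(0, ts (length w) K)} \<subseteq> S"
      by (force simp: S_def ts_def zero_tape_def shape_def)
    with 1 have 2: "mid (act_sem w) Q `` {(0, ts (length w) K)} \<subseteq> S"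
      by (meson Image_mono order_refl order_trans)
    have 3: "S \<subseteq> head_bound (width (length w) + 2)"
      using shape_bound[of _ "width (length w)"] by (fastforce simp: S_def head_bound_def)
    from 2 3 show ?thesis by (rule order_trans)
  qed
  have mid_P: "mid (act_sem w) (P k) `` {(0, ts (length w) k)} \<subseteq> head_bound (width (length w) + 2)"
    if "k \<le> K" for w k
    using that
  proof (induction rule: inc_induct)
    case base
    show ?case using mid_Q by (simp add: P_simps)
  next
    case (step k)
    have "sem (act_sem w) (init_tape K k) `` {(0, ts (length w) k)} \<subseteq> {(0, ts (length w) (Suc k))}"
      using step by (auto simp: init_tape_iff[OF proper _ ts_nth] ts_Suc)
    from mid_SeqI[OF init_tape_mid[OF proper _ ts_nth ts_bound] this] step
    show ?case by (simp add: P_simps)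
  qed
  have wf: "wf_act K A" if "A \<in> set_prog (P k)" "k \<le> K" for A k
    using that(2,1)
  proof (induction rule: inc_induct)
    case base
    then show ?case using wf_instr_prog by (auto simp: P_simps Q_def set_prog_bind)
  next
    case (step k)
    then show ?case using wf_init_tape by (auto simp: P_simps)
  qed
  have start: "(0, replicate K tape0) = (0::nat, ts n 0)" for n
    by (simp add: ts_def map_replicate_const)
  have "wf_act K A" if "A \<in> set_prog (P 0)" for A using wf[OF that] by simp
  from compile[of "P 0" K, OF this] obtain M where M: "wf_ntm M"
    "\<And>w. accepts M w \<longleftrightarrow> (\<exists>t. ((0, replicate K tape0), t) \<in> sem (act_sem w) (P 0))"
    "\<And>w q p ts. (step M w)\<^sup>*\<^sup>* (initial M) (q, p, ts) \<Longrightarrow>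
       ((0, replicate K tape0), (p, ts)) \<in> mid (act_sem w) (P 0)"
    by blast
  have "accepts M w \<longleftrightarrow> (\<exists>s. ((0, \<lambda>_. 0), s) \<in> sem (instr_sem w) c)" for w
  proof -
    have "bisim (stored K (length w)) (sem (instr_sem w) c) (sem (act_sem w) Q)"
      unfolding Q_def using K by (intro bisim_bind bisim_instr)
    moreover have "((0, \<lambda>_. 0), (0, ts (length w) K)) \<in> stored K (length w)"
      by (auto simp: stored_def ts_def zero_tape_def val_replicate)
    ultimately have "(\<exists>s. ((0, \<lambda>_. 0), s) \<in> sem (instr_sem w) c) \<longleftrightarrow>
        (\<exists>t. ((0, ts (length w) K), t) \<in> sem (act_sem w) Q)"
      unfolding bisim_def by blast
    with M(2)[of w] sem_P[of 0 w] show ?thesis unfolding start[of "length w"] by simp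
  qed
  \<comment> \<open>The heads stay at positions up to \<open>width n + 2\<close>, and the inequality
    in \<open>space_bounded\<close> is strict.\<close>
  moreover have "space_bounded M (\<lambda>n. width n + 3)"
    unfolding space_bounded_def
  proof (intro allI impI, clarify)
    fix w q p us f h assume run: "(step M w)\<^sup>*\<^sup>* (initial M) (q, p, us)" "(f, h) \<in> set us"
    from M(3)[OF run(1)] mid_P[of 0 w] have "(p, us) \<in> head_bound (width (length w) + 2)"
      unfolding start[of "length w"] by auto
    with run(2) show "h < width (length w) + 3" by (fastforce simp: head_bound_def)
  qed
  moreover have "(\<lambda>n. real (width n + 3)) \<in> O(\<lambda>n. ln (real n))"
  proof -
    have "(\<lambda>n. real (width n + 3)) \<in> O(\<lambda>n. 4 + log 2 (real n + 1))"
    proof (intro bigoI[of _ 1] always_eventually allI)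
      fix n :: nat
      show "norm (real (width n + 3)) \<le> 1 * norm (4 + log 2 (real n + 1))"
        using width_le[of n] by simp
    qed
    also have "(\<lambda>n. 4 + log 2 (real n + 1)) \<in> O(\<lambda>n. ln (real n))" by real_asymp
    finally show ?thesis .
  qed
  ultimately show ?thesis using M(1) unfolding NL_def by blast
qed

section \<open>Predicates testable in nondeterministic logarithmic space\<close>

text \<open>
  A test with \<open>k\<close> variables finds them in the registers below \<open>k\<close> and may use all other
  registers, which are zero before and after the test.
\<close>

definition clean :: "nat \<Rightarrow> nat \<Rightarrow> (nat \<Rightarrow> nat) \<Rightarrow> bool" where
  "clean n k \<sigma> \<longleftrightarrow> (\<forall>j. \<sigma> j < cap n) \<and> (\<forall>j\<ge>k. \<sigma> j = 0)"

text \<open>Truth is reported by the mere existence of a run. Every finished run restores the head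
  and all registers, so tests can be chained and repeated.\<close>

definition tests :: "nat \<Rightarrow> 'a instr prog \<Rightarrow> ('a list \<Rightarrow> (nat \<Rightarrow> nat) \<Rightarrow> bool) \<Rightarrow> bool" where
  "tests k c T \<longleftrightarrow> (\<forall>w \<sigma> s. clean (length w) k \<sigma> \<longrightarrow>
     (((0, \<sigma>), s) \<in> sem (instr_sem w) c \<longleftrightarrow> s = (0, \<sigma>) \<and> T w \<sigma>))"

definition test :: "nat \<Rightarrow> ('a list \<Rightarrow> (nat \<Rightarrow> nat) \<Rightarrow> bool) \<Rightarrow> bool" where
  "test k T \<longleftrightarrow> (\<exists>c. tests k c T)"

lemma tests_iff:
  "tests k c T \<Longrightarrow> clean (length w) k \<sigma> \<Longrightarrow>
    ((0, \<sigma>), s) \<in> sem (instr_sem w) c \<longleftrightarrow> s = (0, \<sigma>) \<and> T w \<sigma>"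
  unfolding tests_def by blast

lemma test_NL: "test 0 T \<Longrightarrow> {w :: 'a::finite list. T w (\<lambda>_. 0)} \<in> NL"
proof -
  assume "test 0 T"
  then obtain c where c: "tests 0 c T" unfolding test_def by blast
  have "clean (length w) 0 (\<lambda>_. 0)" for w :: "'a list"
    using cap_gt[of "length w"] by (auto simp: clean_def)
  from tests_iff[OF c this] have "{w. \<exists>s. ((0, \<lambda>_. 0), s) \<in> sem (instr_sem w) c} = {w. T w (\<lambda>_. 0)}"
    by blast
  with language_in_NL[of c] show ?thesis by simp
qed

lemma clean_update: "clean n k \<sigma> \<Longrightarrow> x < cap n \<Longrightarrow> j < k' \<Longrightarrow> k \<le> k' \<Longrightarrow> clean n k' (\<sigma>(j := x))"
  by (auto simp: clean_def)

lemma cleanD: "clean n k \<sigma> \<Longrightarrow> \<sigma> j < cap n" "clean n k \<sigma> \<Longrightarrow> k \<le> j \<Longrightarrow> \<sigma> j = 0"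
  by (auto simp: clean_def)

lemma instr_sem_iff:
  "((p, \<sigma>), s) \<in> instr_sem w (Inc j) \<longleftrightarrow> Suc (\<sigma> j) < cap (length w) \<and> s = (p, \<sigma>(j := Suc (\<sigma> j)))"
  "((p, \<sigma>), s) \<in> instr_sem w (Dec j) \<longleftrightarrow> \<sigma> j > 0 \<and> s = (p, \<sigma>(j := \<sigma> j - 1))"
  "((p, \<sigma>), s) \<in> instr_sem w (Is_Zero j) \<longleftrightarrow> \<sigma> j = 0 \<and> s = (p, \<sigma>)"
  "((p, \<sigma>), s) \<in> instr_sem w (Is_Max j) \<longleftrightarrow> Suc (\<sigma> j) = cap (length w) \<and> s = (p, \<sigma>)"
  "((p, \<sigma>), s) \<in> instr_sem w (Head d) \<longleftrightarrow> s = (min (shift d p) (length w + 1), \<sigma>)"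
  "((p, \<sigma>), s) \<in> instr_sem w (Reads a) \<longleftrightarrow> input_cell w p = a \<and> s = (p, \<sigma>)"
  by auto

declare instr_sem.simps [simp del]

section \<open>Elementary register programs\<close>

definition clear :: "nat \<Rightarrow> 'a instr prog" where
  "clear j = Seq (Star (Atom (Dec j))) (Atom (Is_Zero j))"

definition guess :: "nat \<Rightarrow> 'a instr prog" where
  "guess j = Star (Atom (Inc j))"

definition move :: "nat \<Rightarrow> nat \<Rightarrow> 'a instr prog" where
  "move i j = Seq (Star (Seq (Atom (Dec i)) (Atom (Inc j)))) (Atom (Is_Zero i))"

lemma clear_iff: "((p, \<sigma>), s) \<in> sem (instr_sem w) (clear j) \<longleftrightarrow> s = (p, \<sigma>(j := 0))"
proof -
  let ?g = "\<lambda>i. (p, \<sigma>(j := \<sigma> j - i))"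
  have "(?g i, t) \<in> sem (instr_sem w) (Atom (Dec j)) \<longleftrightarrow> i < \<sigma> j \<and> t = ?g (Suc i)" for i t
    by (auto simp: instr_sem_iff)
  from rtrancl_chain_iff[of ?g, OF this]
  have "((p, \<sigma>), s) \<in> sem (instr_sem w) (clear j) \<longleftrightarrow> (\<exists>i\<le>\<sigma> j. (?g i, s) \<in> instr_sem w (Is_Zero j))"
    by (auto simp: clear_def all_less_iff)
  also have "\<dots> \<longleftrightarrow> s = (p, \<sigma>(j := 0))" by (auto simp: instr_sem_iff)
  finally show ?thesis .
qed

lemma guess_iff:
  assumes "\<sigma> j = 0"
  shows "((p, \<sigma>), s) \<in> sem (instr_sem w) (guess j) \<longleftrightarrow> (\<exists>x<cap (length w). s = (p, \<sigma>(j := x)))"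
proof -
  let ?g = "\<lambda>i. (p, \<sigma>(j := i))"
  have "(?g i, t) \<in> sem (instr_sem w) (Atom (Inc j)) \<longleftrightarrow> Suc i < cap (length w) \<and> t = ?g (Suc i)" for i t
    by (auto simp: instr_sem_iff)
  from rtrancl_chain_iff[of ?g, OF this]
  have "(?g 0, s) \<in> sem (instr_sem w) (guess j) \<longleftrightarrow> (\<exists>i. s = ?g i \<and> (\<forall>j<i. Suc j < cap (length w)))"
    by (simp add: guess_def)
  moreover have "(\<forall>j<i. Suc j < N) \<longleftrightarrow> i < N" if "0 < N" for i N :: nat
    using that by (cases i) auto
  moreover have "?g 0 = (p, \<sigma>)" using assms by (simp add: fun_upd_idem)
  ultimately show ?thesis using cap_gt[of "length w"] by auto
qed

lemma move_iff:
  assumes "\<sigma> j = 0" "\<sigma> i < cap (length w)" "i \<noteq> j"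
  shows "((p, \<sigma>), s) \<in> sem (instr_sem w) (move i j) \<longleftrightarrow> s = (p, \<sigma>(i := 0, j := \<sigma> i))"
proof -
  let ?g = "\<lambda>x. (p, \<sigma>(i := \<sigma> i - x, j := x))"
  have "(?g x, t) \<in> sem (instr_sem w) (Seq (Atom (Dec i)) (Atom (Inc j))) \<longleftrightarrow> x < \<sigma> i \<and> t = ?g (Suc x)" for x t
    using assms by (auto simp: sem_Seq_iff instr_sem_iff fun_upd_twist simp del: sem.simps(2))
  from rtrancl_chain_iff[of ?g, OF this]
  have "(?g 0, t) \<in> (sem (instr_sem w) (Seq (Atom (Dec i)) (Atom (Inc j))))\<^sup>* \<longleftrightarrow> (\<exists>x\<le>\<sigma> i. t = ?g x)" for t
    by (auto simp: all_less_iff)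
  moreover have "?g 0 = (p, \<sigma>)" using assms by (auto simp: fun_eq_iff)
  ultimately have "((p, \<sigma>), s) \<in> sem (instr_sem w) (move i j) \<longleftrightarrow>
      (\<exists>x\<le>\<sigma> i. (?g x, s) \<in> instr_sem w (Is_Zero i))"
    unfolding move_def sem_Seq_iff sem.simps(1,4) by auto
  also have "\<dots> \<longleftrightarrow> s = (p, \<sigma>(i := 0, j := \<sigma> i))"
    using assms(3) by (auto simp: instr_sem_iff)
  finally show ?thesis .
qed

section \<open>Closure of the tests under logical operations\<close>

lemma test_cong: "test k T \<Longrightarrow> (\<And>w \<sigma>. clean (length w) k \<sigma> \<Longrightarrow> T w \<sigma> \<longleftrightarrow> T' w \<sigma>) \<Longrightarrow> test k T'"
proof -
  assume "test k T" and T': "\<And>w \<sigma>. clean (length w) k \<sigma> \<Longrightarrow> T w \<sigma> \<longleftrightarrow> T' w \<sigma>"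
  then obtain c where "tests k c T" unfolding test_def by blast
  then have "tests k c T'" unfolding tests_def using T' by blast
  then show ?thesis unfolding test_def by blast
qed

lemma test_conj: "test k S \<Longrightarrow> test k T \<Longrightarrow> test k (\<lambda>w \<sigma>. S w \<sigma> \<and> T w \<sigma>)"
proof -
  assume "test k S" "test k T"
  then obtain c d where "tests k c S" "tests k d T" unfolding test_def by blast
  then have "tests k (Seq c d) (\<lambda>w \<sigma>. S w \<sigma> \<and> T w \<sigma>)"
    unfolding tests_def sem_Seq_iff by auto
  then show ?thesis unfolding test_def by blast
qed

lemma test_disj: "test k S \<Longrightarrow> test k T \<Longrightarrow> test k (\<lambda>w \<sigma>. S w \<sigma> \<or> T w \<sigma>)"
proof -
  assume "test k S" "test k T"
  then obtain c d where "tests k c S" "tests k d T" unfolding test_def by blast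
  then have "tests k (Choice c d) (\<lambda>w \<sigma>. S w \<sigma> \<or> T w \<sigma>)"
    unfolding tests_def by auto
  then show ?thesis unfolding test_def by blast
qed

lemma test_const: "test k (\<lambda>w \<sigma>. b)"
proof -
  have "tests k (if b then Atom (Is_Zero k) else Atom (Dec k)) (\<lambda>w \<sigma>. b)"
    by (auto simp: tests_def instr_sem_iff cleanD)
  then show ?thesis unfolding test_def by blast
qed

lemma test_zero: "i < k \<Longrightarrow> test k (\<lambda>w \<sigma>. \<sigma> i = 0)"
  unfolding test_def tests_def by (rule exI[of _ "Atom (Is_Zero i)"]) (auto simp: instr_sem_iff)

lemma test_max: "i < k \<Longrightarrow> test k (\<lambda>w \<sigma>. Suc (\<sigma> i) = cap (length w))"
  unfolding test_def tests_def by (rule exI[of _ "Atom (Is_Max i)"]) (auto simp: instr_sem_iff)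

lemma test_ex:
  assumes "test (Suc k) T" "\<And>w \<sigma> x. T w (\<sigma>(k := x)) \<longleftrightarrow> P w \<sigma> x"
  shows "test k (\<lambda>w \<sigma>. \<exists>x<cap (length w). P w \<sigma> x)"
proof -
  from assms(1) obtain c where c: "tests (Suc k) c T" unfolding test_def by blast
  have "((0, \<sigma>), s) \<in> sem (instr_sem w) (Seq (guess k) (Seq c (clear k))) \<longleftrightarrow>
      s = (0, \<sigma>) \<and> (\<exists>x<cap (length w). P w \<sigma> x)" if "clean (length w) k \<sigma>" for w \<sigma> s
  proof -
    have \<sigma>: "\<sigma> k = 0" "\<sigma>(k := 0) = \<sigma>" using cleanD(2)[OF that, of k] by auto
    have "((0, \<sigma>(k := x)), s) \<in> sem (instr_sem w) (Seq c (clear k)) \<longleftrightarrow> P w \<sigma> x \<and> s = (0, \<sigma>)"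
      if "x < cap (length w)" for x
      using tests_iff[OF c clean_update[OF \<open>clean _ _ _\<close> that, of k "Suc k"]] \<sigma>
      by (simp add: sem_Seq_iff clear_iff assms(2) del: sem.simps(2))
    then show ?thesis
      unfolding sem_Seq_iff[of _ _ _ "guess k"] guess_iff[of \<sigma> k, OF \<sigma>(1)] by blast
  qed
  then show ?thesis unfolding test_def tests_def by blast
qed

text \<open>A universal quantifier costs no negation: register \<open>k\<close> runs through its
  values in order, and each value has to pass its own test before the next increment. As
  \<open>Inc\<close> fails at the top value, the test for that value stands behind the loop.\<close>

lemma test_all:
  assumes "test (Suc k) T" "\<And>w \<sigma> x. T w (\<sigma>(k := x)) \<longleftrightarrow> P w \<sigma> x"
  shows "test k (\<lambda>w \<sigma>. \<forall>x<cap (length w). P w \<sigma> x)"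
proof -
  from assms(1) obtain c where c: "tests (Suc k) c T" unfolding test_def by blast
  let ?d = "Seq (Star (Seq c (Atom (Inc k)))) (Seq c (Seq (Atom (Is_Max k)) (clear k)))"
  have "((0, \<sigma>), s) \<in> sem (instr_sem w) ?d \<longleftrightarrow>
      s = (0, \<sigma>) \<and> (\<forall>x<cap (length w). P w \<sigma> x)" if "clean (length w) k \<sigma>" for w \<sigma> s
  proof -
    define m where "m = cap (length w) - 1"
    have m: "cap (length w) = Suc m" using cap_gt[of "length w"] by (simp add: m_def)
    \<comment> \<open>\<open>rtrancl_chain_iff\<close> wants a state for every \<open>x\<close>; the
      minimum keeps it constant from \<open>m\<close> on, where \<open>Inc\<close> fails.\<close>
    let ?g = "\<lambda>x. (0, \<sigma>(k := min x m))"
    have clean: "clean (length w) (Suc k) (\<sigma>(k := x))" if "x \<le> m" for x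
      using clean_update[OF \<open>clean _ _ _\<close>, of x k "Suc k"] that m by simp
    have \<sigma>: "\<sigma>(k := 0) = \<sigma>" using cleanD(2)[OF that, of k] by auto
    have "(?g x, t) \<in> sem (instr_sem w) (Seq c (Atom (Inc k))) \<longleftrightarrow> (P w \<sigma> x \<and> x < m) \<and> t = ?g (Suc x)" for x t
      using tests_iff[OF c clean[of "min x m"]] m
      by (auto simp: sem_Seq_iff instr_sem_iff assms(2) min_def simp del: sem.simps(2))
    from rtrancl_chain_iff[of ?g, OF this]
    have "(?g 0, t) \<in> (sem (instr_sem w) (Seq c (Atom (Inc k))))\<^sup>* \<longleftrightarrow>
        (\<exists>x. t = ?g x \<and> (\<forall>y<x. P w \<sigma> y \<and> y < m))" for t .
    moreover have "?g 0 = (0, \<sigma>)" using \<sigma> by simp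
    ultimately have "((0, \<sigma>), s) \<in> sem (instr_sem w) ?d \<longleftrightarrow>
      (\<exists>x. (\<forall>y<x. P w \<sigma> y \<and> y < m) \<and> (?g x, s) \<in> sem (instr_sem w) (Seq c (Seq (Atom (Is_Max k)) (clear k))))"
      unfolding sem_Seq_iff[of _ _ _ "Star _"] sem.simps(4) by auto
    also have "\<dots> \<longleftrightarrow> (\<exists>x. (\<forall>y<x. P w \<sigma> y \<and> y < m) \<and> P w \<sigma> (min x m) \<and> m \<le> x \<and> s = (0, \<sigma>))"
      using tests_iff[OF c clean[of "min x m" for x]] m \<sigma>
      by (auto simp: sem_Seq_iff instr_sem_iff clear_iff assms(2) min_def simp del: sem.simps(2))
    also have "\<dots> \<longleftrightarrow> s = (0, \<sigma>) \<and> (\<forall>x\<le>m. P w \<sigma> x)"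
      (is "?l \<longleftrightarrow> ?r")
    proof
      assume ?l
      then obtain x where x: "\<forall>y<x. P w \<sigma> y \<and> y < m" "P w \<sigma> (min x m)" "m \<le> x" "s = (0, \<sigma>)" by blast
      from x(1,3) have "x = m" using all_less_iff[of x m] by auto
      with x show ?r by (auto simp: le_less)
    next
      assume ?r
      then show ?l by (intro exI[of _ m]) auto
    qed
    finally show ?thesis by (simp add: m less_Suc_eq_le)
  qed
  then show ?thesis unfolding test_def tests_def by blast
qed

text \<open>Both registers are counted down in step while the scratch register \<open>k\<close>
  records the number of rounds; register \<open>i\<close> has to arrive at zero, and the rounds are
  then undone. For \<open>i = j\<close> a round would decrement the same register twice, whence the
  separate case.\<close>

lemma test_le:
  assumes "i < k" "j < k"
  shows "test k (\<lambda>w \<sigma>. \<sigma> i \<le> \<sigma> j)"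
proof (cases "i = j")
  case True
  then show ?thesis using test_const[of k True] by simp
next
  case ij: False
  let ?down = "Seq (Atom (Dec i)) (Seq (Atom (Dec j)) (Atom (Inc k)))"
  let ?up = "Seq (Atom (Dec k)) (Seq (Atom (Inc i)) (Atom (Inc j)))"
  let ?c = "Seq (Star ?down) (Seq (Atom (Is_Zero i)) (Seq (Star ?up) (Atom (Is_Zero k))))"
  have "((0, \<sigma>), s) \<in> sem (instr_sem w) ?c \<longleftrightarrow> s = (0, \<sigma>) \<and> \<sigma> i \<le> \<sigma> j"
    if \<sigma>: "clean (length w) k \<sigma>" for w \<sigma> s
  proof -
    note bound = cleanD(1)[OF \<sigma>, of i] cleanD(1)[OF \<sigma>, of j] and zero = cleanD(2)[OF \<sigma>, of k]
    \<comment> \<open>\<open>?g x\<close> is the state after \<open>x\<close> rounds down,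
      \<open>?h x\<close> the state after \<open>x\<close> rounds up. The two sequences meet in
      \<open>?g (\<sigma> i) = ?h 0\<close>.\<close>
    let ?g = "\<lambda>x. (0 :: nat, \<sigma>(i := \<sigma> i - x, j := \<sigma> j - x, k := x))"
    let ?h = "\<lambda>x. (0 :: nat, \<sigma>(i := x, j := \<sigma> j - \<sigma> i + x, k := \<sigma> i - x))"
    have "(?g x, t) \<in> sem (instr_sem w) ?down \<longleftrightarrow> (x < \<sigma> i \<and> x < \<sigma> j) \<and> t = ?g (Suc x)" for x t
      using assms ij bound
      by (auto simp: sem_Seq_iff instr_sem_iff min_def simp del: sem.simps(2); auto simp: fun_eq_iff)
    from rtrancl_chain_iff[of ?g, OF this]
    have down: "((0, \<sigma>), t) \<in> sem (instr_sem w) (Star ?down) \<longleftrightarrow> (\<exists>x. t = ?g x \<and> x \<le> \<sigma> i \<and> x \<le> \<sigma> j)" for t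
      using zero by (simp add: all_less_iff imp_conjR all_conj_distrib fun_upd_idem)
    have "(?h x, t) \<in> sem (instr_sem w) ?up \<longleftrightarrow> x < \<sigma> i \<and> t = ?h (Suc x)" if "\<sigma> i \<le> \<sigma> j" for x t
      using assms ij bound that
      by (auto simp: sem_Seq_iff instr_sem_iff min_def simp del: sem.simps(2); auto simp: fun_eq_iff)
    from rtrancl_chain_iff[of ?h, OF this]
    have up: "(?h 0, t) \<in> sem (instr_sem w) (Star ?up) \<longleftrightarrow> (\<exists>x. t = ?h x \<and> x \<le> \<sigma> i)" if "\<sigma> i \<le> \<sigma> j" for t
      using that by (simp add: all_less_iff)
    have "(?g x, s) \<in> sem (instr_sem w) (Seq (Atom (Is_Zero i)) d) \<longleftrightarrow>
        \<sigma> i \<le> x \<and> (?g x, s) \<in> sem (instr_sem w) d" for x d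
      using assms ij by (simp add: sem_Seq_iff instr_sem_iff del: sem.simps(2))
    then have "((0, \<sigma>), s) \<in> sem (instr_sem w) ?c \<longleftrightarrow> (\<exists>x. x \<le> \<sigma> i \<and> x \<le> \<sigma> j \<and> \<sigma> i \<le> x \<and>
        (?g x, s) \<in> sem (instr_sem w) (Seq (Star ?up) (Atom (Is_Zero k))))"
      unfolding sem_Seq_iff[of _ _ _ "Star ?down"] down by blast
    also have "\<dots> \<longleftrightarrow> \<sigma> i \<le> \<sigma> j \<and> (?h 0, s) \<in> sem (instr_sem w) (Seq (Star ?up) (Atom (Is_Zero k)))"
    proof -
      have "?g (\<sigma> i) = ?h 0" by simp
      then show ?thesis by (metis le_antisym order_refl)
    qed
    also have "\<dots> \<longleftrightarrow> s = (0, \<sigma>) \<and> \<sigma> i \<le> \<sigma> j"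
    proof -
      have "(\<exists>x\<le>\<sigma> i. (?h x, s) \<in> instr_sem w (Is_Zero k)) \<longleftrightarrow> s = (0, \<sigma>)" if "\<sigma> i \<le> \<sigma> j"
      proof -
        have "?h (\<sigma> i) = (0, \<sigma>)" using that zero by (auto simp: fun_eq_iff)
        then show ?thesis by (auto simp: instr_sem_iff)
      qed
      moreover have "(?h 0, s) \<in> sem (instr_sem w) (Seq (Star ?up) (Atom (Is_Zero k))) \<longleftrightarrow>
          (\<exists>x\<le>\<sigma> i. (?h x, s) \<in> instr_sem w (Is_Zero k))" if "\<sigma> i \<le> \<sigma> j"
        unfolding sem_Seq_iff[of _ _ _ "Star ?up"] sem.simps(1) up[OF that] by (rule iffI; elim exE conjE; blast)
      ultimately show ?thesis by blast
    qed
    finally show ?thesis .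
  qed
  then show ?thesis unfolding test_def tests_def by blast
qed

text \<open>Substitutes a predecessor into a test by decrementing a register and restoring it.
  Applied to equality and \<open>\<le>\<close>, this yields the successor relation and the strict
  order.\<close>

lemma test_pred:
  assumes "test k T" "j < k"
  shows "test k (\<lambda>w \<sigma>. \<sigma> j > 0 \<and> T w (\<sigma>(j := \<sigma> j - 1)))"
proof -
  from assms(1) obtain c where c: "tests k c T" unfolding test_def by blast
  have "((0, \<sigma>), s) \<in> sem (instr_sem w) (Seq (Atom (Dec j)) (Seq c (Atom (Inc j)))) \<longleftrightarrow>
      s = (0, \<sigma>) \<and> \<sigma> j > 0 \<and> T w (\<sigma>(j := \<sigma> j - 1))" if \<sigma>: "clean (length w) k \<sigma>" for w \<sigma> s
  proof -
    have "clean (length w) k (\<sigma>(j := \<sigma> j - 1))"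
      using clean_update[OF \<sigma>, of "\<sigma> j - 1" j k] cleanD(1)[OF \<sigma>, of j] assms(2) by simp
    with tests_iff[OF c this] cleanD(1)[OF \<sigma>, of j] show ?thesis
      by (auto simp: sem_Seq_iff instr_sem_iff simp del: sem.simps(2))
  qed
  then show ?thesis unfolding test_def tests_def by blast
qed

lemma test_eq: "i < k \<Longrightarrow> j < k \<Longrightarrow> test k (\<lambda>w \<sigma>. \<sigma> i = \<sigma> j)"
  unfolding order_eq_iff by (intro test_conj test_le)

lemma test_Suc: "i < k \<Longrightarrow> j < k \<Longrightarrow> test k (\<lambda>w \<sigma>. \<sigma> j = Suc (\<sigma> i))"
proof (cases "i = j")
  case True
  then show ?thesis using test_const[of k False] by simp
next
  case False
  assume "i < k" "j < k"
  from test_pred[OF test_eq[OF this] this(2)] show ?thesis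
    by (rule test_cong) (use False in auto)
qed

lemma test_less: "i < k \<Longrightarrow> j < k \<Longrightarrow> test k (\<lambda>w \<sigma>. \<sigma> i < \<sigma> j)"
proof (cases "i = j")
  case True
  then show ?thesis using test_const[of k False] by simp
next
  case False
  assume "i < k" "j < k"
  from test_pred[OF test_le[OF this] this(2)] show ?thesis
    by (rule test_cong) (use False in auto)
qed

lemma test_neq: "i < k \<Longrightarrow> j < k \<Longrightarrow> test k (\<lambda>w \<sigma>. \<sigma> i \<noteq> \<sigma> j)"
  unfolding nat_neq_iff by (intro test_disj test_less)

text \<open>The input head walks right while register \<open>i\<close> is poured into the scratch
  register, and back afterwards. A value beyond the input leaves the head on the right end marker,
  which is what \<open>input_cell\<close> returns there; on the way back the surplus moves are
  absorbed at the left end.\<close>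

lemma test_cell:
  assumes "i < k"
  shows "test k (\<lambda>w \<sigma>. input_cell w (\<sigma> i) = a)"
proof -
  let ?down = "Seq (Atom (Dec i)) (Seq (Atom (Inc k)) (Atom (Head Move_Right)))"
  let ?up = "Seq (Atom (Dec k)) (Seq (Atom (Inc i)) (Atom (Head Move_Left)))"
  let ?c = "Seq (Star ?down) (Seq (Atom (Is_Zero i)) (Seq (Atom (Reads a)) (Seq (Star ?up) (Atom (Is_Zero k)))))"
  have "((0, \<sigma>), s) \<in> sem (instr_sem w) ?c \<longleftrightarrow> s = (0, \<sigma>) \<and> input_cell w (\<sigma> i) = a"
    if \<sigma>: "clean (length w) k \<sigma>" for w \<sigma> s
  proof -
    note bound = cleanD(1)[OF \<sigma>, of i] and zero = cleanD(2)[OF \<sigma>, of k]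
    let ?n = "length w + 1"
    let ?g = "\<lambda>x. (min x ?n, \<sigma>(i := \<sigma> i - x, k := x))"
    let ?h = "\<lambda>x. (min (\<sigma> i) ?n - x, \<sigma>(i := x, k := \<sigma> i - x))"
    have "(?g x, t) \<in> sem (instr_sem w) ?down \<longleftrightarrow> x < \<sigma> i \<and> t = ?g (Suc x)" for x t
      using assms bound
      by (auto simp: sem_Seq_iff instr_sem_iff min_def simp del: sem.simps(2); auto simp: fun_eq_iff)
    from rtrancl_chain_iff[of ?g, OF this]
    have down: "((0, \<sigma>), t) \<in> sem (instr_sem w) (Star ?down) \<longleftrightarrow> (\<exists>x. t = ?g x \<and> x \<le> \<sigma> i)" for t
      using zero by (simp add: all_less_iff fun_upd_idem)
    have "(?h x, t) \<in> sem (instr_sem w) ?up \<longleftrightarrow> x < \<sigma> i \<and> t = ?h (Suc x)" for x t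
      using assms bound
      by (auto simp: sem_Seq_iff instr_sem_iff min_def simp del: sem.simps(2); auto simp: fun_eq_iff)
    from rtrancl_chain_iff[of ?h, OF this]
    have up: "(?h 0, t) \<in> sem (instr_sem w) (Star ?up) \<longleftrightarrow> (\<exists>x. t = ?h x \<and> x \<le> \<sigma> i)" for t
      by (simp add: all_less_iff)
    have "input_cell w (min v ?n) = input_cell w v" for v by (auto simp: input_cell_def)
    then have "(?g x, s) \<in> sem (instr_sem w) (Seq (Atom (Is_Zero i)) (Seq (Atom (Reads a)) d)) \<longleftrightarrow>
        \<sigma> i \<le> x \<and> input_cell w x = a \<and> (?g x, s) \<in> sem (instr_sem w) d" for x d
      using assms by (simp add: sem_Seq_iff instr_sem_iff del: sem.simps(2))
    then have "((0, \<sigma>), s) \<in> sem (instr_sem w) ?c \<longleftrightarrow> (\<exists>x. x \<le> \<sigma> i \<and> \<sigma> i \<le> x \<and> input_cell w x = a \<and>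
        (?g x, s) \<in> sem (instr_sem w) (Seq (Star ?up) (Atom (Is_Zero k))))"
      unfolding sem_Seq_iff[of _ _ _ "Star ?down"] down by blast
    also have "\<dots> \<longleftrightarrow> input_cell w (\<sigma> i) = a \<and>
        (?h 0, s) \<in> sem (instr_sem w) (Seq (Star ?up) (Atom (Is_Zero k)))"
    proof -
      have "?g (\<sigma> i) = ?h 0" by simp
      then show ?thesis by (metis le_antisym order_refl)
    qed
    also have "\<dots> \<longleftrightarrow> s = (0, \<sigma>) \<and> input_cell w (\<sigma> i) = a"
    proof -
      have "?h (\<sigma> i) = (0, \<sigma>)" using zero by (auto simp: fun_eq_iff)
      then have "(\<exists>x\<le>\<sigma> i. (?h x, s) \<in> instr_sem w (Is_Zero k)) \<longleftrightarrow> s = (0, \<sigma>)"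
        by (auto simp: instr_sem_iff)
      then show ?thesis unfolding sem_Seq_iff[of _ _ _ "Star ?up"] using up by auto
    qed
    finally show ?thesis .
  qed
  then show ?thesis unfolding test_def tests_def by blast
qed

section \<open>Transitive closure\<close>

text \<open>Pairs, because most applications accompany a node or an input position by a number;
  where one component would do, the other stays fixed. Each new pair is bounded by \<open>N\<close>,
  so that it fits into registers.\<close>

definition tc :: "nat \<Rightarrow> (nat \<Rightarrow> nat \<Rightarrow> nat \<Rightarrow> nat \<Rightarrow> bool) \<Rightarrow> nat \<Rightarrow> nat \<Rightarrow> nat \<Rightarrow> nat \<Rightarrow> bool" where
  "tc N P x y x' y' \<longleftrightarrow> ((x, y), (x', y')) \<in> {((x, y), (x', y')). x' < N \<and> y' < N \<and> P x y x' y'}\<^sup>*"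

lemma guess_two_iff:
  assumes "\<sigma> i = 0" "\<sigma> j = 0" "i \<noteq> j"
  shows "((p, \<sigma>), v) \<in> sem (instr_sem w) (Seq (guess i) (Seq (guess j) r)) \<longleftrightarrow>
    (\<exists>x<cap (length w). \<exists>y<cap (length w). ((p, \<sigma>(i := x, j := y)), v) \<in> sem (instr_sem w) r)"
proof -
  have "((p, \<sigma>(i := x)), u) \<in> sem (instr_sem w) (guess j) \<longleftrightarrow> (\<exists>y<cap (length w). u = (p, \<sigma>(i := x, j := y)))" for x u
    using assms by (intro guess_iff) simp
  moreover have "(\<exists>u. (\<exists>x<N. u = f x) \<and> Q u) \<longleftrightarrow> (\<exists>x<N. Q (f x))" for N :: nat and f :: "nat \<Rightarrow> state" and Q
    by blast
  ultimately show ?thesis by (simp only: sem_Seq_iff guess_iff[of \<sigma> i, OF assms(1)])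
qed

text \<open>A path is guessed pair by pair. Only the current pair and its guessed successor are
  kept, in the four registers from \<open>k\<close> on.\<close>

lemma test_tc:
  fixes T :: "'a list \<Rightarrow> (nat \<Rightarrow> nat) \<Rightarrow> bool"
  assumes T: "test (Suc (Suc (Suc (Suc k)))) T"
    and P: "\<And>w \<sigma> x y x' y'. T w (\<sigma>(k := x, Suc k := y, Suc (Suc k) := x', Suc (Suc (Suc k)) := y')) \<longleftrightarrow> P w \<sigma> x y x' y'"
    and k: "a < k" "b < k" "c < k" "d < k"
  shows "test k (\<lambda>w \<sigma>. tc (cap (length w)) (P w \<sigma>) (\<sigma> a) (\<sigma> b) (\<sigma> c) (\<sigma> d))"
proof -
  from T obtain t where t: "tests (Suc (Suc (Suc (Suc k)))) t T" unfolding test_def by blast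
  have "test (Suc (Suc (Suc (Suc k)))) (\<lambda>(w :: 'a list) \<sigma>. \<sigma> k = \<sigma> a \<and> \<sigma> (Suc k) = \<sigma> b)"
    "test (Suc (Suc (Suc (Suc k)))) (\<lambda>(w :: 'a list) \<sigma>. \<sigma> k = \<sigma> c \<and> \<sigma> (Suc k) = \<sigma> d)"
    using k by (auto intro!: test_conj test_eq)
  then obtain e f :: "'a instr prog" where e: "tests (Suc (Suc (Suc (Suc k)))) e (\<lambda>w \<sigma>. \<sigma> k = \<sigma> a \<and> \<sigma> (Suc k) = \<sigma> b)"
    and f: "tests (Suc (Suc (Suc (Suc k)))) f (\<lambda>w \<sigma>. \<sigma> k = \<sigma> c \<and> \<sigma> (Suc k) = \<sigma> d)" unfolding test_def by blast
  define next_pair :: "'a instr prog" where "next_pair = Seq (guess (Suc (Suc k))) (Seq (guess (Suc (Suc (Suc k))))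
    (Seq t (Seq (clear k) (Seq (clear (Suc k)) (Seq (move (Suc (Suc k)) k) (move (Suc (Suc (Suc k))) (Suc k)))))))"
  \<comment> \<open>No instruction copies a register, so the start pair is guessed and compared with
    registers \<open>a\<close> and \<open>b\<close> by \<open>e\<close>; in the same way
    \<open>f\<close> checks the end pair.\<close>
  define prog where "prog = Seq (guess k) (Seq (guess (Suc k)) (Seq e (Seq (Star next_pair)
    (Seq f (Seq (clear k) (clear (Suc k)))))))"
  have "((0, \<sigma>), s) \<in> sem (instr_sem w) prog \<longleftrightarrow>
      s = (0, \<sigma>) \<and> tc (cap (length w)) (P w \<sigma>) (\<sigma> a) (\<sigma> b) (\<sigma> c) (\<sigma> d)"
    if \<sigma>: "clean (length w) k \<sigma>" for w \<sigma> s
  proof -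
    let ?N = "cap (length w)"
    define g where "g = (\<lambda>(x, y). (0 :: nat, \<sigma>(k := x, Suc k := y)))"
    let ?Q = "{((x, y), (x', y')). x' < ?N \<and> y' < ?N \<and> P w \<sigma> x y x' y'}"
    let ?P = "\<lambda>(x, y). x < ?N \<and> y < ?N"
    have zero: "\<sigma> j = 0" if "k \<le> j" for j using cleanD(2)[OF \<sigma> that] .
    have g_clean: "clean (length w) (Suc (Suc (Suc (Suc k)))) (\<sigma>(k := x, Suc k := y))" if "x < ?N" "y < ?N" for x y
      using that cleanD[OF \<sigma>] by (auto simp: clean_def)
    have step: "(g u, v) \<in> sem (instr_sem w) next_pair \<longleftrightarrow> (\<exists>u'. (u, u') \<in> ?Q \<and> v = g u')" if u: "?P u" for u v
    proof -
      obtain x y where xy: "u = (x, y)" "x < ?N" "y < ?N" using u by auto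
      let ?\<sigma> = "\<lambda>x' y'. \<sigma>(k := x, Suc k := y, Suc (Suc k) := x', Suc (Suc (Suc k)) := y')"
      have clean: "clean (length w) (Suc (Suc (Suc (Suc k)))) (?\<sigma> x' y')" if "x' < ?N" "y' < ?N" for x' y'
        using that xy cleanD[OF \<sigma>] by (auto simp: clean_def)
      have 1: "(g u, v) \<in> sem (instr_sem w) next_pair \<longleftrightarrow> (\<exists>x'<?N. \<exists>y'<?N. ((0, ?\<sigma> x' y'), v) \<in> sem (instr_sem w)
         (Seq t (Seq (clear k) (Seq (clear (Suc k)) (Seq (move (Suc (Suc k)) k) (move (Suc (Suc (Suc k))) (Suc k)))))))"
        unfolding next_pair_def g_def xy(1) prod.case using zero by (intro guess_two_iff) auto
      have 2: "((0, ?\<sigma> x' y'), v) \<in> sem (instr_sem w)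
          (Seq t (Seq (clear k) (Seq (clear (Suc k)) (Seq (move (Suc (Suc k)) k) (move (Suc (Suc (Suc k))) (Suc k)))))) \<longleftrightarrow>
          P w \<sigma> x y x' y' \<and> v = g (x', y')" if "x' < ?N" "y' < ?N" for x' y'
      proof -
        have "((?\<sigma> x' y')(k := 0, Suc k := 0, Suc (Suc k) := 0, k := x', Suc (Suc (Suc k)) := 0, Suc k := y')) = \<sigma>(k := x', Suc k := y')"
          using zero by (auto simp: fun_eq_iff)
        then show ?thesis
          using that by (simp add: sem_Seq_iff tests_iff[OF t clean[OF that]] clear_iff move_iff P g_def del: sem.simps(2))
      qed
      show ?thesis unfolding 1 using 2 by (auto simp: xy(1) simp del: sem.simps)
    qed
    have star: "(g u, v) \<in> sem (instr_sem w) (Star next_pair) \<longleftrightarrow> (\<exists>u'. (u, u') \<in> ?Q\<^sup>* \<and> v = g u')"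
      if "?P u" for u v
      unfolding sem.simps(4)
    proof (rule rtrancl_embed_iff[where P = ?P, OF step])
      show "?P u'" if "(u, u') \<in> ?Q" for u u' using that by auto
    qed (use that in auto)
    have bound: "?P u'" if "(u, u') \<in> ?Q\<^sup>*" "?P u" for u u'
      using that by (induction rule: rtrancl_induct) auto
    have ends: "(g u, v) \<in> sem (instr_sem w) (Seq f (Seq (clear k) (clear (Suc k)))) \<longleftrightarrow>
        v = (0, \<sigma>) \<and> u = (\<sigma> c, \<sigma> d)" if u: "?P u" for u v
    proof -
      obtain x y where xy: "u = (x, y)" "x < ?N" "y < ?N" using u by auto
      have "\<sigma>(k := x, Suc k := y, k := 0, Suc k := 0) = \<sigma>" using zero by (auto simp: fun_eq_iff)
      then show ?thesis
        using tests_iff[OF f g_clean[OF xy(2,3)]] k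
        by (auto simp: sem_Seq_iff clear_iff g_def xy(1) simp del: sem.simps(2))
    qed
    have starts: "(g u, v) \<in> sem (instr_sem w) e \<longleftrightarrow> v = g u \<and> u = (\<sigma> a, \<sigma> b)" if u: "?P u" for u v
    proof -
      obtain x y where xy: "u = (x, y)" "x < ?N" "y < ?N" using u by auto
      show ?thesis
        using tests_iff[OF e g_clean[OF xy(2,3)]] k by (auto simp: g_def xy(1))
    qed
    have guesses: "((0, \<sigma>), v) \<in> sem (instr_sem w) (Seq (guess k) (Seq (guess (Suc k)) r)) \<longleftrightarrow>
        (\<exists>u. ?P u \<and> (g u, v) \<in> sem (instr_sem w) r)" for v r
      using guess_two_iff[of \<sigma> k "Suc k" 0 v w r] zero by (auto simp: g_def)
    have ab: "?P (\<sigma> a, \<sigma> b)" using cleanD(1)[OF \<sigma>] by auto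
    let ?rest = "Seq (Star next_pair) (Seq f (Seq (clear k) (clear (Suc k))))"
    have starts_rest: "(g u, s) \<in> sem (instr_sem w) (Seq e ?rest) \<longleftrightarrow>
        u = (\<sigma> a, \<sigma> b) \<and> (g u, s) \<in> sem (instr_sem w) ?rest" if u: "?P u" for u
      unfolding sem_Seq_iff[of _ _ _ e] starts[OF u] by blast
    have "((0, \<sigma>), s) \<in> sem (instr_sem w) prog \<longleftrightarrow> (g (\<sigma> a, \<sigma> b), s) \<in> sem (instr_sem w) ?rest"
      unfolding prog_def guesses
    proof
      assume "\<exists>u. ?P u \<and> (g u, s) \<in> sem (instr_sem w) (Seq e ?rest)"
      then obtain u where u: "?P u" "(g u, s) \<in> sem (instr_sem w) (Seq e ?rest)" by blast
      from iffD1[OF starts_rest[OF u(1)] u(2)] show "(g (\<sigma> a, \<sigma> b), s) \<in> sem (instr_sem w) ?rest"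
        by (elim conjE) (simp only:)
    next
      assume "(g (\<sigma> a, \<sigma> b), s) \<in> sem (instr_sem w) ?rest"
      with starts_rest[OF ab] have "(g (\<sigma> a, \<sigma> b), s) \<in> sem (instr_sem w) (Seq e ?rest)" by simp
      with ab show "\<exists>u. ?P u \<and> (g u, s) \<in> sem (instr_sem w) (Seq e ?rest)" by blast
    qed
    also have "\<dots> \<longleftrightarrow> (\<exists>u'. ((\<sigma> a, \<sigma> b), u') \<in> ?Q\<^sup>* \<and>
        (g u', s) \<in> sem (instr_sem w) (Seq f (Seq (clear k) (clear (Suc k)))))"
      unfolding sem_Seq_iff[of _ _ _ "Star next_pair"] star[OF ab] by blast
    also have "\<dots> \<longleftrightarrow> (\<exists>u'. ((\<sigma> a, \<sigma> b), u') \<in> ?Q\<^sup>* \<and> s = (0, \<sigma>) \<and> u' = (\<sigma> c, \<sigma> d))"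
      by (intro ex_cong conj_cong refl ends bound[OF _ ab])
    finally show ?thesis by (auto simp: tc_def)
  qed
  then show ?thesis unfolding test_def tests_def by blast
qed

text \<open>The body reads the bound value from register \<open>k\<close>, a form in which the rule
  unifies with a formula. The second premise says that \<open>P\<close> itself depends on the
  registers below \<open>k\<close> only.\<close>

lemma test_exI:
  assumes "test (Suc k) (\<lambda>w \<sigma>. P w \<sigma> (\<sigma> k))"
    and "\<And>w \<sigma> \<tau>. \<forall>i<k. \<sigma> i = \<tau> i \<Longrightarrow> P w \<sigma> = P w \<tau>"
  shows "test k (\<lambda>w \<sigma>. \<exists>x<cap (length w). P w \<sigma> x)"
proof (rule test_ex[OF assms(1)])
  show "P w (\<sigma>(k := x)) ((\<sigma>(k := x)) k) \<longleftrightarrow> P w \<sigma> x" for w \<sigma> x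
    using assms(2)[of "\<sigma>(k := x)" \<sigma> w] by simp
qed

lemma test_allI:
  assumes "test (Suc k) (\<lambda>w \<sigma>. P w \<sigma> (\<sigma> k))"
    and "\<And>w \<sigma> \<tau>. \<forall>i<k. \<sigma> i = \<tau> i \<Longrightarrow> P w \<sigma> = P w \<tau>"
  shows "test k (\<lambda>w \<sigma>. \<forall>x<cap (length w). P w \<sigma> x)"
proof (rule test_all[OF assms(1)])
  show "P w (\<sigma>(k := x)) ((\<sigma>(k := x)) k) \<longleftrightarrow> P w \<sigma> x" for w \<sigma> x
    using assms(2)[of "\<sigma>(k := x)" \<sigma> w] by simp
qed

lemma test_tcI:
  assumes "test (Suc (Suc (Suc (Suc k))))
      (\<lambda>w \<sigma>. P w \<sigma> (\<sigma> k) (\<sigma> (Suc k)) (\<sigma> (Suc (Suc k))) (\<sigma> (Suc (Suc (Suc k)))))"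
    and "\<And>w \<sigma> \<tau>. \<forall>i<k. \<sigma> i = \<tau> i \<Longrightarrow> P w \<sigma> = P w \<tau>"
    and "a < k" "b < k" "c < k" "d < k"
  shows "test k (\<lambda>w \<sigma>. tc (cap (length w)) (P w \<sigma>) (\<sigma> a) (\<sigma> b) (\<sigma> c) (\<sigma> d))"
proof (rule test_tc[OF assms(1) _ assms(3-6)])
  fix w x y x' y' and \<sigma> :: "nat \<Rightarrow> nat"
  let ?\<sigma> = "\<sigma>(k := x, Suc k := y, Suc (Suc k) := x', Suc (Suc (Suc k)) := y')"
  have "P w ?\<sigma> = P w \<sigma>" by (rule assms(2)) simp
  then show "P w ?\<sigma> (?\<sigma> k) (?\<sigma> (Suc k)) (?\<sigma> (Suc (Suc k))) (?\<sigma> (Suc (Suc (Suc k)))) \<longleftrightarrow> P w \<sigma> x y x' y'"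
    by simp
qed

lemmas test_intros = test_exI test_allI test_tcI test_conj test_disj
  test_eq test_neq test_Suc test_less test_zero test_max test_cell

section \<open>Inductive counting\<close>

lemma tc_refl: "tc N P x y x y"
  by (simp add: tc_def)

lemma tc_step: "tc N P x y x' y' \<Longrightarrow> P x' y' x'' y'' \<Longrightarrow> x'' < N \<Longrightarrow> y'' < N \<Longrightarrow> tc N P x y x'' y''"
  unfolding tc_def by (erule rtrancl.rtrancl_into_rtrancl) simp

lemma tc_induct [consumes 1, case_names refl step]:
  assumes "tc N P x y x' y'" "I x y"
    and "\<And>a b a' b'. I a b \<Longrightarrow> P a b a' b' \<Longrightarrow> a' < N \<Longrightarrow> b' < N \<Longrightarrow> I a' b'"
  shows "I x' y'"
proof -
  have "((x, y), (x', y')) \<in> {((x, y), (x', y')). x' < N \<and> y' < N \<and> P x y x' y'}\<^sup>*"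
    using assms(1) by (simp add: tc_def)
  then show ?thesis
    by (induction rule: rtrancl_induct2) (use assms(2,3) in auto)
qed

text \<open>
  The nodes of a graph are the numbers below \<open>N - 1\<close>, so that the number of nodes is still below \<open>N\<close>.
  For complementary edge relations \<open>P\<close> and \<open>Q\<close>, \<open>count N P Q s d c\<close> says that \<open>c\<close> is the number of nodes
  at distance at most \<open>d\<close> from \<open>s\<close>. Knowing this number, one can certify that a node is not among them.
\<close>

definition near :: "nat \<Rightarrow> (nat \<Rightarrow> nat \<Rightarrow> bool) \<Rightarrow> nat \<Rightarrow> nat \<Rightarrow> nat \<Rightarrow> bool" where
  "near N P s d v \<longleftrightarrow> (\<exists>z<N. z = 0 \<and> tc N (\<lambda>x i x' i'. i' = Suc i \<and> (x' = x \<or> P x x')) s z v d)"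

text \<open>The nodes are run through and some of those in \<open>R\<close> are counted; skipping is
  always allowed, whence a lower bound only. The variables \<open>z\<close> and \<open>m\<close>
  stand for the constants \<open>0\<close> and \<open>N - 1\<close>, since \<open>tc\<close> takes
  its end points from registers.\<close>

definition at_least :: "nat \<Rightarrow> (nat \<Rightarrow> bool) \<Rightarrow> nat \<Rightarrow> bool" where
  "at_least N R c \<longleftrightarrow> (\<exists>z<N. z = 0 \<and> (\<exists>m<N. Suc m = N \<and>
     tc N (\<lambda>x i x' i'. x' = Suc x \<and> (i' = i \<or> i' = Suc i \<and> R x)) z z m c))"

text \<open>\<open>R'\<close> plays the complement of \<open>R\<close> in a testable form. Each node
  has to be decided one way or the other, which makes the count exact.\<close>

definition exactly :: "nat \<Rightarrow> (nat \<Rightarrow> bool) \<Rightarrow> (nat \<Rightarrow> bool) \<Rightarrow> nat \<Rightarrow> bool" where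
  "exactly N R R' c \<longleftrightarrow> (\<exists>z<N. z = 0 \<and> (\<exists>m<N. Suc m = N \<and>
     tc N (\<lambda>x i x' i'. x' = Suc x \<and> (i' = Suc i \<and> R x \<or> i' = i \<and> R' x)) z z m c))"

text \<open>If \<open>c\<close> is the true number of nodes within distance \<open>d\<close>, then
  \<open>c\<close> such nodes are all of them. As none equals \<open>v\<close> or has an edge to
  \<open>v\<close>, the node \<open>v\<close> is not within distance \<open>Suc d\<close>.\<close>

definition far :: "nat \<Rightarrow> (nat \<Rightarrow> nat \<Rightarrow> bool) \<Rightarrow> (nat \<Rightarrow> nat \<Rightarrow> bool) \<Rightarrow> nat \<Rightarrow> nat \<Rightarrow> nat \<Rightarrow> nat \<Rightarrow> bool" where
  "far N P Q s d c v \<longleftrightarrow> at_least N (\<lambda>u. near N P s d u \<and> u \<noteq> v \<and> Q u v) c"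

definition count :: "nat \<Rightarrow> (nat \<Rightarrow> nat \<Rightarrow> bool) \<Rightarrow> (nat \<Rightarrow> nat \<Rightarrow> bool) \<Rightarrow> nat \<Rightarrow> nat \<Rightarrow> nat \<Rightarrow> bool" where
  "count N P Q s d c \<longleftrightarrow> (\<exists>z<N. z = 0 \<and> (\<exists>one<N. one = Suc z \<and>
     tc N (\<lambda>d c d' c'. d' = Suc d \<and> exactly N (near N P s d') (far N P Q s d c) c') z one d c))"

text \<open>Equal counts for \<open>d\<close> and \<open>Suc d\<close> show that the set of nodes
  within distance \<open>d\<close> has stopped growing; exhibiting \<open>c\<close> of its nodes
  other than \<open>v\<close> then excludes \<open>v\<close>.\<close>

definition unreachable :: "nat \<Rightarrow> (nat \<Rightarrow> nat \<Rightarrow> bool) \<Rightarrow> (nat \<Rightarrow> nat \<Rightarrow> bool) \<Rightarrow> nat \<Rightarrow> nat \<Rightarrow> bool" where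
  "unreachable N P Q s v \<longleftrightarrow> (\<exists>d<N. \<exists>c<N. \<exists>d'<N. d' = Suc d \<and> count N P Q s d c \<and> count N P Q s d' c \<and>
     at_least N (\<lambda>u. near N P s d u \<and> u \<noteq> v) c)"

lemma card_less_Suc: "card {y. y < Suc x \<and> R y} = card {y. y < x \<and> R y} + (if R x then 1 else 0)"
proof -
  have "{y. y < Suc x \<and> R y} = (if R x then insert x {y. y < x \<and> R y} else {y. y < x \<and> R y})"
    by (auto simp: less_Suc_eq)
  then show ?thesis by simp
qed

lemma card_less_le: "card {y. y < x \<and> R y} \<le> x"
  using card_mono[of "{..<x}" "{y. y < x \<and> R y}"] by auto

lemma at_least_iff:
  assumes "1 \<le> N"
  shows "at_least N R c \<longleftrightarrow> c \<le> card {y. y < N - 1 \<and> R y}"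
proof -
  let ?tc = "tc N (\<lambda>x i x' i'. x' = Suc x \<and> (i' = i \<or> i' = Suc i \<and> R x)) 0 0"
  have "c \<le> card {y. y < x \<and> R y}" if "?tc x c" for x c
    using that by (induction rule: tc_induct) (auto simp: card_less_Suc)
  moreover have "?tc x i" if "x < N" "i \<le> card {y. y < x \<and> R y}" for x i
    using that
  proof (induction x arbitrary: i)
    case 0
    then show ?case by (simp add: tc_refl)
  next
    case (Suc x)
    show ?case
    proof (cases "i \<le> card {y. y < x \<and> R y}")
      case True
      with Suc have "?tc x i" by simp
      then show ?thesis by (rule tc_step) (use Suc.prems True card_less_le[of x R] in auto)
    next
      case False
      with Suc.prems have *: "R x" "i = Suc (card {y. y < x \<and> R y})" by (auto simp: card_less_Suc split: if_splits)
      with Suc have "?tc x (card {y. y < x \<and> R y})" by simp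
      then show ?thesis by (rule tc_step) (use Suc.prems * card_less_le[of x R] in auto)
    qed
  qed
  ultimately have "?tc (N - 1) c \<longleftrightarrow> c \<le> card {y. y < N - 1 \<and> R y}" using assms by auto
  moreover have "at_least N R c \<longleftrightarrow> ?tc (N - 1) c"
    using assms unfolding at_least_def by (cases N) auto
  ultimately show ?thesis by simp
qed

lemma exactly_iff:
  assumes "1 \<le> N" "\<And>x. x < N - 1 \<Longrightarrow> R' x \<longleftrightarrow> \<not> R x"
  shows "exactly N R R' c \<longleftrightarrow> c = card {y. y < N - 1 \<and> R y}"
proof -
  let ?tc = "tc N (\<lambda>x i x' i'. x' = Suc x \<and> (i' = Suc i \<and> R x \<or> i' = i \<and> R' x)) 0 0"
  have "c = card {y. y < x \<and> R y}" if "?tc x c" for x c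
    using that by (induction rule: tc_induct) (use assms(2) in \<open>auto simp: card_less_Suc\<close>)
  moreover have "?tc x (card {y. y < x \<and> R y})" if "x < N" for x
    using that
  proof (induction x)
    case 0
    then show ?case by (simp add: tc_refl)
  next
    case (Suc x)
    then have "?tc x (card {y. y < x \<and> R y})" by simp
    then show ?case
      by (rule tc_step) (use Suc.prems assms(2)[of x] card_less_le[of x R] in \<open>auto simp: card_less_Suc\<close>)
  qed
  ultimately have "?tc (N - 1) c \<longleftrightarrow> c = card {y. y < N - 1 \<and> R y}" using assms(1) by auto
  moreover have "exactly N R R' c \<longleftrightarrow> ?tc (N - 1) c"
    using assms(1) unfolding exactly_def by (cases N) auto
  ultimately show ?thesis by simp
qed

section \<open>Correctness of inductive counting\<close>

primrec ball :: "('a \<Rightarrow> 'a \<Rightarrow> bool) \<Rightarrow> 'a \<Rightarrow> nat \<Rightarrow> 'a set" where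
  "ball P s 0 = {s}"
| "ball P s (Suc d) = ball P s d \<union> {v. \<exists>u\<in>ball P s d. P u v}"

lemma ball_subset: "ball P s d \<subseteq> {v. P\<^sup>*\<^sup>* s v}"
  by (induction d) (auto intro: rtranclp.rtrancl_into_rtrancl)

lemma ball_closed:
  assumes "ball P s (Suc d) = ball P s d"
  shows "ball P s d = {v. P\<^sup>*\<^sup>* s v}"
proof -
  have "v \<in> ball P s d" if "P\<^sup>*\<^sup>* s v" for v
    using that
  proof (induction rule: rtranclp_induct)
    case base
    show ?case by (induction d) auto
  next
    case (step y z)
    then have "z \<in> ball P s (Suc d)" by auto
    with assms show ?case by simp
  qed
  with ball_subset[of P s d] show ?thesis by auto
qed

lemma unreachable_iff:
  assumes s: "s < N - 1" and P: "\<And>u v. P u v \<Longrightarrow> v < N - 1"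
    and Q: "\<And>u v. u < N - 1 \<Longrightarrow> v < N - 1 \<Longrightarrow> Q u v \<longleftrightarrow> \<not> P u v" and v: "v < N - 1"
  shows "unreachable N P Q s v \<longleftrightarrow> \<not> P\<^sup>*\<^sup>* s v"
proof -
  have N: "1 \<le> N" using s by simp
  let ?R = "ball P s"
  have R: "?R d \<subseteq> {..<N - 1}" for d by (induction d) (use s P in auto)
  have fin: "finite (?R d)" for d using finite_subset[OF R] by blast
  have card: "card (?R d) \<le> N - 1" for d using card_mono[OF _ R[of d]] by simp
  have near: "near N P s d v \<longleftrightarrow> d < N \<and> v \<in> ?R d" for d v
  proof -
    let ?tc = "tc N (\<lambda>x i x' i'. i' = Suc i \<and> (x' = x \<or> P x x')) s 0"
    have "d < N \<and> v \<in> ?R d" if "?tc v d" for v d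
      using that by (induction rule: tc_induct) (use s in auto)
    moreover have "?tc v d" if "d < N" "v \<in> ?R d" for v d
      using that
    proof (induction d arbitrary: v)
      case (Suc d)
      then obtain u where "u \<in> ?R d" "v = u \<or> P u v" by auto
      with Suc have "?tc u d" by simp
      then show ?case by (rule tc_step) (use \<open>v = u \<or> P u v\<close> Suc.prems R[of "Suc d"] in auto)
    qed (simp add: tc_refl)
    ultimately show ?thesis using N by (auto simp: near_def)
  qed
  \<comment> \<open>With the true size of the ball as threshold, the counted nodes exhaust the ball,
    so a lower bound amounts to a universal statement.\<close>
  have at_least: "at_least N (\<lambda>u. near N P s d u \<and> S u) (card (?R d)) \<longleftrightarrow> (\<forall>u\<in>?R d. S u)" if "d < N" for d S
  proof -
    have "card (?R d) \<le> card {u \<in> ?R d. S u} \<longleftrightarrow> {u \<in> ?R d. S u} = ?R d"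
      using card_seteq[OF fin, of "{u \<in> ?R d. S u}" d] by auto
    moreover have "{u. u < N - 1 \<and> (d < N \<and> u \<in> ?R d) \<and> S u} = {u \<in> ?R d. S u}"
      using R[of d] that by auto
    ultimately show ?thesis unfolding at_least_iff[OF N] near by auto
  qed
  have far: "far N P Q s d (card (?R d)) v \<longleftrightarrow> v \<notin> ?R (Suc d)" if "d < N" "v < N - 1" for d v
    using at_least[OF that(1), of "\<lambda>u. u \<noteq> v \<and> Q u v"] Q R[of d] that(2) by (fastforce simp: far_def)
  have exactly: "exactly N (near N P s (Suc d)) (far N P Q s d (card (?R d))) c \<longleftrightarrow> c = card (?R (Suc d))"
    if "Suc d < N" for d c
  proof -
    have "far N P Q s d (card (?R d)) v \<longleftrightarrow> \<not> near N P s (Suc d) v" if "v < N - 1" for v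
      using far[OF _ that, of d] \<open>Suc d < N\<close> by (simp add: near)
    then have "exactly N (near N P s (Suc d)) (far N P Q s d (card (?R d))) c \<longleftrightarrow>
        c = card {v. v < N - 1 \<and> near N P s (Suc d) v}"
      by (rule exactly_iff[OF N])
    moreover have "{v. v < N - 1 \<and> near N P s (Suc d) v} = ?R (Suc d)"
      using R[of "Suc d"] that unfolding near by blast
    ultimately show ?thesis by (simp only:)
  qed
  have count: "count N P Q s d c \<longleftrightarrow> d < N \<and> c = card (?R d)" for d c
  proof -
    let ?tc = "tc N (\<lambda>d c d' c'. d' = Suc d \<and> exactly N (near N P s d') (far N P Q s d c) c') 0 1"
    have "d < N \<and> c = card (?R d)" if "?tc d c" for d c
      using that by (induction rule: tc_induct) (use N exactly in auto)
    moreover have "?tc d (card (?R d))" if "d < N" for d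
      using that
    proof (induction d)
      case (Suc d)
      then have "?tc d (card (?R d))" by simp
      then show ?case by (rule tc_step) (use Suc.prems exactly card[of "Suc d"] N in auto)
    qed (simp add: tc_refl)
    moreover have "count N P Q s d c \<longleftrightarrow> ?tc d c" using s by (auto simp: count_def)
    ultimately show ?thesis by blast
  qed
  have mono: "?R d \<subseteq> ?R (Suc d)" for d by auto
  have stable: "?R (Suc d) = ?R d" if "card (?R (Suc d)) = card (?R d)" for d
    using card_subset_eq[OF fin mono that[symmetric]] by (rule sym)
  \<comment> \<open>The sizes start at \<open>1\<close>; if they grew strictly all the way to
    \<open>N - 1\<close>, that ball would contain more than the \<open>N - 1\<close> nodes there
    are.\<close>
  have "\<exists>d. Suc d < N \<and> card (?R (Suc d)) = card (?R d)"
  proof (rule ccontr)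
    assume *: "\<nexists>d. Suc d < N \<and> card (?R (Suc d)) = card (?R d)"
    have "d < card (?R d)" if "d < N" for d
      using that
    proof (induction d)
      case (Suc d)
      then have "card (?R d) \<noteq> card (?R (Suc d))" using * by auto
      moreover have "card (?R d) \<le> card (?R (Suc d))" by (rule card_mono[OF fin mono])
      ultimately show ?case using Suc by simp
    qed simp
    from this[of "N - 1"] card[of "N - 1"] N show False by simp
  qed
  then obtain d where d: "Suc d < N" "card (?R (Suc d)) = card (?R d)" by blast
  show ?thesis
  proof
    assume "unreachable N P Q s v"
    then obtain d where "Suc d < N" "card (?R (Suc d)) = card (?R d)"
      "at_least N (\<lambda>u. near N P s d u \<and> u \<noteq> v) (card (?R d))"
      unfolding unreachable_def count by auto
    with at_least[of d "\<lambda>u. u \<noteq> v"] have "v \<notin> ?R d" by auto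
    with ball_closed[OF stable] \<open>card (?R (Suc d)) = card (?R d)\<close> show "\<not> P\<^sup>*\<^sup>* s v" by blast
  next
    assume "\<not> P\<^sup>*\<^sup>* s v"
    with ball_subset[of P s d] have "v \<notin> ?R d" by blast
    with at_least[of d "\<lambda>u. u \<noteq> v"] d(1) have "at_least N (\<lambda>u. near N P s d u \<and> u \<noteq> v) (card (?R d))" by auto
    moreover have "card (?R d) < N" using card[of d] N by linarith
    ultimately show "unreachable N P Q s v"
      unfolding unreachable_def count using d by (intro exI[of _ d] exI[of _ "card (?R d)"] exI[of _ "Suc d"] conjI) auto
  qed
qed

section \<open>Testing the counting formulas\<close>

text \<open>The premise ranges over all \<open>k\<close> because the edge relation is evaluated
  below further quantifiers and closures, with more registers in use.\<close>

lemma test_near: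
  assumes "\<And>k i j. i < k \<Longrightarrow> j < k \<Longrightarrow> test k (\<lambda>w \<sigma>. P w (\<sigma> i) (\<sigma> j))"
  shows "i < k \<Longrightarrow> j < k \<Longrightarrow> l < k \<Longrightarrow>
    test k (\<lambda>w \<sigma>. near (cap (length w)) (P w) (\<sigma> i) (\<sigma> j) (\<sigma> l))"
  unfolding near_def by (intro test_intros assms; simp)

lemma test_far:
  assumes "\<And>k i j. i < k \<Longrightarrow> j < k \<Longrightarrow> test k (\<lambda>w \<sigma>. P w (\<sigma> i) (\<sigma> j))"
    and "\<And>k i j. i < k \<Longrightarrow> j < k \<Longrightarrow> test k (\<lambda>w \<sigma>. Q w (\<sigma> i) (\<sigma> j))"
  shows "i < k \<Longrightarrow> j < k \<Longrightarrow> l < k \<Longrightarrow> m < k \<Longrightarrow>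
    test k (\<lambda>w \<sigma>. far (cap (length w)) (P w) (Q w) (\<sigma> i) (\<sigma> j) (\<sigma> l) (\<sigma> m))"
  unfolding far_def at_least_def by (intro test_intros test_near assms; simp)

lemma test_count:
  assumes "\<And>k i j. i < k \<Longrightarrow> j < k \<Longrightarrow> test k (\<lambda>w \<sigma>. P w (\<sigma> i) (\<sigma> j))"
    and "\<And>k i j. i < k \<Longrightarrow> j < k \<Longrightarrow> test k (\<lambda>w \<sigma>. Q w (\<sigma> i) (\<sigma> j))"
  shows "i < k \<Longrightarrow> j < k \<Longrightarrow> l < k \<Longrightarrow>
    test k (\<lambda>w \<sigma>. count (cap (length w)) (P w) (Q w) (\<sigma> i) (\<sigma> j) (\<sigma> l))"
  unfolding count_def exactly_def by (intro test_intros test_near test_far assms; simp)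

lemma test_unreachable:
  assumes "\<And>k i j. i < k \<Longrightarrow> j < k \<Longrightarrow> test k (\<lambda>w \<sigma>. P w (\<sigma> i) (\<sigma> j))"
    and "\<And>k i j. i < k \<Longrightarrow> j < k \<Longrightarrow> test k (\<lambda>w \<sigma>. Q w (\<sigma> i) (\<sigma> j))"
  shows "i < k \<Longrightarrow> j < k \<Longrightarrow>
    test k (\<lambda>w \<sigma>. unreachable (cap (length w)) (P w) (Q w) (\<sigma> i) (\<sigma> j))"
  unfolding unreachable_def at_least_def by (intro test_intros test_near test_count assms; simp)

section \<open>Reading sentences\<close>

text \<open>The alphabet is finite, so this is a finite disjunction. Applied to a complement, it
  supplies the negation of a test for a single cell.\<close>

lemma test_in_cells:
  assumes "i < k"
  shows "test k (\<lambda>w \<sigma>. input_cell w (\<sigma> i) \<in> (A :: 'a::finite cell set))"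
  using finite_cells[of A]
proof (induction A rule: finite_induct)
  case empty
  show ?case using test_const[of k False] by simp
next
  case (insert a A)
  from test_disj[OF test_cell[OF assms, of a] this(3)] show ?case by simp
qed

text \<open>Positions are those of the input head: the word starts at \<open>1\<close>, and
  \<open>q\<close> is the position behind the occurrence.\<close>

primrec occurs :: "'a list \<Rightarrow> nat \<Rightarrow> 'a list \<Rightarrow> nat \<Rightarrow> bool" where
  "occurs w p [] q \<longleftrightarrow> p = q"
| "occurs w p (x # xs) q \<longleftrightarrow> input_cell w p = Input x \<and> occurs w (Suc p) xs q"

lemma occurs_append: "occurs w p (xs @ ys) q \<longleftrightarrow> (\<exists>r. occurs w p xs r \<and> occurs w r ys q)"
  by (induction xs arbitrary: p) auto

lemma occurs_le: "occurs w p xs q \<Longrightarrow> q = p + length xs"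
proof (induction xs arbitrary: p)
  case (Cons x xs)
  with Cons.IH[of "Suc p"] show ?case by simp
qed simp

lemma input_cell_Suc: "input_cell w (Suc k) = Input x \<longleftrightarrow> k < length w \<and> w ! k = x"
  by (auto simp: input_cell_def)

lemma occurs_iff:
  "k \<le> length w \<Longrightarrow> occurs w (Suc k) xs q \<longleftrightarrow> q = Suc (k + length xs) \<and> take (length xs) (drop k w) = xs"
proof (induction xs arbitrary: k)
  case (Cons x xs)
  show ?case
  proof (cases "k < length w")
    case True
    then have "drop k w = w ! k # drop (Suc k) w" by (simp add: Cons_nth_drop_Suc)
    with Cons.IH[of "Suc k"] True show ?thesis by (auto simp: input_cell_Suc)
  next
    case False
    with Cons.prems show ?thesis by (auto simp: input_cell_Suc)
  qed
qed auto

lemma occurs_split: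
  assumes "occurs w p xs q" "xs \<noteq> []"
  shows "\<exists>ys zs. w = ys @ xs @ zs \<and> p = Suc (length ys)"
proof -
  from assms obtain x xs' where "xs = x # xs'" "input_cell w p = Input x" by (cases xs) auto
  then obtain k where k: "p = Suc k" "k < length w"
    by (cases p) (auto simp: input_cell_Suc, simp add: input_cell_def)
  with assms(1) occurs_iff[of k w xs q] have "take (length xs) (drop k w) = xs" by simp
  then have "w = take k w @ xs @ drop (length xs) (drop k w)"
    by (metis append_take_drop_id)
  with k show ?thesis by (intro exI[of _ "take k w"] exI[of _ "drop (length xs) (drop k w)"]) simp
qed

lemma occurs_appendI: "occurs (ys @ xs @ zs) (Suc (length ys)) xs (Suc (length ys + length xs))"
  by (subst occurs_iff) auto

lemma occurs_whole: "occurs w 1 xs q \<and> input_cell w q = Right_End \<longleftrightarrow> xs = w \<and> q = length w + 1"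
proof -
  have "occurs w 1 xs q \<longleftrightarrow> q = length xs + 1 \<and> take (length xs) w = xs"
    using occurs_iff[of 0 w xs q] by simp
  moreover have "take (length xs) w = xs \<and> length w < length xs + 1 \<longleftrightarrow> xs = w" by auto
  ultimately show ?thesis unfolding input_cell_iff by blast
qed

subsection \<open>Binary numbers\<close>

text \<open>Most significant bit first, as in the encoding of sentences; the counters on tapes use
  the opposite order.\<close>

definition of_bits :: "bool list \<Rightarrow> nat" where
  "of_bits = foldl (\<lambda>a b. 2 * a + of_bool b) 0"

lemma of_bits_simps: "of_bits [] = 0" "of_bits (bs @ [b]) = 2 * of_bits bs + of_bool b"
  by (simp_all add: of_bits_def)

lemma of_bits_binary: "of_bits (binary n) = n"
proof (induction n rule: less_induct)
  case (less n)
  show ?case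
  proof (cases "n = 0")
    case False
    with less[of "n div 2"] show ?thesis by (subst binary.simps) (simp add: of_bits_simps)
  qed (simp add: binary.simps of_bits_simps)
qed

lemma binary_of_bits: "(bs \<noteq> [] \<longrightarrow> hd bs) \<Longrightarrow> binary (of_bits bs) = bs"
proof (induction bs rule: rev_induct)
  case Nil
  show ?case by (simp add: binary.simps of_bits_simps)
next
  case (snoc b bs)
  then have IH: "binary (of_bits bs) = bs" by (cases bs) auto
  have "of_bits (bs @ [b]) \<noteq> 0"
  proof (cases bs)
    case Nil
    with snoc.prems show ?thesis by (simp add: of_bits_def)
  next
    case (Cons c cs)
    moreover have "binary 0 = []" by (simp add: binary.simps)
    ultimately have "of_bits bs \<noteq> 0" using IH by (metis list.distinct(1))
    then show ?thesis by (simp add: of_bits_simps)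
  qed
  then show ?case using IH by (subst binary.simps) (simp add: of_bits_simps)
qed

lemma hd_binary: "n > 0 \<Longrightarrow> binary n \<noteq> [] \<and> hd (binary n)"
proof (induction n rule: less_induct)
  case (less n)
  show ?case
  proof (cases "n = 1")
    case False
    with less have "binary (n div 2) \<noteq> [] \<and> hd (binary (n div 2))" by (intro less.IH) auto
    with less.prems show ?thesis by (subst (1 2) binary.simps) auto
  qed (simp add: binary.simps)
qed

text \<open>The only arithmetic available so far is the successor, so doubling is a loop that takes
  two steps for one.\<close>

definition double :: "nat \<Rightarrow> nat \<Rightarrow> nat \<Rightarrow> bool" where
  "double N y z \<longleftrightarrow> (\<exists>o'<N. o' = 0 \<and> tc N (\<lambda>x i x' i'. x' = Suc x \<and> (\<exists>j<N. j = Suc i \<and> i' = Suc j)) o' o' y z)"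

lemma double_iff:
  assumes "z < N"
  shows "double N y z \<longleftrightarrow> z = 2 * y"
proof -
  let ?tc = "tc N (\<lambda>x i x' i'. x' = Suc x \<and> (\<exists>j<N. j = Suc i \<and> i' = Suc j)) 0 0"
  have "z = 2 * y" if "?tc y z" for y z
    using that by (induction rule: tc_induct) auto
  moreover have "?tc y (2 * y)" if "2 * y < N" for y
    using that
  proof (induction y)
    case (Suc y)
    then have "?tc y (2 * y)" by simp
    then show ?case by (rule tc_step) (use Suc.prems in auto)
  qed (simp add: tc_refl)
  ultimately have "?tc y z \<longleftrightarrow> z = 2 * y" using assms by auto
  moreover have "double N y z \<longleftrightarrow> ?tc y z" using assms by (auto simp: double_def)
  ultimately show ?thesis by simp
qed

lemma test_double: "i < k \<Longrightarrow> j < k \<Longrightarrow> test k (\<lambda>w \<sigma>. double (cap (length w)) (\<sigma> i) (\<sigma> j))"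
  unfolding double_def by (intro test_intros; simp)

definition no_bit :: "token cell set" where "no_bit = - (Input ` range Bit)"

text \<open>Horner's scheme along the digits. A leading \<open>True\<close> rules out leading zeros
  and the value \<open>0\<close>; the cell at \<open>q\<close> must not be a digit, so that the
  number is read to its end.\<close>

definition number :: "nat \<Rightarrow> token list \<Rightarrow> nat \<Rightarrow> nat \<Rightarrow> nat \<Rightarrow> bool" where
  "number N w p v q \<longleftrightarrow> input_cell w p = Input (Bit True) \<and> input_cell w q \<in> no_bit \<and>
     (\<exists>z<N. z = 0 \<and> tc N (\<lambda>x y x' y'. x' = Suc x \<and>
        (input_cell w x = Input (Bit False) \<and> double N y y' \<or>
         input_cell w x = Input (Bit True) \<and> (\<exists>u<N. double N y u \<and> y' = Suc u))) p z q v)"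

lemma test_number: "i < k \<Longrightarrow> j < k \<Longrightarrow> l < k \<Longrightarrow> test k (\<lambda>w \<sigma>. number (cap (length w)) w (\<sigma> i) (\<sigma> j) (\<sigma> l))"
  unfolding number_def by (intro test_intros test_double test_in_cells; simp)

lemma number_iff:
  assumes "v < N" "q < N"
  shows "number N w p v q \<longleftrightarrow> v > 0 \<and> occurs w p (map Bit (binary v)) q \<and> input_cell w q \<in> no_bit"
proof -
  let ?S = "\<lambda>x y x' y'. x' = Suc x \<and>
        (input_cell w x = Input (Bit False) \<and> double N y y' \<or>
         input_cell w x = Input (Bit True) \<and> (\<exists>u<N. double N y u \<and> y' = Suc u))"
  let ?tc = "tc N ?S p 0"
  have S: "?S x y x' y' \<longleftrightarrow> x' = Suc x \<and> (\<exists>b. input_cell w x = Input (Bit b) \<and> y' = 2 * y + of_bool b)"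
    if "y' < N" for x y x' y'
  proof -
    have "(\<exists>u<N. double N y u \<and> y' = Suc u) \<longleftrightarrow> y' = Suc (2 * y)"
      using that by (auto simp: double_iff)
    moreover have "(\<exists>b. input_cell w x = Input (Bit b) \<and> y' = 2 * y + of_bool b) \<longleftrightarrow>
        input_cell w x = Input (Bit False) \<and> y' = 2 * y \<or> input_cell w x = Input (Bit True) \<and> y' = Suc (2 * y)"
      by (simp add: ex_bool_eq) blast
    ultimately show ?thesis using double_iff[OF that] by simp
  qed
  have sound: "\<exists>bs. occurs w p (map Bit bs) q \<and> v = of_bits bs" if "?tc q v" for q v
    using that
  proof (induction rule: tc_induct)
    case refl
    show ?case by (intro exI[of _ "[]"]) (simp add: of_bits_simps)
  next
    case (step x y x' y')
    then obtain b bs where "x' = Suc x" "input_cell w x = Input (Bit b)" "y' = 2 * y + of_bool b"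
      "occurs w p (map Bit bs) x" "y = of_bits bs" using S[of y' x' x y] by blast
    then show ?case by (intro exI[of _ "bs @ [b]"]) (auto simp: of_bits_simps occurs_append)
  qed
  have complete: "?tc q (of_bits bs)" if "occurs w p (map Bit bs) q" "q < N" "of_bits bs < N" for q bs
    using that
  proof (induction bs arbitrary: q rule: rev_induct)
    case Nil
    then show ?case by (simp add: tc_refl of_bits_simps)
  next
    case (snoc b bs)
    then obtain r where r: "occurs w p (map Bit bs) r" "input_cell w r = Input (Bit b)" "q = Suc r"
      by (auto simp: occurs_append)
    with snoc have "?tc r (of_bits bs)" by (simp add: of_bits_simps)
    moreover have "?S r (of_bits bs) q (of_bits (bs @ [b]))"
      using S[of "of_bits (bs @ [b])" q r "of_bits bs"] snoc.prems r by (auto simp: of_bits_simps)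
    ultimately show ?case using snoc.prems by (blast intro: tc_step)
  qed
  have "number N w p v q \<longleftrightarrow> input_cell w p = Input (Bit True) \<and> input_cell w q \<in> no_bit \<and> ?tc q v"
    using assms by (auto simp: number_def)
  also have "\<dots> \<longleftrightarrow> v > 0 \<and> occurs w p (map Bit (binary v)) q \<and> input_cell w q \<in> no_bit"
  proof
    assume *: "input_cell w p = Input (Bit True) \<and> input_cell w q \<in> no_bit \<and> ?tc q v"
    with sound obtain bs where bs: "occurs w p (map Bit bs) q" "v = of_bits bs" by blast
    have "bs \<noteq> []" using bs(1) * by (auto simp: no_bit_def)
    moreover have "hd bs" using bs(1) * \<open>bs \<noteq> []\<close> by (cases bs) auto
    ultimately have "binary v = bs" using binary_of_bits[of bs] bs(2) by simp
    with bs * \<open>bs \<noteq> []\<close> show "v > 0 \<and> occurs w p (map Bit (binary v)) q \<and> input_cell w q \<in> no_bit"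
      by (cases "v = 0") (auto simp: binary.simps)
  next
    assume *: "v > 0 \<and> occurs w p (map Bit (binary v)) q \<and> input_cell w q \<in> no_bit"
    then have "input_cell w p = Input (Bit True)" using hd_binary[of v] by (cases "binary v") auto
    with * complete[of "binary v" q] assms of_bits_binary[of v]
    show "input_cell w p = Input (Bit True) \<and> input_cell w q \<in> no_bit \<and> ?tc q v" by simp
  qed
  finally show ?thesis .
qed

subsection \<open>Variables and atoms\<close>

text \<open>A variable is identified with the position of its quantifier in the sentence.\<close>

fun pos :: "qvar \<Rightarrow> nat" where
  "pos (X i) = 2 * i - 1"
| "pos (Y i) = 2 * i"

text \<open>\<open>r\<close> is twice the index; \<open>u\<close> is \<open>r\<close> for an
  existential variable and one less for a universal one, in accordance with
  \<open>pos\<close>.\<close>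

definition var_at :: "nat \<Rightarrow> token list \<Rightarrow> nat \<Rightarrow> nat \<Rightarrow> nat \<Rightarrow> bool" where
  "var_at N w p u q \<longleftrightarrow> (\<exists>p'<N. \<exists>v<N. \<exists>r<N. p' = Suc p \<and> number N w p' v q \<and> double N v r \<and>
     (input_cell w p = Input VarX \<and> r = Suc u \<or> input_cell w p = Input VarY \<and> u = r))"

definition atom_at :: "nat \<Rightarrow> token list \<Rightarrow> nat \<Rightarrow> nat \<Rightarrow> nat \<Rightarrow> nat \<Rightarrow> bool" where
  "atom_at N w p u v q \<longleftrightarrow> (\<exists>p'<N. \<exists>r<N. input_cell w p = Input Edge \<and> p' = Suc p \<and>
     var_at N w p' u r \<and> var_at N w r v q)"

lemma test_var_at: "i < k \<Longrightarrow> j < k \<Longrightarrow> l < k \<Longrightarrow> test k (\<lambda>w \<sigma>. var_at (cap (length w)) w (\<sigma> i) (\<sigma> j) (\<sigma> l))"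
  unfolding var_at_def by (intro test_intros test_double test_number; simp)

lemma test_atom_at: "i < k \<Longrightarrow> j < k \<Longrightarrow> l < k \<Longrightarrow> m < k \<Longrightarrow>
    test k (\<lambda>w \<sigma>. atom_at (cap (length w)) w (\<sigma> i) (\<sigma> j) (\<sigma> l) (\<sigma> m))"
  unfolding atom_at_def by (intro test_intros test_var_at; simp)

lemma var_atD:
  assumes "var_at N w p u q" "q < N"
  shows "\<exists>x. qindex x > 0 \<and> u = pos x \<and> occurs w p (encode_var x) q \<and> input_cell w q \<in> no_bit"
proof -
  from assms(1) obtain v r where v: "v < N" "r < N" "number N w (Suc p) v q" "double N v r"
    and u: "input_cell w p = Input VarX \<and> r = Suc u \<or> input_cell w p = Input VarY \<and> u = r"
    unfolding var_at_def by blast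
  from v number_iff[OF v(1) assms(2)] double_iff[OF v(2)]
  have "v > 0" "r = 2 * v" "occurs w (Suc p) (map Bit (binary v)) q" "input_cell w q \<in> no_bit" by auto
  with u show ?thesis
    by (elim disjE) (rule exI[of _ "X v"], simp, rule exI[of _ "Y v"], simp)
qed

text \<open>The doubled index is at most \<open>Suc (pos x)\<close>, so the last premise makes it
  fit into the quantified range.\<close>

lemma var_atI:
  assumes "qindex x > 0" "occurs w p (encode_var x) q" "input_cell w q \<in> no_bit" "q < N" "Suc (pos x) < N"
  shows "var_at N w p (pos x) q"
proof -
  have idx: "2 * qindex x < N" using assms(1,5) by (cases x) auto
  have "encode_var x \<noteq> []" by (cases x) auto
  then have p: "Suc p < N \<or> Suc p = q" using occurs_le[OF assms(2)] assms(4) by (cases "encode_var x") auto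
  then have p: "Suc p < N" using assms(4) by auto
  have "occurs w (Suc p) (map Bit (binary (qindex x))) q" using assms(2) by (cases x) auto
  with assms(1,3,4) idx have "number N w (Suc p) (qindex x) q" by (simp add: number_iff)
  moreover have "double N (qindex x) (2 * qindex x)" using idx by (simp add: double_iff)
  moreover have "input_cell w p = Input VarX \<and> 2 * qindex x = Suc (pos x) \<or>
      input_cell w p = Input VarY \<and> pos x = 2 * qindex x"
    using assms(1,2) by (cases x) auto
  moreover have "qindex x < N" using idx by simp
  ultimately show ?thesis
    unfolding var_at_def using p idx by blast
qed

lemma encode_var_first: "\<exists>x xs. encode_var a = x # xs \<and> x \<in> {VarX, VarY}"
  by (cases a) auto

lemma atom_atD:
  assumes "atom_at N w p u v q" "q < N"
  shows "\<exists>a b. qindex a > 0 \<and> qindex b > 0 \<and> u = pos a \<and> v = pos b \<and>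
    occurs w p (encode_atom (a, b)) q \<and> input_cell w q \<in> no_bit"
proof -
  from assms(1) obtain r where r: "r < N" "input_cell w p = Input Edge" "var_at N w (Suc p) u r" "var_at N w r v q"
    unfolding atom_at_def by blast
  from var_atD[OF r(3,1)] obtain a where a: "qindex a > 0" "u = pos a" "occurs w (Suc p) (encode_var a) r" by blast
  from var_atD[OF r(4) assms(2)] obtain b where
    b: "qindex b > 0" "v = pos b" "occurs w r (encode_var b) q" "input_cell w q \<in> no_bit" by blast
  have "occurs w p (encode_atom (a, b)) q" using r(2) a(3) b(3) by (auto simp: occurs_append)
  with a b show ?thesis by blast
qed

lemma atom_atI:
  assumes "qindex a > 0" "qindex b > 0" "occurs w p (encode_atom (a, b)) q" "input_cell w q \<in> no_bit"
    "q < N" "Suc (pos a) < N" "Suc (pos b) < N"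
  shows "atom_at N w p (pos a) (pos b) q"
proof -
  from assms(3) obtain r where r: "input_cell w p = Input Edge"
    "occurs w (Suc p) (encode_var a) r" "occurs w r (encode_var b) q" by (auto simp: occurs_append)
  have "r < N" "Suc p < N" using occurs_le[OF r(2)] occurs_le[OF r(3)] assms(5) by auto
  moreover have "input_cell w r \<in> no_bit"
    using encode_var_first[of b] r(3) by (auto simp: no_bit_def)
  ultimately show ?thesis
    unfolding atom_at_def using r assms by (blast intro: var_atI)
qed

section \<open>Well-formed sentences\<close>

definition prefix :: "nat \<Rightarrow> token list \<Rightarrow> nat \<Rightarrow> bool" where
  "prefix N w s \<longleftrightarrow> (\<exists>z<N. z = 0 \<and> (\<exists>o'<N. o' = Suc z \<and> tc N (\<lambda>x y x' y'. y' = y \<and>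
     (\<exists>u<N. u = Suc x \<and> x' = Suc u \<and> input_cell w x = Input QForall \<and> input_cell w u = Input QExists)) o' z s z))"

text \<open>The prefix occupies the positions below \<open>s\<close>, so \<open>u < s\<close> and
  \<open>v < s\<close> say that both variables of an atom are bound by it.\<close>

definition atoms :: "nat \<Rightarrow> token list \<Rightarrow> nat \<Rightarrow> nat \<Rightarrow> bool" where
  "atoms N w s e \<longleftrightarrow> (\<exists>z<N. z = 0 \<and> tc N (\<lambda>x y x' y'. y' = y \<and>
     (\<exists>u<N. \<exists>v<N. atom_at N w x u v x' \<and> u < s \<and> v < s)) s z e z)"

definition valid :: "nat \<Rightarrow> token list \<Rightarrow> bool" where
  "valid N w \<longleftrightarrow> (\<exists>s<N. \<exists>e<N. prefix N w s \<and> atoms N w s e \<and> input_cell w e = Right_End)"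

lemma test_valid: "test k (\<lambda>w \<sigma>. valid (cap (length w)) w)"
  unfolding valid_def prefix_def atoms_def by (intro test_intros test_atom_at; simp)

lemma prefix_iff:
  assumes "s < N" "1 < N"
  shows "prefix N w s \<longleftrightarrow> (\<exists>m. s = 2 * m + 1 \<and> occurs w 1 (concat (replicate m [QForall, QExists])) s)"
proof -
  let ?S = "\<lambda>x y x' y'. y' = y \<and>
     (\<exists>u<N. u = Suc x \<and> x' = Suc u \<and> input_cell w x = Input QForall \<and> input_cell w u = Input QExists)"
  let ?w = "\<lambda>m. concat (replicate m [QForall, QExists])"
  have Suc_w: "?w (Suc m) = ?w m @ [QForall, QExists]" for m
    by (induction m) auto
  have sound: "\<exists>m. s = 2 * m + 1 \<and> occurs w 1 (?w m) s" if "tc N ?S 1 0 s y" for s y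
    using that
  proof (induction rule: tc_induct)
    case refl
    show ?case by (intro exI[of _ 0]) simp
  next
    case (step x y x' y')
    then obtain m where "x = 2 * m + 1" "occurs w 1 (?w m) x" by blast
    with step(2) show ?case
      by (intro exI[of _ "Suc m"]) (auto simp only: Suc_w occurs_append occurs.simps, auto)
  qed
  have complete: "tc N ?S 1 0 (2 * m + 1) 0" if "occurs w 1 (?w m) (2 * m + 1)" "2 * m + 1 < N" for m
    using that
  proof (induction m)
    case (Suc m)
    from Suc.prems(1) obtain r where r: "occurs w 1 (?w m) r" "input_cell w r = Input QForall"
      "input_cell w (Suc r) = Input QExists" "Suc (Suc r) = 2 * Suc m + 1"
      unfolding Suc_w occurs_append by auto
    then have "r = 2 * m + 1" by simp
    have "tc N ?S 1 0 (2 * m + 1) 0"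
    proof (rule Suc.IH)
      show "occurs w 1 (?w m) (2 * m + 1)" using r(1) \<open>r = 2 * m + 1\<close> by (simp only:)
      have "2 * Suc m + 1 = Suc (Suc (2 * m + 1))" by simp
      with Suc.prems(2) show "2 * m + 1 < N" by (metis Suc_lessD)
    qed
    moreover have "?S (2 * m + 1) 0 (2 * Suc m + 1) 0"
      using r(2,3) \<open>r = 2 * m + 1\<close> Suc.prems(2) by (intro conjI exI[of _ "Suc r"]) auto
    ultimately show ?case
      by (rule tc_step[OF _ _ Suc.prems(2) less_trans[OF zero_less_one assms(2)]])
  qed (simp add: tc_refl)
  have "prefix N w s \<longleftrightarrow> tc N ?S 1 0 s 0" using assms by (auto simp: prefix_def)
  with sound complete assms(1) show ?thesis by blast
qed

text \<open>Where a number ends is seen only from the cell behind it. So the cell at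
  \<open>e\<close> must not be a digit, and in the induction an earlier atom is followed by an
  \<open>Edge\<close>.\<close>

lemma atoms_iff:
  assumes "s < N" "e < N" "input_cell w e \<in> no_bit"
  shows "atoms N w s e \<longleftrightarrow> (\<exists>\<Phi>. occurs w s (concat (map encode_atom \<Phi>)) e \<and>
    (\<forall>(a, b)\<in>set \<Phi>. qindex a > 0 \<and> qindex b > 0 \<and> pos a < s \<and> pos b < s))"
proof -
  let ?S = "\<lambda>x y x' y'. y' = y \<and> (\<exists>u<N. \<exists>v<N. atom_at N w x u v x' \<and> u < s \<and> v < s)"
  let ?ok = "\<lambda>\<Phi>. \<forall>(a, b)\<in>set \<Phi>. qindex a > 0 \<and> qindex b > 0 \<and> pos a < s \<and> pos b < s"
  have sound: "\<exists>\<Phi>. occurs w s (concat (map encode_atom \<Phi>)) e \<and> ?ok \<Phi>" if "tc N ?S s 0 e y" for e y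
    using that
  proof (induction rule: tc_induct)
    case refl
    show ?case by (intro exI[of _ "[]"]) simp
  next
    case (step x y x' y')
    then obtain \<Phi> where \<Phi>: "occurs w s (concat (map encode_atom \<Phi>)) x" "?ok \<Phi>" by blast
    from step(2) obtain u v where uv: "atom_at N w x u v x'" "u < s" "v < s" by blast
    from atom_atD[OF uv(1) step(3)] obtain a b where "qindex a > 0" "qindex b > 0" "u = pos a" "v = pos b"
      "occurs w x (encode_atom (a, b)) x'" by blast
    with \<Phi> uv show ?case
      by (intro exI[of _ "\<Phi> @ [(a, b)]"]) (auto simp: occurs_append[of w s] simp del: encode_atom.simps)
  qed
  have complete: "tc N ?S s 0 e 0"
    if "occurs w s (concat (map encode_atom \<Phi>)) e" "?ok \<Phi>" "e < N" "input_cell w e \<in> no_bit" for \<Phi> e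
    using that
  proof (induction \<Phi> arbitrary: e rule: rev_induct)
    case (snoc ab \<Phi>)
    obtain a b where ab: "ab = (a, b)" by (cases ab)
    from snoc.prems(1) obtain r where r: "occurs w s (concat (map encode_atom \<Phi>)) r"
      "occurs w r (encode_atom (a, b)) e" by (auto simp: occurs_append[of w s] ab simp del: encode_atom.simps)
    have "r < N" using occurs_le[OF r(2)] snoc.prems(3) by simp
    moreover have "input_cell w r \<in> no_bit" using r(2) by (auto simp: no_bit_def)
    ultimately have "tc N ?S s 0 r 0" using snoc r(1) by auto
    moreover have "atom_at N w r (pos a) (pos b) e"
      using snoc.prems r(2) assms(1) by (intro atom_atI) (auto simp: ab simp del: encode_atom.simps)
    then have "?S r 0 e 0"
      using snoc.prems(2) assms(1) by (intro conjI exI[of _ "pos a"] exI[of _ "pos b"]) (auto simp: ab)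
    moreover have "0 < N" using assms(1) by (cases N) simp_all
    ultimately show ?case using snoc.prems(3) by (blast intro: tc_step)
  qed (simp add: tc_refl)
  have "atoms N w s e \<longleftrightarrow> tc N ?S s 0 e 0" using assms by (auto simp: atoms_def)
  with sound complete assms(2,3) show ?thesis by blast
qed

lemma pos_less: "qindex a > 0 \<Longrightarrow> pos a < 2 * m + 1 \<longleftrightarrow> qindex a \<le> m"
  by (cases a) auto

lemma length_prefix: "length (concat (replicate m [QForall, QExists])) = 2 * m"
  by (induction m) auto

lemma valid_iff:
  assumes "length w + 1 < N"
  shows "valid N w \<longleftrightarrow> (\<exists>m \<Phi>. is_sentence (m, \<Phi>) \<and> w = encode (m, \<Phi>))"
proof
  assume "valid N w"
  then obtain s e where s: "s < N" "e < N" "prefix N w s" "atoms N w s e" "input_cell w e = Right_End"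
    unfolding valid_def by blast
  have "input_cell w e \<in> no_bit" using s(5) by (auto simp: no_bit_def)
  from s(4)[unfolded atoms_iff[OF s(1,2) this]] obtain \<Phi> where
    \<Phi>: "occurs w s (concat (map encode_atom \<Phi>)) e"
    "\<forall>(a, b)\<in>set \<Phi>. qindex a > 0 \<and> qindex b > 0 \<and> pos a < s \<and> pos b < s" by blast
  from s(1,3) assms obtain m where m: "s = 2 * m + 1" "occurs w 1 (concat (replicate m [QForall, QExists])) s"
    using prefix_iff[of s N w] by auto
  have "occurs w 1 (encode (m, \<Phi>)) e" using m(2) \<Phi>(1) by (auto simp: occurs_append)
  with s(5) occurs_whole have "encode (m, \<Phi>) = w" by blast
  moreover have "is_sentence (m, \<Phi>)" using \<Phi>(2) pos_less[of _ m] m(1) by fastforce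
  ultimately show "\<exists>m \<Phi>. is_sentence (m, \<Phi>) \<and> w = encode (m, \<Phi>)" by blast
next
  assume "\<exists>m \<Phi>. is_sentence (m, \<Phi>) \<and> w = encode (m, \<Phi>)"
  then obtain m \<Phi> where m: "is_sentence (m, \<Phi>)" "w = encode (m, \<Phi>)" by blast
  define s where "s = 2 * m + 1"
  define e where "e = length w + 1"
  have e: "input_cell w e = Right_End" "e < N" using assms by (simp_all add: e_def input_cell_iff)
  have "s \<le> length w + 1" unfolding s_def m(2) using length_prefix[of m] by simp
  then have s: "s < N" using assms by simp
  have "occurs w 1 (encode (m, \<Phi>)) e" using occurs_whole[of w "encode (m, \<Phi>)" e] m(2) e by (simp add: e_def)
  then obtain r where r: "occurs w 1 (concat (replicate m [QForall, QExists])) r"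
    "occurs w r (concat (map encode_atom \<Phi>)) e" by (auto simp: occurs_append)
  have "r = s" using occurs_le[OF r(1)] by (simp add: length_prefix s_def)
  have "prefix N w s" using prefix_iff[OF s, of w] assms r(1) \<open>r = s\<close> s_def by auto
  moreover have "atoms N w s e"
  proof -
    have "input_cell w e \<in> no_bit" using e(1) by (auto simp: no_bit_def)
    moreover have "\<forall>(a, b)\<in>set \<Phi>. qindex a > 0 \<and> qindex b > 0 \<and> pos a < s \<and> pos b < s"
      using m(1) pos_less[of _ m] unfolding s_def by fastforce
    ultimately show ?thesis using atoms_iff[OF s e(2)] r(2) \<open>r = s\<close> by blast
  qed
  ultimately show "valid N w" unfolding valid_def using s e by blast
qed

section \<open>The graph of the atoms\<close>

definition edge :: "nat \<Rightarrow> token list \<Rightarrow> nat \<Rightarrow> nat \<Rightarrow> bool" where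
  "edge N w u v \<longleftrightarrow> (\<exists>p<N. \<exists>q<N. atom_at N w p u v q)"

text \<open>The complement in positive form: in a well-formed sentence each \<open>Edge\<close>
  token starts exactly one atom, so it suffices to read at each of them an atom other than
  \<open>(u, v)\<close>.\<close>

definition no_edge :: "nat \<Rightarrow> token list \<Rightarrow> nat \<Rightarrow> nat \<Rightarrow> bool" where
  "no_edge N w u v \<longleftrightarrow> (\<forall>p<N. input_cell w p \<in> - {Input Edge} \<or>
     (\<exists>u'<N. \<exists>v'<N. \<exists>q<N. atom_at N w p u' v' q \<and> (u' \<noteq> u \<or> v' \<noteq> v)))"

text \<open>Implications are disjunctions over complemented cell sets. The cell at a prefix position
  tells the kind of its variable, and \<open>v < u\<close> says that the universal variable is
  quantified before the existential one.\<close>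

definition path_free :: "nat \<Rightarrow> token list \<Rightarrow> bool" where
  "path_free N w \<longleftrightarrow> (\<forall>u<N. \<forall>v<N. input_cell w v \<in> - {Input QForall} \<or>
     (input_cell w u \<in> - {Input QForall} \<or> u = v \<or> unreachable N (edge N w) (no_edge N w) u v) \<and>
     (input_cell w u \<in> - {Input QExists} \<or> v < u \<or> unreachable N (edge N w) (no_edge N w) v u \<or>
        unreachable N (edge N w) (no_edge N w) u v))"

lemma test_edge: "i < k \<Longrightarrow> j < k \<Longrightarrow> test k (\<lambda>w \<sigma>. edge (cap (length w)) w (\<sigma> i) (\<sigma> j))"
  unfolding edge_def by (intro test_intros test_atom_at; simp)

lemma test_no_edge: "i < k \<Longrightarrow> j < k \<Longrightarrow> test k (\<lambda>w \<sigma>. no_edge (cap (length w)) w (\<sigma> i) (\<sigma> j))"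
  unfolding no_edge_def by (intro test_intros test_atom_at test_in_cells; simp)

lemma test_path_free: "test k (\<lambda>w \<sigma>. path_free (cap (length w)) w)"
  unfolding path_free_def
  by (intro test_intros test_in_cells test_unreachable test_edge test_no_edge; simp)

lemma encode_var_append_cases:
  assumes "encode_var a @ xs = ys @ Edge # zs"
  shows "\<exists>ys'. ys = encode_var a @ ys' \<and> xs = ys' @ Edge # zs"
proof -
  have "Edge \<notin> set (encode_var a)" by (cases a) auto
  from assms consider us where "encode_var a = ys @ us" "us @ xs = Edge # zs"
    | us where "encode_var a @ us = ys" "xs = us @ Edge # zs"
    by (auto simp: append_eq_append_conv2)
  then show ?thesis
  proof cases
    case 1
    with \<open>Edge \<notin> _\<close> have "us = []" by (cases us) auto
    with 1 show ?thesis by auto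
  qed auto
qed

lemma no_bit_hd: "xs = [] \<or> hd xs \<notin> range Bit \<Longrightarrow> input_cell (ys @ xs) (Suc (length ys)) \<in> no_bit"
  by (cases xs) (auto simp: no_bit_def input_cell_def nth_append)

lemma Edge_in_atoms:
  assumes "concat (map encode_atom \<Phi>) = ys @ Edge # zs"
  shows "\<exists>(a, b)\<in>set \<Phi>. \<exists>xs. Edge # zs = encode_atom (a, b) @ xs \<and> (xs = [] \<or> hd xs \<notin> range Bit)"
  using assms
proof (induction \<Phi> arbitrary: ys)
  case (Cons ab \<Phi>)
  obtain a b where ab: "ab = (a, b)" by (cases ab)
  show ?case
  proof (cases ys)
    case Nil
    with Cons.prems ab hd_encode_atoms[of \<Phi>] show ?thesis by auto
  next
    case (Cons y ys')
    with Cons.prems ab have "encode_var a @ (encode_var b @ concat (map encode_atom \<Phi>)) = ys' @ Edge # zs"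
      by simp
    from encode_var_append_cases[OF this] obtain ys'' where
      "encode_var b @ concat (map encode_atom \<Phi>) = ys'' @ Edge # zs" by blast
    from encode_var_append_cases[OF this] obtain ys3 where "concat (map encode_atom \<Phi>) = ys3 @ Edge # zs" by blast
    from Cons.IH[OF this] show ?thesis by auto
  qed
qed simp

lemma Edge_in_prefix: "Edge \<notin> set (concat (replicate m [QForall, QExists]))"
  by (induction m) auto

text \<open>\<open>Edge\<close> occurs neither in the prefix nor inside an encoded variable, so it
  can only be the first token of an atom.\<close>

lemma Edge_in_sentence:
  assumes "w = encode (m, \<Phi>)" "input_cell w p = Input Edge"
  shows "\<exists>(a, b)\<in>set \<Phi>. \<exists>q. occurs w p (encode_atom (a, b)) q \<and> input_cell w q \<in> no_bit"
proof -
  have "occurs w p [Edge] (Suc p)" using assms(2) by simp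
  from occurs_split[OF this] obtain ys zs where w: "w = ys @ Edge # zs" and p: "p = Suc (length ys)" by auto
  from w assms(1) have "concat (replicate m [QForall, QExists]) @ concat (map encode_atom \<Phi>) = ys @ Edge # zs"
    by simp
  then consider us where "concat (replicate m [QForall, QExists]) = ys @ us"
      "us @ concat (map encode_atom \<Phi>) = Edge # zs"
    | us where "ys = concat (replicate m [QForall, QExists]) @ us" "concat (map encode_atom \<Phi>) = us @ Edge # zs"
    by (auto simp: append_eq_append_conv2)
  then obtain us where us: "concat (map encode_atom \<Phi>) = us @ Edge # zs"
  proof cases
    case 1
    with Edge_in_prefix[of m] have "us = []" by (cases us) auto
    with 1 that[of "[]"] show ?thesis by auto
  qed (use that in blast)
  from Edge_in_atoms[OF this] obtain a b xs where
    ab: "(a, b) \<in> set \<Phi>" "Edge # zs = encode_atom (a, b) @ xs" "xs = [] \<or> hd xs \<notin> range Bit" by blast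
  from w ab(2) have w': "w = ys @ encode_atom (a, b) @ xs" by simp
  have "occurs w p (encode_atom (a, b)) (Suc (length ys + length (encode_atom (a, b))))"
    unfolding w' p by (rule occurs_appendI)
  moreover have "input_cell w (Suc (length ys + length (encode_atom (a, b)))) \<in> no_bit"
    using no_bit_hd[OF ab(3), of "ys @ encode_atom (a, b)"] w' by simp
  ultimately show ?thesis using ab(1) by blast
qed

text \<open>Since no digit follows, the last number cannot be cut short or prolonged, and the
  unambiguity of the encoding carries over to occurrences.\<close>

lemma occurs_atom_unique:
  assumes "occurs w p (encode_atom (a, b)) q" "input_cell w q \<in> no_bit"
    and "occurs w p (encode_atom (a', b')) q'" "input_cell w q' \<in> no_bit"
  shows "a = a' \<and> b = b'"
proof -
  have split: "\<exists>ys zs. w = ys @ encode_atom (a, b) @ zs \<and> p = Suc (length ys) \<and> (zs = [] \<or> hd zs \<notin> range Bit)"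
    if "occurs w p (encode_atom (a, b)) q" "input_cell w q \<in> no_bit" for a b q
  proof -
    from occurs_split[OF that(1)] obtain ys zs where w: "w = ys @ encode_atom (a, b) @ zs" "p = Suc (length ys)" by auto
    have "q = Suc (length (ys @ encode_atom (a, b)))" using occurs_le[OF that(1)] w(2) by simp
    then have "zs = [] \<or> hd zs \<notin> range Bit" using that(2) w(1)
      by (cases zs) (auto simp: no_bit_def input_cell_def nth_append)
    with w show ?thesis by blast
  qed
  from split[OF assms(1,2)] obtain ys zs where 1: "w = ys @ encode_atom (a, b) @ zs" "p = Suc (length ys)"
    "zs = [] \<or> hd zs \<notin> range Bit" by blast
  from split[OF assms(3,4)] obtain ys' zs' where 2: "w = ys' @ encode_atom (a', b') @ zs'" "p = Suc (length ys')"
    "zs' = [] \<or> hd zs' \<notin> range Bit" by blast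
  from 1 2 have "encode_atom (a, b) @ zs = encode_atom (a', b') @ zs'" by auto
  then have eq: "encode_var a @ (encode_var b @ zs) = encode_var a' @ (encode_var b' @ zs')" by simp
  have "encode_var b @ zs = [] \<or> hd (encode_var b @ zs) \<notin> range Bit" for b zs by (cases b) auto
  with encode_var_append_inject[OF eq] have "a = a'" "encode_var b @ zs = encode_var b' @ zs'" by blast+
  with encode_var_append_inject[OF this(2) 1(3) 2(3)] show ?thesis by blast
qed

lemma pos_inject: "qindex a > 0 \<Longrightarrow> qindex b > 0 \<Longrightarrow> pos a = pos b \<longleftrightarrow> a = b"
  by (cases a; cases b) (auto, presburger+)

section \<open>Correctness of the path conditions on well-formed input\<close>

context
  fixes w m \<Phi> N
  assumes w: "w = encode (m, \<Phi>)" and sentence: "is_sentence (m, \<Phi>)" and N: "length w + 1 < N"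
begin

lemma length_w: "2 * m \<le> length w"
  unfolding w using length_prefix[of m] by simp

lemma index: "(a, b) \<in> set \<Phi> \<Longrightarrow> qindex a > 0 \<and> qindex b > 0 \<and> qindex a \<le> m \<and> qindex b \<le> m"
  using sentence by fastforce

lemma pos_bound: "qindex a \<le> m \<Longrightarrow> Suc (pos a) < N"
  using N length_w by (cases a) auto

lemma edge_iff: "edge N w u v \<longleftrightarrow> (\<exists>(a, b)\<in>set \<Phi>. u = pos a \<and> v = pos b)"
proof
  assume "edge N w u v"
  then obtain p q where q: "q < N" "atom_at N w p u v q" unfolding edge_def by blast
  from atom_atD[OF q(2,1)] obtain a b where ab: "u = pos a" "v = pos b"
    "occurs w p (encode_atom (a, b)) q" "input_cell w q \<in> no_bit" by blast
  then have "input_cell w p = Input Edge" by simp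
  from Edge_in_sentence[OF w this] obtain a' b' q' where "(a', b') \<in> set \<Phi>"
    "occurs w p (encode_atom (a', b')) q'" "input_cell w q' \<in> no_bit" by blast
  with occurs_atom_unique[OF ab(3,4)] ab(1,2) show "\<exists>(a, b)\<in>set \<Phi>. u = pos a \<and> v = pos b" by blast
next
  assume "\<exists>(a, b)\<in>set \<Phi>. u = pos a \<and> v = pos b"
  then obtain a b where ab: "(a, b) \<in> set \<Phi>" "u = pos a" "v = pos b" by blast
  from split_list[OF ab(1)] obtain \<Phi>1 \<Phi>2 where \<Phi>: "\<Phi> = \<Phi>1 @ (a, b) # \<Phi>2" by blast
  let ?ys = "concat (replicate m [QForall, QExists]) @ concat (map encode_atom \<Phi>1)"
  let ?zs = "concat (map encode_atom \<Phi>2)"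
  let ?q = "Suc (length ?ys + length (encode_atom (a, b)))"
  have w': "w = ?ys @ encode_atom (a, b) @ ?zs" unfolding w \<Phi> by simp
  have occ: "occurs w (Suc (length ?ys)) (encode_atom (a, b)) ?q"
    by (subst w') (rule occurs_appendI)
  have "?zs = [] \<or> hd ?zs \<notin> range Bit" using hd_encode_atoms[of \<Phi>2] by auto
  from no_bit_hd[OF this, of "?ys @ encode_atom (a, b)"] have no_bit: "input_cell w ?q \<in> no_bit"
    by (subst w') (simp add: add.assoc del: encode_atom.simps)
  have q: "?q < N" using N by (subst (asm) w') (simp del: encode_atom.simps)
  have "atom_at N w (Suc (length ?ys)) (pos a) (pos b) ?q"
    using index[OF ab(1)] pos_bound by (intro atom_atI occ no_bit q) auto
  moreover have "Suc (length ?ys) < N" using q by simp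
  ultimately show "edge N w u v" unfolding edge_def ab using q by blast
qed

lemma no_edge_iff: "no_edge N w u v \<longleftrightarrow> \<not> edge N w u v"
proof
  assume *: "no_edge N w u v"
  show "\<not> edge N w u v"
  proof
    assume "edge N w u v"
    then obtain p q where q: "p < N" "q < N" "atom_at N w p u v q" unfolding edge_def by blast
    from atom_atD[OF q(3,2)] obtain a b where ab: "u = pos a" "v = pos b"
      "occurs w p (encode_atom (a, b)) q" "input_cell w q \<in> no_bit" by blast
    then have "input_cell w p = Input Edge" by simp
    with * q(1) obtain u' v' q' where q': "q' < N" "atom_at N w p u' v' q'" "u' \<noteq> u \<or> v' \<noteq> v"
      unfolding no_edge_def by blast
    from atom_atD[OF q'(2,1)] obtain a' b' where "u' = pos a'" "v' = pos b'"
      "occurs w p (encode_atom (a', b')) q'" "input_cell w q' \<in> no_bit" by blast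
    with occurs_atom_unique[OF ab(3,4)] ab(1,2) q'(3) show False by blast
  qed
next
  assume *: "\<not> edge N w u v"
  show "no_edge N w u v"
    unfolding no_edge_def
  proof (intro allI impI)
    fix p assume "p < N"
    show "input_cell w p \<in> - {Input Edge} \<or>
     (\<exists>u'<N. \<exists>v'<N. \<exists>q<N. atom_at N w p u' v' q \<and> (u' \<noteq> u \<or> v' \<noteq> v))"
    proof (cases "input_cell w p = Input Edge")
      case True
      from Edge_in_sentence[OF w this] obtain a b q where ab: "(a, b) \<in> set \<Phi>"
        "occurs w p (encode_atom (a, b)) q" "input_cell w q \<in> no_bit" by blast
      from ab(2) have "encode_atom (a, b) \<noteq> []" "\<exists>ys zs. w = ys @ encode_atom (a, b) @ zs \<and> p = Suc (length ys)"
        using occurs_split[OF ab(2)] by auto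
      then obtain ys zs where "w = ys @ encode_atom (a, b) @ zs" "p = Suc (length ys)" by blast
      with occurs_le[OF ab(2)] N have q: "q < N" by (simp del: encode_atom.simps)
      have "atom_at N w p (pos a) (pos b) q"
        using index[OF ab(1)] pos_bound q by (intro atom_atI ab) auto
      moreover have "pos a \<noteq> u \<or> pos b \<noteq> v" using * ab(1) unfolding edge_iff by blast
      moreover have "pos a < N" "pos b < N" using index[OF ab(1)] pos_bound[of a] pos_bound[of b] by auto
      ultimately show ?thesis using q by blast
    qed simp
  qed
qed

text \<open>\<open>pos\<close> embeds the variables of positive index; index \<open>0\<close> is
  excluded because truncated subtraction sends \<open>X 0\<close> and \<open>Y 0\<close> to the same
  number.\<close>

lemma reachable_iff:
  assumes "qindex a > 0" "qindex b > 0"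
  shows "(edge N w)\<^sup>*\<^sup>* (pos a) (pos b) \<longleftrightarrow> (a, b) \<in> (set \<Phi>)\<^sup>*"
proof -
  let ?E = "{(u, v). edge N w u v}"
  have "(pos a, t) \<in> ?E \<longleftrightarrow> (\<exists>b. (a, b) \<in> set \<Phi> \<and> t = pos b)" if "qindex a > 0" for a t
    using pos_inject[OF that] index unfolding edge_iff by auto blast
  moreover have "qindex b > 0" if "(a, b) \<in> set \<Phi>" for a b using index[OF that] by blast
  ultimately have "(pos a, t) \<in> ?E\<^sup>* \<longleftrightarrow> (\<exists>b. (a, b) \<in> (set \<Phi>)\<^sup>* \<and> t = pos b)" for t
    using assms(1) by (intro rtrancl_embed_iff[where P = "\<lambda>a. qindex a > 0"])
  moreover have "qindex c > 0" if "(a, c) \<in> (set \<Phi>)\<^sup>*" for c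
    using that assms(1) by (induction rule: rtrancl_induct) (use index in blast)+
  moreover have "(edge N w)\<^sup>*\<^sup>* (pos a) (pos b) \<longleftrightarrow> (pos a, pos b) \<in> ?E\<^sup>*"
    by (simp add: rtranclp_rtrancl_eq)
  ultimately show ?thesis using pos_inject[OF _ assms(2)] by auto
qed

lemma unreachable_edge_iff:
  assumes "qindex a > 0" "qindex b > 0" "qindex a \<le> m" "qindex b \<le> m"
  shows "unreachable N (edge N w) (no_edge N w) (pos a) (pos b) \<longleftrightarrow> (a, b) \<notin> (set \<Phi>)\<^sup>*"
proof -
  have "v < N - 1" if "edge N w u v" for u v
    using that index pos_bound unfolding edge_iff by fastforce
  with unreachable_iff[of "pos a" N "edge N w" "no_edge N w" "pos b"] no_edge_iff
    pos_bound[OF assms(3)] pos_bound[OF assms(4)] reachable_iff[OF assms(1,2)]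
  show ?thesis by auto
qed

text \<open>The prefix alternates from position \<open>1\<close> on and no atom contains a
  quantifier token, so within the prefix the parity of a position decides.\<close>

lemma quantifier_cells:
  "input_cell w u = Input QForall \<longleftrightarrow> (\<exists>i\<in>{1..m}. u = pos (X i))"
  "input_cell w u = Input QExists \<longleftrightarrow> (\<exists>i\<in>{1..m}. u = pos (Y i))"
proof -
  have nth: "concat (replicate m [QForall, QExists]) ! k = (if even k then QForall else QExists)"
    if "k < 2 * m" for k m
    using that
  proof (induction m arbitrary: k)
    case (Suc m)
    show ?case
    proof (cases "k < 2")
      case True
      then have "k = 0 \<or> k = 1" by auto
      then show ?thesis by auto
    next
      case False
      then obtain k' where "k = Suc (Suc k')" by (metis add_2_eq_Suc le_Suc_ex not_less)
      with Suc show ?thesis by simp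
    qed
  qed simp
  have no: "QForall \<notin> set (concat (map encode_atom \<Phi>))" "QExists \<notin> set (concat (map encode_atom \<Phi>))"
  proof -
    have "QForall \<notin> set (encode_var a)" "QExists \<notin> set (encode_var a)" for a by (cases a; auto)+
    then show "QForall \<notin> set (concat (map encode_atom \<Phi>))" "QExists \<notin> set (concat (map encode_atom \<Phi>))" by auto
  qed
  have *: "input_cell w u = Input c \<longleftrightarrow> (\<exists>k<2 * m. u = Suc k \<and> c = (if even k then QForall else QExists))"
    if "c \<in> {QForall, QExists}" for c
  proof (cases "\<exists>k<2 * m. u = Suc k")
    case True
    then obtain k where k: "u = Suc k" "k < 2 * m" by blast
    then have "w ! k = (if even k then QForall else QExists)"
      unfolding w using nth[of k m] by (simp add: nth_append length_prefix)
    with k length_w show ?thesis by (auto simp: input_cell_Suc)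
  next
    case False
    have "input_cell w u \<noteq> Input c"
    proof
      assume *: "input_cell w u = Input c"
      then obtain k where k: "u = Suc k" "k < length w" "w ! k = c"
        by (cases u) (auto simp: input_cell_Suc, simp add: input_cell_def)
      with False have "2 * m \<le> k" by auto
      with k have "k - 2 * m < length (concat (map encode_atom \<Phi>))" "concat (map encode_atom \<Phi>) ! (k - 2 * m) = c"
        unfolding w by (auto simp: nth_append length_prefix)
      then have "c \<in> set (concat (map encode_atom \<Phi>))" using nth_mem by metis
      with no that show False by auto
    qed
    with False show ?thesis by blast
  qed
  show "input_cell w u = Input QForall \<longleftrightarrow> (\<exists>i\<in>{1..m}. u = pos (X i))"
  proof -
    have "(\<exists>k<2 * m. u = Suc k \<and> even k) \<longleftrightarrow> (\<exists>i\<in>{1..m}. u = 2 * i - 1)"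
    proof
      assume "\<exists>k<2 * m. u = Suc k \<and> even k"
      then obtain j where "2 * j < 2 * m" "u = Suc (2 * j)" by (auto elim!: evenE)
      then show "\<exists>i\<in>{1..m}. u = 2 * i - 1" by (intro bexI[of _ "Suc j"]) auto
    next
      assume "\<exists>i\<in>{1..m}. u = 2 * i - 1"
      then obtain i where "i \<in> {1..m}" "u = 2 * i - 1" by blast
      then show "\<exists>k<2 * m. u = Suc k \<and> even k" by (intro exI[of _ "2 * (i - 1)"]) auto
    qed
    with *[of QForall] show ?thesis by auto
  qed
  show "input_cell w u = Input QExists \<longleftrightarrow> (\<exists>i\<in>{1..m}. u = pos (Y i))"
  proof -
    have "(\<exists>k<2 * m. u = Suc k \<and> odd k) \<longleftrightarrow> (\<exists>i\<in>{1..m}. u = 2 * i)"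
    proof
      assume "\<exists>k<2 * m. u = Suc k \<and> odd k"
      then obtain j where "2 * j + 1 < 2 * m" "u = Suc (2 * j + 1)" by (auto elim!: oddE)
      then show "\<exists>i\<in>{1..m}. u = 2 * i" by (intro bexI[of _ "Suc j"]) auto
    next
      assume "\<exists>i\<in>{1..m}. u = 2 * i"
      then obtain i where "i \<in> {1..m}" "u = 2 * i" by blast
      then show "\<exists>k<2 * m. u = Suc k \<and> odd k" by (intro exI[of _ "2 * i - 1"]) auto
    qed
    with *[of QExists] show ?thesis by auto
  qed
qed

lemma path_free_iff:
  "path_free N w \<longleftrightarrow>
    (\<forall>i\<in>{1..m}. \<forall>j\<in>{1..m}. i \<noteq> j \<longrightarrow> (X i, X j) \<notin> (set \<Phi>)\<^sup>*) \<and>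
    (\<forall>i\<in>{1..m}. \<forall>k\<in>{1..m}. k < i \<longrightarrow> (X i, Y k) \<notin> (set \<Phi>)\<^sup>* \<or> (Y k, X i) \<notin> (set \<Phi>)\<^sup>*)"
proof -
  let ?U = "unreachable N (edge N w) (no_edge N w)"
  have bound: "pos (X i) < N" "pos (Y i) < N" if "i \<in> {1..m}" for i
    using pos_bound[of "X i"] pos_bound[of "Y i"] that by auto
  have "path_free N w \<longleftrightarrow>
    (\<forall>i\<in>{1..m}. \<forall>j\<in>{1..m}. pos (X i) = pos (X j) \<or> ?U (pos (X i)) (pos (X j))) \<and>
    (\<forall>i\<in>{1..m}. \<forall>k\<in>{1..m}. pos (X i) < pos (Y k) \<or> ?U (pos (X i)) (pos (Y k)) \<or> ?U (pos (Y k)) (pos (X i)))"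
    unfolding path_free_def Compl_iff singleton_iff quantifier_cells using bound by blast
  also have "\<dots> \<longleftrightarrow>
    (\<forall>i\<in>{1..m}. \<forall>j\<in>{1..m}. i \<noteq> j \<longrightarrow> (X i, X j) \<notin> (set \<Phi>)\<^sup>*) \<and>
    (\<forall>i\<in>{1..m}. \<forall>k\<in>{1..m}. k < i \<longrightarrow> (X i, Y k) \<notin> (set \<Phi>)\<^sup>* \<or> (Y k, X i) \<notin> (set \<Phi>)\<^sup>*)"
  proof (intro conj_cong ball_cong refl)
    fix i j assume ij: "i \<in> {1..m}" "j \<in> {1..m}"
    have "?U (pos (X i)) (pos (X j)) \<longleftrightarrow> (X i, X j) \<notin> (set \<Phi>)\<^sup>*"
      by (rule unreachable_edge_iff) (use ij in auto)
    moreover have "pos (X i) = pos (X j) \<longleftrightarrow> i = j" using pos_inject[of "X i" "X j"] ij by simp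
    ultimately show "(pos (X i) = pos (X j) \<or> ?U (pos (X i)) (pos (X j))) \<longleftrightarrow> (i \<noteq> j \<longrightarrow> (X i, X j) \<notin> (set \<Phi>)\<^sup>*)"
      by blast
  next
    fix i k assume ik: "i \<in> {1..m}" "k \<in> {1..m}"
    have "?U (pos (X i)) (pos (Y k)) \<longleftrightarrow> (X i, Y k) \<notin> (set \<Phi>)\<^sup>*"
      by (rule unreachable_edge_iff) (use ik in auto)
    moreover have "?U (pos (Y k)) (pos (X i)) \<longleftrightarrow> (Y k, X i) \<notin> (set \<Phi>)\<^sup>*"
      by (rule unreachable_edge_iff) (use ik in auto)
    moreover have "pos (X i) < pos (Y k) \<longleftrightarrow> i \<le> k" using ik by auto
    ultimately show "(pos (X i) < pos (Y k) \<or> ?U (pos (X i)) (pos (Y k)) \<or> ?U (pos (Y k)) (pos (X i))) \<longleftrightarrow>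
        (k < i \<longrightarrow> (X i, Y k) \<notin> (set \<Phi>)\<^sup>* \<or> (Y k, X i) \<notin> (set \<Phi>)\<^sup>*)" by auto
  qed
  finally show ?thesis .
qed

end

section \<open>Truth in a tournament with a source and a sink\<close>

text \<open>\<open>g j\<close> computes the \<open>j\<close>-th existential answer from the
  universal moves; by the third premise it looks only at moves up to \<open>j\<close>, which have
  been made by then. It remains to check the plays that follow \<open>g\<close>.\<close>

lemma quantify_strategy:
  assumes "\<And>e'. (\<forall>v. qindex v < i \<longrightarrow> e' v = e v) \<Longrightarrow>
      (\<forall>j\<in>{i..<i + k}. e' (X j) \<in> V \<and> e' (Y j) = g j (\<lambda>l. e' (X l))) \<Longrightarrow> P e'"
    and "\<And>j \<xi>. \<forall>l\<in>{i..<i + k}. \<xi> l \<in> V \<Longrightarrow> \<forall>l<i. \<xi> l = e (X l) \<Longrightarrow> j \<in> {i..<i + k} \<Longrightarrow> g j \<xi> \<in> V"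
    and "\<And>j \<xi> \<xi>'. (\<forall>l\<le>j. \<xi> l = \<xi>' l) \<Longrightarrow> g j \<xi> = g j \<xi>'"
    and "V \<noteq> {}"
  shows "quantify V i k P e"
  using assms
proof (induction k arbitrary: i e)
  case 0
  from "0.prems"(1)[of e] show ?case by simp
next
  case (Suc k)
  show ?case
    unfolding quantify.simps
  proof
    fix a assume a: "a \<in> V"
    \<comment> \<open>Moves after \<open>i\<close> are still unknown. They get an arbitrary value in
      \<open>V\<close>, which \<open>g i\<close> ignores.\<close>
    define b where "b = g i (\<lambda>l. if l = i then a else if l < i then e (X l) else SOME x. x \<in> V)"
    have some: "(SOME x. x \<in> V) \<in> V" using Suc.prems(4) by (simp add: some_in_eq)
    have b: "b \<in> V" unfolding b_def by (rule Suc.prems(2)) (use a some in auto)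
    let ?e = "e(X i := a, Y i := b)"
    have "quantify V (Suc i) k P ?e"
    proof (rule Suc.IH)
      fix e' assume e': "\<forall>v. qindex v < Suc i \<longrightarrow> e' v = ?e v"
        "\<forall>j\<in>{Suc i..<Suc i + k}. e' (X j) \<in> V \<and> e' (Y j) = g j (\<lambda>l. e' (X l))"
      have low: "e' v = e v" if "qindex v < i" for v
      proof -
        have "v \<noteq> X i" "v \<noteq> Y i" "qindex v < Suc i" using that by auto
        with e'(1) show ?thesis by simp
      qed
      have i: "e' (X i) = a" "e' (Y i) = b" using e'(1) by auto
      have "g i (\<lambda>l. e' (X l)) = b" unfolding b_def
        by (rule Suc.prems(3)) (use i low in auto)
      with i a e'(2) have "\<forall>j\<in>{i..<i + Suc k}. e' (X j) \<in> V \<and> e' (Y j) = g j (\<lambda>l. e' (X l))"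
        by (auto simp: Suc_le_eq le_less)
      with low show "P e'" by (intro Suc.prems(1)) auto
    next
      fix j \<xi> assume *: "\<forall>l\<in>{Suc i..<Suc i + k}. \<xi> l \<in> V" "\<forall>l<Suc i. \<xi> l = ?e (X l)" "j \<in> {Suc i..<Suc i + k}"
      then have "\<xi> i = a" "\<forall>l<i. \<xi> l = e (X l)" by auto
      then have "\<forall>l\<in>{i..<i + Suc k}. \<xi> l \<in> V" using *(1) a by (auto simp: Suc_le_eq le_less)
      with * show "g j \<xi> \<in> V" using \<open>\<forall>l<i. \<xi> l = e (X l)\<close> by (intro Suc.prems(2)) auto
    qed (use Suc.prems in auto)
    with b show "\<exists>b\<in>V. quantify V (Suc i) k P (e(X i := a, Y i := b))" by blast
  qed
qed

text \<open>A true sentence has a satisfying play against every universal strategy, where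
  \<open>\<xi> j\<close> may depend on all variables of index below \<open>j\<close>. A strategy
  whose plays all violate \<open>P\<close> thus refutes the sentence.\<close>

lemma quantify_adversary:
  assumes "quantify V i k P e" "\<And>j e. \<xi> j e \<in> V"
    and "\<And>j e e'. (\<forall>v. qindex v < j \<longrightarrow> e v = e' v) \<Longrightarrow> \<xi> j e = \<xi> j e'"
  shows "\<exists>e'. P e' \<and> (\<forall>v. qindex v < i \<longrightarrow> e' v = e v) \<and>
    (\<forall>j\<in>{i..<i + k}. e' (X j) = \<xi> j e' \<and> e' (Y j) \<in> V)"
  using assms(1)
proof (induction k arbitrary: i e)
  case (Suc k)
  let ?a = "\<xi> i e"
  obtain b where b: "b \<in> V" "quantify V (Suc i) k P (e(X i := ?a, Y i := b))"
    using Suc.prems assms(2)[of i e] unfolding quantify.simps by blast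
  from Suc.IH[OF b(2)] obtain e' where e': "P e'" "\<forall>v. qindex v < Suc i \<longrightarrow> e' v = (e(X i := ?a, Y i := b)) v"
    "\<forall>j\<in>{Suc i..<Suc i + k}. e' (X j) = \<xi> j e' \<and> e' (Y j) \<in> V" by blast
  have low: "e' v = e v" if "qindex v < i" for v
  proof -
    have "v \<noteq> X i" "v \<noteq> Y i" "qindex v < Suc i" using that by auto
    with e'(2) show ?thesis by simp
  qed
  have "e' (X i) = ?a" "e' (Y i) = b" using e'(2) by auto
  moreover have "\<xi> i e = \<xi> i e'" by (rule assms(3)) (use low in auto)
  ultimately have "\<forall>j\<in>{i..<i + Suc k}. e' (X j) = \<xi> j e' \<and> e' (Y j) \<in> V"
    using e'(3) b(1) by (auto simp: Suc_le_eq le_less)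
  with e'(1) low show ?case by blast
qed auto

locale source_sink =
  fixes V :: "'v set" and E :: "'v rel" and s t :: 'v
  assumes s: "s \<in> V" "\<And>v. v \<in> V \<Longrightarrow> (s, v) \<in> E" "\<And>v. (v, s) \<in> E \<Longrightarrow> v = s"
    and t: "t \<in> V" "\<And>v. v \<in> V \<Longrightarrow> (v, t) \<in> E" "\<And>v. (t, v) \<in> E \<Longrightarrow> v = t"
    and refl: "\<And>v. v \<in> V \<Longrightarrow> (v, v) \<in> E"
    and distinct: "s \<noteq> t"
begin

text \<open>Only its loop leaves the sink, and only its loop enters the source; so \<open>t\<close>
  propagates forwards and \<open>s\<close> backwards along a path.\<close>

lemma from_sink:
  assumes "(u, v) \<in> G\<^sup>*" "\<forall>(u, v)\<in>G. (e u, e v) \<in> E"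
  shows "e u = t \<Longrightarrow> e v = t" and "e v = s \<Longrightarrow> e u = s"
proof -
  show "e v = t" if "e u = t"
    using assms(1) by (induction rule: rtrancl_induct) (use that assms(2) t(3) in fastforce)+
  show "e u = s" if "e v = s"
    using assms(1) by (induction rule: converse_rtrancl_induct) (use that assms(2) s(3) in fastforce)+
qed

text \<open>
  The universal player only needs the source and the sink. The existential player answers with the
  value of a universal variable on a common cycle if there is one, which is then unique and has
  already been played; otherwise with the sink or the source.
\<close>

lemma quantify_iff:
  assumes index: "\<And>u v. (u, v) \<in> G \<Longrightarrow> qindex u \<in> {1..m} \<and> qindex v \<in> {1..m}"
  shows "quantify V 1 m (\<lambda>e. \<forall>(u, v)\<in>G. (e u, e v) \<in> E) e \<longleftrightarrow>
    (\<forall>i\<in>{1..m}. \<forall>j\<in>{1..m}. i \<noteq> j \<longrightarrow> (X i, X j) \<notin> G\<^sup>*) \<and>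
    (\<forall>i\<in>{1..m}. \<forall>k\<in>{1..m}. k < i \<longrightarrow> (X i, Y k) \<notin> G\<^sup>* \<or> (Y k, X i) \<notin> G\<^sup>*)" (is "?Q \<longleftrightarrow> ?U \<and> ?C")
proof (intro iffI conjI ballI impI)
  fix i j assume Q: ?Q and ij: "i \<in> {1..m}" "j \<in> {1..m}" "i \<noteq> j"
  \<comment> \<open>A path from \<open>X i\<close> to \<open>X j\<close> would carry the sink to a
    variable whose value is the source.\<close>
  let ?\<xi> = "\<lambda>l (e :: qvar \<Rightarrow> 'v). if l = i then t else s"
  have "\<exists>e'. (\<forall>(u, v)\<in>G. (e' u, e' v) \<in> E) \<and> (\<forall>v. qindex v < 1 \<longrightarrow> e' v = e v) \<and>
      (\<forall>j\<in>{1..<1 + m}. e' (X j) = ?\<xi> j e' \<and> e' (Y j) \<in> V)"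
    by (rule quantify_adversary[OF Q]) (use s(1) t(1) in auto)
  then obtain e' where e': "\<forall>(u, v)\<in>G. (e' u, e' v) \<in> E" "\<forall>j\<in>{1..<1 + m}. e' (X j) = ?\<xi> j e'"
    by blast
  then have "e' (X i) = t" "e' (X j) = s" using ij by auto
  with from_sink(1)[OF _ e'(1), of "X i" "X j"] distinct show "(X i, X j) \<notin> G\<^sup>*" by auto
next
  fix i k assume Q: ?Q and ik: "i \<in> {1..m}" "k \<in> {1..m}" "k < i"
  \<comment> \<open>As \<open>k < i\<close>, the value of \<open>Y k\<close> is known when
    \<open>X i\<close> is chosen: the source is answered by the sink, anything else by the source.
    One of the two paths is then contradicted.\<close>
  let ?\<xi> = "\<lambda>l (e :: qvar \<Rightarrow> 'v). if l = i \<and> e (Y k) = s then t else s"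
  have "\<exists>e'. (\<forall>(u, v)\<in>G. (e' u, e' v) \<in> E) \<and> (\<forall>v. qindex v < 1 \<longrightarrow> e' v = e v) \<and>
      (\<forall>j\<in>{1..<1 + m}. e' (X j) = ?\<xi> j e' \<and> e' (Y j) \<in> V)"
    by (rule quantify_adversary[OF Q]) (use s(1) t(1) ik(3) in auto)
  then obtain e' where e': "\<forall>(u, v)\<in>G. (e' u, e' v) \<in> E" "\<forall>j\<in>{1..<1 + m}. e' (X j) = ?\<xi> j e'"
    by blast
  then have X_i: "e' (X i) = (if e' (Y k) = s then t else s)" using ik by auto
  show "(X i, Y k) \<notin> G\<^sup>* \<or> (Y k, X i) \<notin> G\<^sup>*"
  proof (cases "e' (Y k) = s")
    case True
    with X_i from_sink(1)[OF _ e'(1), of "X i" "Y k"] distinct show ?thesis by auto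
  next
    case False
    with X_i from_sink(2)[OF _ e'(1), of "Y k" "X i"] show ?thesis by auto
  qed
next
  assume "?U \<and> ?C"
  then have U: ?U and C: ?C by blast+
  have same: "i = j" if "i \<in> {1..m}" "j \<in> {1..m}" "(X i, X j) \<in> G\<^sup>*" for i j
    using U that by blast
  define cyc where "cyc j i \<longleftrightarrow> i \<in> {1..m} \<and> (X i, Y j) \<in> G\<^sup>* \<and> (Y j, X i) \<in> G\<^sup>*" for i j
  define g where "g j \<xi> = (if \<exists>i. cyc j i then \<xi> (SOME i. cyc j i)
    else if \<exists>i\<in>{1..m}. (X i, Y j) \<in> G\<^sup>* then t else s)" for j and \<xi> :: "nat \<Rightarrow> 'v"
  have cyc_unique: "(SOME i. cyc j i) = i" if "cyc j i" for j i
  proof -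
    have "i' = i" if "cyc j i'" for i'
      using U that \<open>cyc j i\<close> unfolding cyc_def by (meson rtrancl_trans)
    with that show ?thesis by (metis someI)
  qed
  show ?Q
  proof (rule quantify_strategy[where g = g])
    fix e' assume e': "\<forall>j\<in>{1..<1 + m}. e' (X j) \<in> V \<and> e' (Y j) = g j (\<lambda>l. e' (X l))"
    have Xe: "e' (X j) \<in> V" if "j \<in> {1..m}" for j using e' that by auto
    have Ye: "e' (Y j) = g j (\<lambda>l. e' (X l))" if "j \<in> {1..m}" for j using e' that by auto
    have g_cyc: "e' (Y j) = e' (X i)" if "cyc j i" "j \<in> {1..m}" for i j
      using that cyc_unique[OF that(1)] by (auto simp: Ye g_def)
    have Ve: "e' v \<in> V" if "qindex v \<in> {1..m}" for v
    proof (cases v)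
      case (Y j)
      show ?thesis
      proof (cases "\<exists>i. cyc j i")
        case True
        then obtain i where "cyc j i" by blast
        with g_cyc[OF this] Xe[of i] that Y show ?thesis by (auto simp: cyc_def)
      qed (use Y that s(1) t(1) Ye in \<open>auto simp: g_def\<close>)
    qed (use Xe that in auto)
    show "\<forall>(u, v)\<in>G. (e' u, e' v) \<in> E"
    proof (intro ballI, clarify)
      fix u v assume uv: "(u, v) \<in> G"
      note idx = index[OF uv]
      \<comment> \<open>In each of these cases the edge is present: the source dominates all
        vertices, all vertices dominate the sink, and there are loops.\<close>
      consider "e' u = s" | "e' v = t" | "e' u = e' v"
      proof -
        have u_cases: "e' u = s \<or> (\<exists>i\<in>{1..m}. (X i, u) \<in> G\<^sup>*) \<and> (e' u = t \<or> (\<exists>i\<in>{1..m}. (X i, u) \<in> G\<^sup>* \<and> e' u = e' (X i)))"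
        proof (cases u)
          case (X i)
          then show ?thesis using idx by auto
        next
          case (Y j)
          show ?thesis
          proof (cases "\<exists>i. cyc j i")
            case True
            then obtain i where i: "cyc j i" by blast
            with g_cyc[OF i] idx Y show ?thesis by (auto simp: cyc_def)
          next
            case False
            with Y idx show ?thesis by (auto simp: Ye g_def)
          qed
        qed
        have v_cases: "e' v = t \<or> e' v = e' (X i) \<and> (v, X i) \<in> G\<^sup>*" if i: "i \<in> {1..m}" "(X i, v) \<in> G\<^sup>*" for i
        proof (cases v)
          case (X j)
          then have "i = j" using same[of i j] i idx by simp
          then show ?thesis using X by simp
        next
          case (Y j)
          show ?thesis
          proof (cases "\<exists>i. cyc j i")
            case True
            then obtain i' where i': "cyc j i'" by blast
            then have "(X i, X i') \<in> G\<^sup>*" using i(2) Y by (auto simp: cyc_def)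
            then have "i = i'" using same[of i i'] i(1) i' by (simp add: cyc_def)
            with g_cyc[OF i'] i' idx Y show ?thesis by (auto simp: cyc_def)
          next
            case False
            with Y idx i show ?thesis by (auto simp: Ye g_def)
          qed
        qed
        show ?thesis
        proof (cases "e' u = s \<or> e' v = t")
          \<comment> \<open>Here \<open>u\<close> is reachable from some \<open>X i\<close>, and
            hence so is \<open>v\<close>. Since \<open>v\<close> does not have the sink as value, it
            leads back to \<open>X i\<close>, which puts \<open>u\<close> on the same cycle.\<close>
          case False
          with u_cases obtain i where i: "i \<in> {1..m}" "(X i, u) \<in> G\<^sup>*" by blast
          then have iv: "(X i, v) \<in> G\<^sup>*" using uv by simp
          with v_cases[OF i(1) iv] False have v: "e' v = e' (X i)" "(v, X i) \<in> G\<^sup>*" by auto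
          have "(u, X i) \<in> G\<^sup>*" using uv v(2) by (meson converse_rtrancl_into_rtrancl)
          have "e' u = e' (X i)"
          proof (cases u)
            case (X j)
            then have "j = i" using same[of j i] i idx \<open>(u, X i) \<in> G\<^sup>*\<close> by simp
            then show ?thesis using X by simp
          next
            case (Y j)
            then have "cyc j i" using i \<open>(u, X i) \<in> G\<^sup>*\<close> by (simp add: cyc_def)
            from g_cyc[OF this] idx Y show ?thesis by simp
          qed
          with v that show ?thesis by simp
        qed (use that in blast)
      qed
      then show "(e' u, e' v) \<in> E"
        using s(2) t(2) refl Ve idx by cases auto
    qed
  next
    fix j and \<xi> :: "nat \<Rightarrow> 'v" assume "\<forall>l\<in>{1..<1 + m}. \<xi> l \<in> V" "j \<in> {1..<1 + m}"
    then show "g j \<xi> \<in> V"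
      using s(1) t(1) cyc_unique by (auto simp: g_def) (auto simp: cyc_def)
  next
    fix j and \<xi> \<xi>' :: "nat \<Rightarrow> 'v" assume eq: "\<forall>l\<le>j. \<xi> l = \<xi>' l"
    show "g j \<xi> = g j \<xi>'"
    proof (cases "\<exists>i. cyc j i")
      case True
      then obtain i where i: "cyc j i" by blast
      then have "(X i, Y j) \<in> G\<^sup>*" by (simp add: cyc_def)
      then obtain z where "(z, Y j) \<in> G" by (cases rule: rtranclE) auto
      with index have j: "j \<in> {1..m}" by fastforce
      \<comment> \<open>This is where the second path condition enters: a universal variable on a
        cycle with \<open>Y j\<close> is quantified before it, so the answer may use its
        value.\<close>
      have "i \<le> j"
      proof (rule ccontr)
        assume "\<not> i \<le> j"
        then have "j < i" by simp
        with C i j show False unfolding cyc_def by blast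
      qed
      with eq cyc_unique[OF i] True show ?thesis by (simp add: g_def)
    qed (simp add: g_def)
  qed (use s(1) in auto)
qed

end

text \<open>Covers the tournament with a single vertex, where source and sink coincide.\<close>

lemma quantify_always:
  assumes "\<And>e'. (\<forall>v. qindex v \<in> {i..<i + k} \<longrightarrow> e' v \<in> V) \<Longrightarrow> P e'" "V \<noteq> {}"
  shows "quantify V i k P e"
proof -
  obtain x where "x \<in> V" using assms(2) by blast
  show ?thesis
  proof (rule quantify_strategy[where g = "\<lambda>_ _. x"])
    fix e' assume e': "\<forall>j\<in>{i..<i + k}. e' (X j) \<in> V \<and> e' (Y j) = x"
    show "P e'"
    proof (rule assms(1), intro allI impI)
      fix v assume "qindex v \<in> {i..<i + k}"
      with e' \<open>x \<in> V\<close> show "e' v \<in> V" by (cases v) auto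
    qed
  qed (use \<open>x \<in> V\<close> in auto)
qed

section \<open>Strong components\<close>

text \<open>The vertex of the first component has edges to all other components by their order and
  to itself by reflexivity; dually for the last one. With only one component the two vertices
  coincide.\<close>

lemma single_component_ends:
  assumes H: "reflexive_tournament H" and Hs: "scc_decomposition H Hs"
    and "card (verts (hd Hs)) = 1" "card (verts (last Hs)) = 1"
  shows "\<exists>s\<in>pverts H. \<exists>t\<in>pverts H. \<forall>v\<in>pverts H. (s, v) \<in> parcs H \<and> (v, t) \<in> parcs H"
proof -
  interpret pair_fin_digraph H using H by (simp add: reflexive_tournament_def)
  have ne: "pverts H \<noteq> {}" and refl: "\<And>v. v \<in> pverts H \<Longrightarrow> (v, v) \<in> parcs H"
    using H by (auto simp: reflexive_tournament_def)
  have set: "set Hs = sccs" using Hs by (simp add: scc_decomposition_def)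
  have order: "(u, v) \<in> parcs H"
    if "i < length Hs" "j < length Hs" "i < j" "u \<in> verts (Hs ! i)" "v \<in> verts (Hs ! j)" for i j u v
  proof -
    have "i \<noteq> j" using that(3) by simp
    with Hs that show ?thesis unfolding scc_decomposition_def by blast
  qed
  have cover: "\<exists>i<length Hs. v \<in> verts (Hs ! i)" if "v \<in> pverts H" for v
  proof -
    have "scc_of v \<in> sccs_verts" "v \<in> scc_of v"
      using that scc_of_in_sccs_verts[of v] in_scc_of_self[of v] by simp_all
    then obtain c where "c \<in> sccs" "v \<in> verts c" unfolding sccs_verts_conv by blast
    with set show ?thesis by (metis in_set_conv_nth)
  qed
  have sub: "verts (Hs ! i) \<subseteq> pverts H" if "i < length Hs" for i
  proof -
    have "verts (Hs ! i) \<in> sccs_verts" unfolding sccs_verts_conv using set nth_mem[OF that] by blast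
    from sccs_verts_subsets[OF this] show ?thesis by simp
  qed
  define l where "l = length Hs - 1"
  have len: "0 < length Hs" using cover ne by fastforce
  then have l: "l < length Hs" "\<And>i. i < length Hs \<Longrightarrow> i \<noteq> l \<Longrightarrow> i < l" by (auto simp: l_def)
  have "card (verts (Hs ! 0)) = 1" "card (verts (Hs ! l)) = 1"
    using assms(3,4) len by (simp_all add: hd_conv_nth last_conv_nth l_def)
  then obtain s t where s: "verts (Hs ! 0) = {s}" and t: "verts (Hs ! l) = {t}"
    by (meson card_1_singletonE)
  have "(s, v) \<in> parcs H \<and> (v, t) \<in> parcs H" if v: "v \<in> pverts H" for v
  proof -
    from cover[OF v] obtain i where i: "i < length Hs" "v \<in> verts (Hs ! i)" by blast
    have "(s, v) \<in> parcs H"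
    proof (cases "i = 0")
      case True
      then show ?thesis using i s refl[OF v] by simp
    qed (use order[OF len i(1) _ _ i(2), of s] s in auto)
    moreover have "(v, t) \<in> parcs H"
    proof (cases "i = l")
      case True
      then show ?thesis using i t refl[OF v] by simp
    qed (use order[OF i(1) l(1) _ i(2), of t] l(2)[OF i(1)] t in auto)
    ultimately show ?thesis ..
  qed
  moreover have "s \<in> pverts H" "t \<in> pverts H" using sub[OF len] sub[OF l(1)] s t by auto
  ultimately show ?thesis by blast
qed

theorem theorem4p3:
  fixes H :: "'v pair_pre_digraph" and Hs :: "('v, 'v \<times> 'v) pre_digraph list"
  assumes "reflexive_tournament H"
    and "scc_decomposition H Hs"
    and "card (verts (hd Hs)) = 1"
    and "card (verts (last Hs)) = 1"
  shows "QCSP H \<in> NL"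
proof -
  from single_component_ends[OF assms] obtain s t where s: "s \<in> pverts H" "\<And>v. v \<in> pverts H \<Longrightarrow> (s, v) \<in> parcs H"
    and t: "t \<in> pverts H" "\<And>v. v \<in> pverts H \<Longrightarrow> (v, t) \<in> parcs H" by blast
  have refl: "\<And>v. v \<in> pverts H \<Longrightarrow> (v, v) \<in> parcs H"
    and antisym: "\<And>u v. u \<in> pverts H \<Longrightarrow> v \<in> pverts H \<Longrightarrow> (u, v) \<in> parcs H \<Longrightarrow> (v, u) \<in> parcs H \<Longrightarrow> u = v"
    and wf: "pair_wf_digraph H"
    using assms(1) by (auto simp: reflexive_tournament_def pair_fin_digraph_def)
  have arc: "u \<in> pverts H \<and> v \<in> pverts H" if "(u, v) \<in> parcs H" for u v
    using pair_wf_digraph.in_arcsD1[OF wf that] pair_wf_digraph.in_arcsD2[OF wf that] by simp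
  \<comment> \<open>\<open>cap (length w)\<close> takes the role of \<open>N\<close>; it exceeds
    \<open>length w + 1\<close>, as the correctness statements demand.\<close>
  have true_iff: "true_in H (m, \<Phi>) \<longleftrightarrow> s = t \<or> path_free (cap (length w)) w"
    if w: "w = encode (m, \<Phi>)" and sentence: "is_sentence (m, \<Phi>)" for w m \<Phi>
  proof (cases "s = t")
    case True
    then have single: "v = s" if "v \<in> pverts H" for v using s t antisym that by blast
    have "quantify (pverts H) 1 m (\<lambda>e. \<forall>(u, v)\<in>set \<Phi>. (e u, e v) \<in> parcs H) e" for e
    proof (rule quantify_always)
      fix e assume e: "\<forall>v. qindex v \<in> {1..<1 + m} \<longrightarrow> e v \<in> pverts H"
      have "(e u, e v) \<in> parcs H" if "(u, v) \<in> set \<Phi>" for u v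
      proof -
        have "qindex u \<in> {1..<1 + m}" "qindex v \<in> {1..<1 + m}" using sentence that by auto
        then have "e u = s" "e v = s" using e single by blast+
        then show ?thesis using refl[OF s(1)] by simp
      qed
      then show "\<forall>(u, v)\<in>set \<Phi>. (e u, e v) \<in> parcs H" by blast
    qed (use s(1) in blast)
    with True show ?thesis by simp
  next
    case False
    interpret source_sink "pverts H" "parcs H" s t
    proof
      show "v = s" if "(v, s) \<in> parcs H" for v using antisym[of v s] arc[OF that] s that by blast
      show "v = t" if "(t, v) \<in> parcs H" for v using antisym[of v t] arc[OF that] t that by blast
    qed (use s t refl False in auto)
    have "qindex u \<in> {1..m} \<and> qindex v \<in> {1..m}" if "(u, v) \<in> set \<Phi>" for u v
      using sentence that by auto
    from quantify_iff[OF this] path_free_iff[OF w sentence cap_gt] False show ?thesis by simp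
  qed
  have "QCSP H = {w. valid (cap (length w)) w \<and> (s = t \<or> path_free (cap (length w)) w)}"
  proof (intro set_eqI)
    fix w
    have "w \<in> QCSP H \<longleftrightarrow> (\<exists>m \<Phi>. is_sentence (m, \<Phi>) \<and> w = encode (m, \<Phi>) \<and> true_in H (m, \<Phi>))"
      unfolding QCSP_def by auto
    also have "\<dots> \<longleftrightarrow> (\<exists>m \<Phi>. is_sentence (m, \<Phi>) \<and> w = encode (m, \<Phi>)) \<and> (s = t \<or> path_free (cap (length w)) w)"
      using true_iff by blast
    finally show "w \<in> QCSP H \<longleftrightarrow> w \<in> {w. valid (cap (length w)) w \<and> (s = t \<or> path_free (cap (length w)) w)}"
      unfolding valid_iff[OF cap_gt] by blast
  qed
  \<comment> \<open>Whether \<open>s = t\<close> holds depends on \<open>H\<close> and not on the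
    input, so it is a constant test.\<close>
  moreover have "test 0 (\<lambda>w \<sigma>. valid (cap (length w)) w \<and> (s = t \<or> path_free (cap (length w)) w))"
    by (intro test_conj test_disj test_valid test_const test_path_free)
  ultimately show ?thesis using test_NL by simp
qed

end
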